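(* Suppose that a knot $K$ is represented by a symmetric union diagram $D$ with partial knots $K_-$ and $K_+$. Then: (1) $W_D(t,t)=V_K(t)$, the Jones polynomial of $K$. (2) $W_D(-1,t)=V_{K_-}(t)\cdot V_{K_+}(t)$. In particular, both specializations together imply $W_D(-1,-1)=\det(K)=\det(K_-)\cdot\det(K_+)$.
   Context: Diagrams: we consider planar link diagrams in $\mathbb{R}^2$ transverse to the axis $\{0\}\times\mathbb{R}$; crossings may lie on the axis. Let $\rho(x,y)=(-x,y)$. A diagram is symmetric if $\rho(D)=D$ (including over/under information) except for crossings on the axis, which are necessarily reversed by $\rho$. A symmetric union is a symmetric diagram such that each component is mapped to itself by $\rho$ with reversed orientation; equivalently each component perpendicularly traverses the axis in exactly two points that are not crossings. Here $D$ has one component. Crossings on the axis: such a crossing has two ends on the left and two on the right. It is of type $X_o$ if the overstrand runs from upper left to lower right, $X_u$ if it runs from lower left to upper right. The horizontal smoothing $h$ joins upper left to upper right and lower left to lower right; the vertical smoothing $v$ joins the two left ends to each other and the two right ends to each other (without meeting the axis). Partial knots: apply the vertical smoothing $v$ to every crossing on the axis; then only the two perpendicular traversals of the axis remain; replace these two horizontal strands by two vertical strands, one on each side of the axis. One obtains disjoint diagrams $D_-$ in $\{x<0\}$ and $D_+$ in $\{x>0\}$; the knots $K_-,K_+$ they represent are the partial knots of $D$ (mirror images of one another). $W$: the bracket $\langle D\rangle\in\mathbb{Z}(A,B)$ is defined (forgetting orientations) by: (A) for a crossing off the axis, $\langle D\rangle=A\langle D_A\rangle+A^{-1}\langle D_B\rangle$,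 where $D_A$ is the smoothing joining the two regions swept out when the overstrand is turned counterclockwise to the understrand, $D_B$ the other smoothing; (B) on the axis, $\langle X_o\rangle=B\langle h\rangle+B^{-1}\langle v\rangle$ and $\langle X_u\rangle=B^{-1}\langle h\rangle+B\langle v\rangle$; (C) for $n$ disjoint circles without crossings meeting the axis in $2m$ points, $\langle C\rangle=(-A^2-A^{-2})^{n-m}(-B^2-B^{-2})^{m-1}$. Let $\alpha(D)$ (resp. $\beta(D)$) be the sum of crossing signs off (resp. on) the axis, and $W_D=W_D(s,t)=\langle D\rangle(-A^{-3})^{\alpha(D)}(-B^{-3})^{\beta(D)}$, rewritten via $A^2=t^{-1/2}$, $B^2=s^{-1/2}$. For a symmetric union knot diagram, $W_D\in\mathbb{Z}[s^{\pm1},t^{\pm1}]$. The Jones polynomial is normalized to $1$ on the unknot (and $V=t+t^3-t^4$ for the trefoil with positive crossings); $\det(K)=|V_K(-1)|=|\Delta_K(-1)|$ is the knot determinant. *)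

theory Defs
  imports
    "HOL-Computational_Algebra.Fraction_Field"
    "HOL-Computational_Algebra.Polynomial"
    "HOL-Library.Poly_Mapping"
    "HOL-Library.Product_Plus"
begin

section \<open>Planar link diagrams\<close>

text \<open>
  A planar link diagram, up to planar isotopy, is put in general position with respect to
  the height function and read from bottom to top as the list of its events.  Between two
  events the diagram consists of finitely many strands, counted from the left starting with 0.
  An event \<open>(i, p)\<close> involves the strands at positions \<open>i\<close> and \<open>i + 1\<close>:
  \<open>Cup\<close> is a local minimum, creating these two strands; \<open>Cap\<close> is a local maximum, ending
  them; \<open>Xo\<close> and \<open>Xu\<close> are crossings between them, the overstrand running from upper
  left to lower right for \<open>Xo\<close>, and from lower left to upper right for \<open>Xu\<close>.
\<close>

datatype piece = Cup | Cap | Xo | Xu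

type_synonym diagram = "(nat \<times> piece) list"

definition is_crossing :: "piece \<Rightarrow> bool" where
  "is_crossing p \<longleftrightarrow> p = Xo \<or> p = Xu"

fun mirror :: "piece \<Rightarrow> piece" where
  "mirror Xo = Xu" | "mirror Xu = Xo" | "mirror Cup = Cup" | "mirror Cap = Cap"

text \<open>Number of strands above an event, given the number \<open>n\<close> of strands below it.\<close>

fun strands_after :: "piece \<Rightarrow> nat \<Rightarrow> nat" where
  "strands_after Cup n = n + 2"
| "strands_after Cap n = n - 2"
| "strands_after _ n = n"

fun wf_from :: "nat \<Rightarrow> diagram \<Rightarrow> bool" where
  "wf_from n [] \<longleftrightarrow> n = 0"
| "wf_from n ((i, p) # D) \<longleftrightarrow>
     (if p = Cup then i \<le> n else i + 2 \<le> n) \<and> wf_from (strands_after p n) D"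

definition link_diagram :: "diagram \<Rightarrow> bool" where
  "link_diagram D \<longleftrightarrow> wf_from 0 D"


subsection \<open>Components and orientations\<close>

text \<open>
  \<open>(l, j)\<close> is the point where the strand at position \<open>j\<close> meets a horizontal line between
  the first \<open>l\<close> events and the rest.
\<close>

type_synonym point = "nat \<times> nat"

definition width :: "diagram \<Rightarrow> nat \<Rightarrow> nat" where
  "width D l = fold (\<lambda>e. strands_after (snd e)) (take l D) 0"

definition points :: "diagram \<Rightarrow> point set" where
  "points D = {(l, j). l \<le> length D \<and> j < width D l}"

text \<open>Position above an event of the strand that enters it at position \<open>j\<close>.\<close>

fun through :: "nat \<times> piece \<Rightarrow> nat \<Rightarrow> nat option" where
  "through (i, Cup) j = Some (if j < i then j else j + 2)"
| "through (i, Cap) j = (if j < i then Some j else if j < i + 2 then None else Some (j - 2))"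
| "through (i, _) j = Some (if j = i then i + 1 else if j = i + 1 then i else j)"

definition rising :: "diagram \<Rightarrow> (point \<times> point) set" where
  "rising D = {((l, j), (Suc l, j')) | l j j'.
     l < length D \<and> j < width D l \<and> through (D ! l) j = Some j'}"

definition turning :: "diagram \<Rightarrow> (point \<times> point) set" where
  "turning D = {((Suc l, i), (Suc l, Suc i)) | l i. l < length D \<and> D ! l = (i, Cup)}
             \<union> {((l, i), (l, Suc i)) | l i. l < length D \<and> D ! l = (i, Cap)}"

definition connected_points :: "diagram \<Rightarrow> (point \<times> point) set" where
  "connected_points D = (let r = rising D \<union> turning D in (r \<union> r\<inverse>)\<^sup>*)"

definition components :: "diagram \<Rightarrow> point set set" where
  "components D = points D // connected_points D"

definition knot_diagram :: "diagram \<Rightarrow> bool" where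
  "knot_diagram D \<longleftrightarrow> link_diagram D \<and> card (components D) = 1"

text \<open>\<open>up x\<close> says that the diagram is traversed upwards at the point \<open>x\<close>.\<close>

definition orientation :: "diagram \<Rightarrow> (point \<Rightarrow> bool) \<Rightarrow> bool" where
  "orientation D up \<longleftrightarrow>
     (\<forall>(x, y) \<in> rising D. up x = up y) \<and> (\<forall>(x, y) \<in> turning D. up x \<noteq> up y)"

text \<open>
  With both strands directed upwards, \<open>Xu\<close> is positive and \<open>Xo\<close> is negative; reversing
  one strand changes the sign.
\<close>

definition crossing_sign :: "diagram \<Rightarrow> (point \<Rightarrow> bool) \<Rightarrow> nat \<Rightarrow> int" where
  "crossing_sign D up l = (case D ! l of (i, p) \<Rightarrow>
     if is_crossing p
     then (if (p = Xu) = (up (l, i) = up (l, Suc i)) then 1 else -1)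
     else 0)"

text \<open>
  The signs of the crossings of a knot diagram do not depend on the choice of its orientation.
\<close>

definition chosen_orientation :: "diagram \<Rightarrow> point \<Rightarrow> bool" where
  "chosen_orientation D = (SOME up. orientation D up)"

definition writhe :: "diagram \<Rightarrow> int" where
  "writhe D = (\<Sum>l<length D. crossing_sign D (chosen_orientation D) l)"


subsection \<open>Knots\<close>

text \<open>
  Isotopy of links is presented by the Reidemeister moves together with the moves that realise
  planar isotopies of event lists: exchanging the heights of two distant events, straightening a
  strand, and sliding a strand across a local extremum.  In \<open>distant\<close>, the second event
  lies to the right of the first one.
\<close>

inductive move :: "diagram \<Rightarrow> diagram \<Rightarrow> bool" where
  distant: "i + (if p = Cap then 0 else 2) \<le> j \<Longrightarrow>
     move [(i, p), (j, q)]
          [(j + (if p = Cup then 0 else 2) - (if p = Cap then 0 else 2), q), (i, p)]"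
| straighten1: "move [(i, Cup), (Suc i, Cap)] []"
| straighten2: "move [(Suc i, Cup), (i, Cap)] []"
| slide_cup: "is_crossing p \<Longrightarrow>
     move [(i, Cup), (Suc i, p)] [(Suc i, Cup), (i, mirror p)]"
| slide_cap: "is_crossing p \<Longrightarrow>
     move [(Suc i, p), (i, Cap)] [(i, mirror p), (Suc i, Cap)]"
| R1_cup: "is_crossing p \<Longrightarrow> move [(i, Cup), (i, p)] [(i, Cup)]"
| R1_cap: "is_crossing p \<Longrightarrow> move [(i, p), (i, Cap)] [(i, Cap)]"
| R2: "is_crossing p \<Longrightarrow> move [(i, p), (i, mirror p)] []"
| R3: "is_crossing p \<Longrightarrow>
     move [(i, p), (Suc i, p), (i, p)] [(Suc i, p), (i, p), (Suc i, p)]"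

definition local_move :: "diagram \<Rightarrow> diagram \<Rightarrow> bool" where
  "local_move D E \<longleftrightarrow> link_diagram D \<and> link_diagram E \<and>
     (\<exists>u x y v. D = u @ x @ v \<and> E = u @ y @ v \<and> move x y)"

text \<open>
  A knot is the class of all diagrams representing it; \<open>D \<in> K\<close> means that \<open>D\<close>
  represents \<open>K\<close>.
\<close>

type_synonym knot = "diagram set"

definition knots :: "knot set" where
  "knots = {D. knot_diagram D} //
     {(D, E). knot_diagram D \<and> knot_diagram E \<and> equivclp local_move D E}"


section \<open>Laurent polynomials\<close>

text \<open>
  The group rings of the groups of integers and of pairs of integers.  The pair \<open>(i, j)\<close> is the
  exponent of the monomial \<open>s\<^sup>i t\<^sup>j\<close>.
\<close>

type_synonym laurent = "int \<Rightarrow>\<^sub>0 int"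

type_synonym laurent2 = "(int \<times> int) \<Rightarrow>\<^sub>0 int"

definition var_t :: laurent where
  "var_t = Poly_Mapping.single 1 1"

text \<open>Integral powers of a unit, and substitution of units for the variables.\<close>

definition unit_inverse :: "'a::comm_ring_1 \<Rightarrow> 'a" where
  "unit_inverse x = (THE y. x * y = 1)"

definition unit_power :: "'a::comm_ring_1 \<Rightarrow> int \<Rightarrow> 'a" where
  "unit_power x k = (if k \<ge> 0 then x ^ nat k else unit_inverse x ^ nat (- k))"

definition subst1 :: "laurent \<Rightarrow> 'a::comm_ring_1 \<Rightarrow> 'a" where
  "subst1 V y = (\<Sum>j \<in> Poly_Mapping.keys V. of_int (Poly_Mapping.lookup V j) * unit_power y j)"

definition subst2 :: "laurent2 \<Rightarrow> 'a::comm_ring_1 \<Rightarrow> 'a \<Rightarrow> 'a" where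
  "subst2 W x y = (\<Sum>(i, j) \<in> Poly_Mapping.keys W.
     of_int (Poly_Mapping.lookup W (i, j)) * unit_power x i * unit_power y j)"

text \<open>The field of rational functions in \<open>A\<close> and \<open>B\<close>.\<close>

type_synonym ratfun = "int poly poly fract"

definition var_A :: ratfun where
  "var_A = Fraction_Field.Fract [:[:0, 1:]:] 1"

definition var_B :: ratfun where
  "var_B = Fraction_Field.Fract [:0, 1:] 1"

definition circle_value :: "ratfun \<Rightarrow> ratfun" where
  "circle_value c = - (c powi 2) - c powi (-2)"


section \<open>The Jones polynomial\<close>

text \<open>
  The smoothing that joins the upper two and the lower two ends of a crossing at \<open>i\<close>
  sideways is \<open>[(i, Cap), (i, Cup)]\<close>, and the one that joins the ends vertically on each side is
  \<open>[]\<close>.  Turned counterclockwise, the overstrand of \<open>Xo\<close> sweeps out the regions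
  on the left and on the right, which the former smoothing joins; for \<open>Xu\<close> it sweeps out those
  above and below.  The argument \<open>S\<close> collects the part that is already smoothed.
\<close>

fun kauffman_from :: "diagram \<Rightarrow> diagram \<Rightarrow> ratfun" where
  "kauffman_from S [] = circle_value var_A powi (int (card (components S)) - 1)"
| "kauffman_from S ((i, p) # D) =
     (let h = kauffman_from (S @ [(i, Cap), (i, Cup)]) D; v = kauffman_from S D in
      case p of
        Xo \<Rightarrow> var_A * h + inverse var_A * v
      | Xu \<Rightarrow> inverse var_A * h + var_A * v
      | _ \<Rightarrow> kauffman_from (S @ [(i, p)]) D)"

definition kauffman_bracket :: "diagram \<Rightarrow> ratfun" where
  "kauffman_bracket D = kauffman_from [] D"

text \<open>The variable of the Jones polynomial is \<open>t = A\<^sup>-\<^sup>4\<close>.\<close>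

definition jones :: "knot \<Rightarrow> laurent" where
  "jones K = (THE V. \<forall>D\<in>K.
     subst1 V (var_A powi (-4)) = kauffman_bracket D * (- (var_A powi (-3))) powi writhe D)"

definition knot_det :: "knot \<Rightarrow> int" where
  "knot_det K = \<bar>subst1 (jones K) (- 1)\<bar>"


section \<open>Diagrams with an axis\<close>

text \<open>
  Diagrams transverse to the vertical axis, up to isotopy preserving the axis, are again encoded by
  lists of events, read from bottom to top.  We may assume that strands traverse the axis
  perpendicularly at local extrema.  On each side, strands are counted from the axis outwards,
  starting with 0: \<open>(L k, p)\<close> and \<open>(R k, p)\<close> involve the strands \<open>k\<close> and \<open>k + 1\<close> on the left or
  on the right, and \<open>(Axis, p)\<close> involves the innermost strand on either side.  So
  \<open>(Axis, Cup)\<close> and \<open>(Axis, Cap)\<close> are the traversals of the axis that are not crossings.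
\<close>

datatype place = L nat | R nat | Axis

type_synonym axis_diagram = "(place \<times> piece) list"

fun wf_axis_from :: "nat \<Rightarrow> nat \<Rightarrow> axis_diagram \<Rightarrow> bool" where
  "wf_axis_from a b [] \<longleftrightarrow> a = 0 \<and> b = 0"
| "wf_axis_from a b ((L k, p) # D) \<longleftrightarrow>
     (if p = Cup then k \<le> a else k + 2 \<le> a) \<and> wf_axis_from (strands_after p a) b D"
| "wf_axis_from a b ((R k, p) # D) \<longleftrightarrow>
     (if p = Cup then k \<le> b else k + 2 \<le> b) \<and> wf_axis_from a (strands_after p b) D"
| "wf_axis_from a b ((Axis, Cup) # D) \<longleftrightarrow> wf_axis_from (a + 1) (b + 1) D"
| "wf_axis_from a b ((Axis, Cap) # D) \<longleftrightarrow> 1 \<le> a \<and> 1 \<le> b \<and> wf_axis_from (a - 1) (b - 1) D"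
| "wf_axis_from a b ((Axis, _) # D) \<longleftrightarrow> 1 \<le> a \<and> 1 \<le> b \<and> wf_axis_from a b D"

text \<open>The underlying link diagram; \<open>a\<close> is the current number of strands on the left.\<close>

fun forget_from :: "nat \<Rightarrow> axis_diagram \<Rightarrow> diagram" where
  "forget_from a [] = []"
| "forget_from a ((L k, p) # D) =
     ((if p = Cup then a - k else a - k - 2), p) # forget_from (strands_after p a) D"
| "forget_from a ((R k, p) # D) = (a + k, p) # forget_from a D"
| "forget_from a ((Axis, Cup) # D) = (a, Cup) # forget_from (a + 1) D"
| "forget_from a ((Axis, Cap) # D) = (a - 1, Cap) # forget_from (a - 1) D"
| "forget_from a ((Axis, p) # D) = (a - 1, p) # forget_from a D"

definition forget_axis :: "axis_diagram \<Rightarrow> diagram" where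
  "forget_axis D = forget_from 0 D"

definition traversals :: "axis_diagram \<Rightarrow> nat set" where
  "traversals D = {l. l < length D \<and> fst (D ! l) = Axis \<and> \<not> is_crossing (snd (D ! l))}"

text \<open>The left one of the two points adjacent to the traversal of the axis at the event \<open>l\<close>.\<close>

definition traversal_point :: "axis_diagram \<Rightarrow> nat \<Rightarrow> point" where
  "traversal_point D l = (case forget_axis D ! l of (i, p) \<Rightarrow> if p = Cup then (Suc l, i) else (l, i))"


subsection \<open>Symmetric unions\<close>

fun reflect_place :: "place \<Rightarrow> place" where
  "reflect_place (L k) = R k" | "reflect_place (R k) = L k" | "reflect_place Axis = Axis"

text \<open>The reflection \<open>(x, y) \<mapsto> (-x, y)\<close>, preserving over/under information.\<close>

definition reflect :: "axis_diagram \<Rightarrow> axis_diagram" where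
  "reflect D = map (\<lambda>(a, p). (reflect_place a, mirror p)) D"

definition switch_on_axis :: "axis_diagram \<Rightarrow> axis_diagram" where
  "switch_on_axis D = map (\<lambda>(a, p). (a, if a = Axis then mirror p else p)) D"

text \<open>
  Events on the left and events on the right can pass each other in height.  So only the order of
  the events on each closed half plane matters.
\<close>

definition same_halves :: "axis_diagram \<Rightarrow> axis_diagram \<Rightarrow> bool" where
  "same_halves D E \<longleftrightarrow>
     filter (\<lambda>(a, p). \<forall>k. a \<noteq> R k) D = filter (\<lambda>(a, p). \<forall>k. a \<noteq> R k) E \<and>
     filter (\<lambda>(a, p). \<forall>k. a \<noteq> L k) D = filter (\<lambda>(a, p). \<forall>k. a \<noteq> L k) E"

definition symmetric :: "axis_diagram \<Rightarrow> bool" where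
  "symmetric D \<longleftrightarrow> wf_axis_from 0 0 D \<and> same_halves (switch_on_axis (reflect D)) D"

definition symmetric_union :: "axis_diagram \<Rightarrow> bool" where
  "symmetric_union D \<longleftrightarrow> symmetric D \<and>
     (\<forall>C \<in> components (forget_axis D). card {l \<in> traversals D. traversal_point D l \<in> C} = 2)"


subsection \<open>Partial knots\<close>

definition smooth_axis_vertically :: "axis_diagram \<Rightarrow> axis_diagram" where
  "smooth_axis_vertically D = filter (\<lambda>(a, p). \<not> (a = Axis \<and> is_crossing p)) D"

text \<open>
  Replaces the two traversals by two vertical strands, which join them on the two sides of the
  axis.  The flag tells whether the current height is between the traversals.  There, the vertical
  strands are the innermost ones, and so all other strands are shifted outwards by one.  A local
  minimum is continued upwards and a local maximum downwards; hence the new strand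
  and the old one either form an extremum at the traversal or continue each other.
\<close>

fun split_from :: "bool \<Rightarrow> axis_diagram \<Rightarrow> axis_diagram" where
  "split_from between [] = []"
| "split_from between ((L k, p) # D) =
     (L (if between then Suc k else k), p) # split_from between D"
| "split_from between ((R k, p) # D) =
     (R (if between then Suc k else k), p) # split_from between D"
| "split_from False ((Axis, Cup) # D) = [(L 0, Cup), (R 0, Cup)] @ split_from True D"
| "split_from False ((Axis, Cap) # D) = split_from True D"
| "split_from True ((Axis, Cup) # D) = split_from False D"
| "split_from True ((Axis, Cap) # D) = [(L 0, Cap), (R 0, Cap)] @ split_from False D"
| "split_from between ((Axis, p) # D) = (Axis, p) # split_from between D"

definition split_along_axis :: "axis_diagram \<Rightarrow> axis_diagram" where
  "split_along_axis D = split_from False (smooth_axis_vertically D)"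

definition partial_minus :: "axis_diagram \<Rightarrow> diagram" where
  "partial_minus D = forget_axis (filter (\<lambda>(a, p). \<exists>k. a = L k) (split_along_axis D))"

definition partial_plus :: "axis_diagram \<Rightarrow> diagram" where
  "partial_plus D = forget_axis (filter (\<lambda>(a, p). \<exists>k. a = R k) (split_along_axis D))"


subsection \<open>The two-variable bracket and the polynomial W\<close>

fun axis_bracket_from :: "axis_diagram \<Rightarrow> axis_diagram \<Rightarrow> ratfun" where
  "axis_bracket_from S [] =
     (let n = int (card (components (forget_axis S))); m = int (card (traversals S) div 2) in
      circle_value var_A powi (n - m) * circle_value var_B powi (m - 1))"
| "axis_bracket_from S ((a, p) # D) =
     (let h = axis_bracket_from (S @ [(a, Cap), (a, Cup)]) D; v = axis_bracket_from S D;
          c = (if a = Axis then var_B else var_A) in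
      case p of
        Xo \<Rightarrow> c * h + inverse c * v
      | Xu \<Rightarrow> inverse c * h + c * v
      | _ \<Rightarrow> axis_bracket_from (S @ [(a, p)]) D)"

definition axis_bracket :: "axis_diagram \<Rightarrow> ratfun" where
  "axis_bracket D = axis_bracket_from [] D"

text \<open>The sums of the crossing signs off the axis and on the axis.\<close>

definition alpha :: "axis_diagram \<Rightarrow> int" where
  "alpha D = (\<Sum>l | l < length D \<and> fst (D ! l) \<noteq> Axis.
     crossing_sign (forget_axis D) (chosen_orientation (forget_axis D)) l)"

definition beta :: "axis_diagram \<Rightarrow> int" where
  "beta D = (\<Sum>l | l < length D \<and> fst (D ! l) = Axis.
     crossing_sign (forget_axis D) (chosen_orientation (forget_axis D)) l)"

text \<open>
  The polynomial W written in the variables \<open>s = B\<^sup>-\<^sup>4\<close> and \<open>t = A\<^sup>-\<^sup>4\<close>.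
  For a symmetric union that is a knot diagram, it is a Laurent polynomial in these
  (Eisermann and Lamm), and the description below determines it.
\<close>

definition W_poly :: "axis_diagram \<Rightarrow> laurent2" where
  "W_poly D = (THE W.
     subst2 W (var_B powi (-4)) (var_A powi (-4)) =
       axis_bracket D * (- (var_A powi (-3))) powi alpha D * (- (var_B powi (-3))) powi beta D)"

end

theory Submission imports Defs begin

text \<open>
  The Kauffman bracket is a state sum of labellings of the strands, and so is the writhe, by a sum
  over orientations.  For a diagram with an axis the labels on both sides form two lists, and events
  on the left commute with events on the right; hence a symmetric diagram may be replaced by its left
  half together with the simultaneous mirror image.  Writing the horizontal smoothing on the axis
  with coefficient \<open>- 1 - B\<^sup>4\<close> or \<open>- 1 - B\<^sup>-\<^sup>4\<close> over the circle value of \<open>A\<close>, the state sum of such a double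
  stays in a lattice over \<open>\<int>[A\<^sup>4, A\<^sup>-\<^sup>4]\<close>, up to a power of the circle value that is determined by
  the number of strands and traversals.  So \<open>W\<close> is a Laurent polynomial, and it can be evaluated at any
  unit \<open>s\<close>.  At \<open>s = t\<close> one recovers the Kauffman bracket.  At \<open>s = -1\<close> the horizontal smoothings disappear, both
  sides are joined only at the two traversals, and, one-strand tangles being scalars, the state sum
  factors into those of the partial knots.  These are mirror images, so their Jones polynomials agree at
  \<open>t = -1\<close>, which makes the product a square.
\<close>

subsection \<open>Vertex models\<close>

text \<open>The obstacle: \<open>W_poly\<close> is pinned down only at generic A and B, as a Laurent
  polynomial whose existence has to be proved, while the theorem needs it at s = -1, where B^4 = -1
  and the circle value of B is zero, so nothing can be substituted in the defining formula. A
  horizontal smoothing on the axis creates two traversals and so contributes circle(B) / circle(A);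
  the coefficients of the overview arise from B * circle(B) = B^-1 * (-1 - B^4). In terms of s they
  are -1 - 1/s and -1 - s. The stray powers of B combine with the sign factor to a power of s
  because, on a symmetric union, the signs off the axis cancel and those on the axis are dictated by
  the crossing type. The denominators circle(A) are compensated by the symmetry: a minimum on the
  axis, applied to the lattice, yields multiples of circle(A). State sums make all this local, so
  that moves, commutations and straightenings are finite checks on labels; circles are counted and
  orientations are shown to exist by evaluating state sums in two ways, without planar
  topology.\<close>

text \<open>
  Each strand carries one of two labels, and a diagram acts, from its last event backwards, on functionals of the
  label lists.  In \<open>w x y c d\<close> the labels \<open>x, y\<close> are below and \<open>c, d\<close> above the event; cups and caps
  have only two ends, whose labels are passed twice.
\<close>

type_synonym 'r weight = "bool \<Rightarrow> bool \<Rightarrow> bool \<Rightarrow> bool \<Rightarrow> 'r"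
type_synonym 'r event = "nat \<times> piece \<times> 'r weight"

definition ins :: "nat \<Rightarrow> 'a \<Rightarrow> 'a \<Rightarrow> 'a list \<Rightarrow> 'a list" where
  "ins i c d xs = take i xs @ c # d # drop i xs"

definition del :: "nat \<Rightarrow> 'a list \<Rightarrow> 'a list" where
  "del i xs = take i xs @ drop (i + 2) xs"

fun act :: "'r::comm_ring_1 event \<Rightarrow> (bool list \<Rightarrow> 'r) \<Rightarrow> bool list \<Rightarrow> 'r" where
  "act (i, Cup, w) \<phi> xs = (\<Sum>c\<in>UNIV. \<Sum>d\<in>UNIV. w c d c d * \<phi> (ins i c d xs))"
| "act (i, Cap, w) \<phi> xs = w (xs ! i) (xs ! Suc i) (xs ! i) (xs ! Suc i) * \<phi> (del i xs)"
| "act (i, _, w) \<phi> xs =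
     (\<Sum>c\<in>UNIV. \<Sum>d\<in>UNIV. w (xs ! i) (xs ! Suc i) c d * \<phi> (ins i c d (del i xs)))"

fun evf :: "'r::comm_ring_1 event list \<Rightarrow> (bool list \<Rightarrow> 'r) \<Rightarrow> bool list \<Rightarrow> 'r" where
  "evf [] \<phi> = \<phi>"
| "evf (e # E) \<phi> = act e (evf E \<phi>)"

definition tag :: "(piece \<Rightarrow> 'r weight) \<Rightarrow> diagram \<Rightarrow> 'r event list" where
  "tag w D = map (\<lambda>(i, p). (i, p, w p)) D"

definition eps :: "'b list \<Rightarrow> 'r::comm_ring_1" where
  "eps xs = of_bool (xs = [])"

definition ev :: "(piece \<Rightarrow> 'r::comm_ring_1 weight) \<Rightarrow> diagram \<Rightarrow> 'r" where
  "ev w D = evf (tag w D) eps []"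

lemma tag_simps [simp]:
  "tag w [] = []" "tag w ((i, p) # D) = (i, p, w p) # tag w D" "tag w (D @ E) = tag w D @ tag w E"
  by (auto simp: tag_def)

lemma evf_append [simp]: "evf (D @ E) \<phi> = evf D (evf E \<phi>)"
  by (induction D) auto

lemma sum_bool: "(\<Sum>c\<in>UNIV. f c) = f True + (f False :: 'r::comm_monoid_add)"
  by (simp add: UNIV_bool add.commute)

lemma ins_append [simp]: "ins (length us + j) c d (us @ vs) = us @ ins j c d vs"
  by (simp add: ins_def)
lemma del_append [simp]: "del (length us + j) (us @ vs) = us @ del j vs"
  by (simp add: del_def)
lemma ins_prefix: "i \<le> length us \<Longrightarrow> ins i c d (us @ vs) = ins i c d us @ vs"
  by (simp add: ins_def)
lemma del_prefix: "i + 2 \<le> length us \<Longrightarrow> del i (us @ vs) = del i us @ vs"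
  by (simp add: del_def)
lemma length_ins [simp]: "length (ins i c d xs) = length xs + 2"
  by (simp add: ins_def)
lemma length_del [simp]: "i + 2 \<le> length xs \<Longrightarrow> length (del i xs) = length xs - 2"
  by (simp add: del_def)

lemma list_simps [simp]:
  "ins (length us) c d (us @ vs) = us @ c # d # vs"
  "ins (Suc (length us)) c d (us @ x # vs) = us @ x # c # d # vs"
  "ins (Suc (Suc (length us))) c d (us @ x # y # vs) = us @ x # y # c # d # vs"
  "del (length us) (us @ x # y # vs) = us @ vs"
  "del (Suc (length us)) (us @ x # y # z # vs) = us @ x # vs"
  "(us @ x # vs) ! length us = x"
  "(us @ x # y # vs) ! Suc (length us) = y"
  "(us @ x # y # z # vs) ! Suc (Suc (length us)) = z"
  by (auto simp: ins_def del_def nth_append)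

lemma ins_0 [simp]: "ins 0 c d xs = c # d # xs" and del_0 [simp]: "del 0 (x # y # xs) = xs"
  and ins_Suc [simp]: "ins (Suc i) c d (x # xs) = x # ins i c d xs"
  and del_Suc [simp]: "del (Suc i) (x # xs) = x # del i xs"
  by (simp_all add: ins_def del_def)

lemma split_at: assumes "i \<le> length xs" obtains us vs where "xs = us @ vs" "length us = i"
  using that[of "take i xs" "drop i xs"] assms by simp

lemma split_at2:
  assumes "i + 2 \<le> length xs" obtains us x y vs where "xs = us @ x # y # vs" "length us = i"
proof -
  have "xs = take i xs @ xs ! i # xs ! Suc i # drop (Suc (Suc i)) xs"
    using assms by (simp add: id_take_nth_drop[symmetric] Cons_nth_drop_Suc)
  then show ?thesis using that[of "take i xs"] assms by simp
qed

lemma split_at3: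
  assumes "i + 3 \<le> length xs" obtains us x y z vs where "xs = us @ x # y # z # vs" "length us = i"
proof -
  have "xs = take i xs @ xs ! i # xs ! Suc i # xs ! Suc (Suc i) # drop (Suc (Suc (Suc i))) xs"
    using assms by (simp add: id_take_nth_drop[symmetric] Cons_nth_drop_Suc)
  then show ?thesis using that[of "take i xs"] assms by simp
qed

text \<open>Tangle version of \<open>wf_from\<close>, with \<open>n\<close> strands below and
  \<open>m\<close> above, so that diagrams can be cut at any height.\<close>

fun wfs :: "nat \<Rightarrow> diagram \<Rightarrow> nat \<Rightarrow> bool" where
  "wfs n [] m \<longleftrightarrow> n = m"
| "wfs n ((i, p) # D) m \<longleftrightarrow>
     (if p = Cup then i \<le> n else i + 2 \<le> n) \<and> wfs (strands_after p n) D m"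

lemma wf_from_wfs: "wf_from n D = wfs n D 0"
  by (induction n D rule: wf_from.induct) auto

lemma wfs_append: "wfs n (D @ E) m \<longleftrightarrow> (\<exists>k. wfs n D k \<and> wfs k E m)"
proof (induction D arbitrary: n)
  case (Cons e D)
  then show ?case by (cases e) (simp del: strands_after.simps)
qed auto

abbreviation untag :: "'r event list \<Rightarrow> diagram" where
  "untag E \<equiv> map (\<lambda>(i, p, w). (i, p)) E"

lemma untag_tag [simp]: "untag (tag w D) = D"
  by (induction D) auto

lemma act_cong:
  assumes "if p = Cup then i \<le> n else i + 2 \<le> n" "length xs = n"
    and "\<And>ys. length ys = strands_after p n \<Longrightarrow> \<phi> ys = \<psi> ys"
  shows "act (i, p, w) \<phi> xs = act (i, p, w) \<psi> xs"
  using assms by (cases p) (auto intro!: sum.cong)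

text \<open>Functionals matter only on lists as long as the number of strands at their height. This
  permits local rewriting although the action on lists of other lengths is arbitrary.\<close>

lemma evf_cong:
  assumes "wfs n (untag E) m" "length xs = n" "\<And>ys. length ys = m \<Longrightarrow> \<phi> ys = \<psi> ys"
  shows "evf E \<phi> xs = evf E \<psi> xs"
  using assms
proof (induction E arbitrary: n xs)
  case (Cons e E)
  obtain i p w where e: "e = (i, p, w)" by (cases e)
  show ?case unfolding e evf.simps
    by (rule act_cong[of _ _ n]) (use Cons e in auto)
qed auto

text \<open>Both actions are finite linear combinations, so this is an exchange of sums. It
  underlies the commutation of distant events and that of the two sides of the axis.\<close>

lemma act_swap:
  "act e (\<lambda>x. act e' (F x) v) u = act e' (\<lambda>y. act e (\<lambda>x. F x y) u) v"
proof -
  obtain i p w j q w' where "e = (i, p, w)" "e' = (j, q, w')" by (cases e, cases e')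
  then show ?thesis
    by (cases p; cases q) (simp_all add: sum_bool algebra_simps)
qed

lemma act_shift: "act (length us + j, q, w) \<phi> (us @ vs) = act (j, q, w) (\<lambda>vs. \<phi> (us @ vs)) vs"
  by (cases q) (simp_all add: nth_append add_Suc_right[symmetric] del: add_Suc_right)

lemma act_prefix:
  "if p = Cup then i \<le> length us else i + 2 \<le> length us \<Longrightarrow>
   act (i, p, w) \<phi> (us @ vs) = act (i, p, w) (\<lambda>us. \<phi> (us @ vs)) us"
  by (cases p) (auto simp add: nth_append ins_prefix del_prefix)

lemma act_distant:
  assumes le: "i + (if p = Cap then 0 else 2) \<le> j"
    and wf: "if p = Cup then i \<le> length xs else i + 2 \<le> length xs"
  shows "act (i, p, w) (act (j, q, w') \<phi>) xs =
    act (j + (if p = Cup then 0 else 2) - (if p = Cap then 0 else 2), q, w') (act (i, p, w) \<phi>) xs"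
    (is "_ = act (?j, _, _) _ _")
proof -
  \<comment> \<open>The label list is cut behind the strands of the first event. The second event
    then acts on the remainder alone, at an offset given by the width of the first part above
    (\<open>n'\<close>) or below (\<open>n\<close>) the first event.\<close>
  define n where "n = (if p = Cup then i else i + 2)"
  have "n \<le> length xs" using wf by (simp add: n_def split: if_splits)
  then obtain us vs where xs: "xs = us @ vs" "length us = n"
    by (rule split_at)
  have ok: "if p = Cup then i \<le> length us else i + 2 \<le> length us"
    by (simp add: xs n_def)
  define n' where "n' = strands_after p n"
  have j: "j = n' + (j - n')" and "?j = n + (j - n')"
    using le unfolding n'_def n_def by (cases p; simp)+
  have "act (i, p, w) (act (j, q, w') \<phi>) (us @ vs) =
     act (i, p, w) (\<lambda>us. act (j, q, w') \<phi> (us @ vs)) us"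
    by (rule act_prefix[OF ok])
  also have "\<dots> = act (i, p, w) (\<lambda>us. act (j - n', q, w') (\<lambda>vs. \<phi> (us @ vs)) vs) us"
  proof (rule act_cong[of _ _ n])
    fix us' :: "bool list" assume "length us' = strands_after p n"
    then show "act (j, q, w') \<phi> (us' @ vs) = act (j - n', q, w') (\<lambda>vs. \<phi> (us' @ vs)) vs"
      using j act_shift[of us' "j - n'" q w' \<phi> vs] by (simp add: n'_def)
  qed (use ok xs in auto)
  also have "\<dots> = act (j - n', q, w') (\<lambda>vs. act (i, p, w) (\<lambda>us. \<phi> (us @ vs)) us) vs"
    by (rule act_swap)
  also have "\<dots> = act (j - n', q, w') (\<lambda>vs. act (i, p, w) \<phi> (us @ vs)) vs"
    using act_prefix[OF ok, of w \<phi>] by simp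
  also have "\<dots> = act (?j, q, w') (act (i, p, w) \<phi>) (us @ vs)"
    using act_shift[of us "j - n'" q w' "act (i, p, w) \<phi>" vs] \<open>?j = n + (j - n')\<close> xs by simp
  finally show ?thesis using xs by simp
qed

lemma act_linear:
  "act e (\<lambda>xs. c * \<phi> xs + d * \<psi> xs) xs = c * act e \<phi> xs + d * act e \<psi> xs"
  by (cases "(e, \<phi>, xs)" rule: act.cases) (simp_all add: sum_bool algebra_simps)

lemma evf_linear:
  "evf E (\<lambda>xs. c * \<phi> xs + d * \<psi> xs) = (\<lambda>xs. c * evf E \<phi> xs + d * evf E \<psi> xs)"
  by (induction E) (auto simp: act_linear)

lemma evf_scale: "evf E (\<lambda>xs. c * \<phi> xs) xs = c * evf E \<phi> xs"
  using evf_linear[of E c \<phi> 0 \<phi>] by simp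

text \<open>
  \<open>bw a b\<close> with \<open>b = 1 / a\<close> is the Kauffman bracket at \<open>A = a\<close>, normalised to \<open>1\<close> on the empty diagram;
  \<open>hv a b h v\<close> is a crossing with coefficients \<open>h, v\<close> of its two smoothings.  In \<open>ow q (1 / q)\<close> the
  labels are orientations of the strands, which are weighted by \<open>q\<close> to the sum of the crossing signs.
\<close>

definition cupw :: "'r::comm_ring_1 \<Rightarrow> bool \<Rightarrow> bool \<Rightarrow> 'r" where
  "cupw a c d = (if c = d then 0 else if c then - (a ^ 2) else 1)"

definition capw :: "'r::comm_ring_1 \<Rightarrow> bool \<Rightarrow> bool \<Rightarrow> 'r" where
  "capw b x y = (if x = y then 0 else if x then 1 else - (b ^ 2))"

definition hv :: "'r::comm_ring_1 \<Rightarrow> 'r \<Rightarrow> 'r \<Rightarrow> 'r \<Rightarrow> 'r weight" where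
  "hv a b h v x y c d = h * capw b x y * cupw a c d + v * of_bool (x = c \<and> y = d)"

fun bw :: "'r::comm_ring_1 \<Rightarrow> 'r \<Rightarrow> piece \<Rightarrow> 'r weight" where
  "bw a b Cup x y c d = cupw a c d"
| "bw a b Cap x y c d = capw b x y"
| "bw a b Xo x y c d = hv a b a b x y c d"
| "bw a b Xu x y c d = hv a b b a x y c d"

fun ow :: "'r::comm_ring_1 \<Rightarrow> 'r \<Rightarrow> piece \<Rightarrow> 'r weight" where
  "ow q r Cup x y c d = of_bool (c \<noteq> d)"
| "ow q r Cap x y c d = of_bool (x \<noteq> y)"
| "ow q r Xo x y c d = of_bool (c = y \<and> d = x) * (if x = y then r else q)"
| "ow q r Xu x y c d = of_bool (c = y \<and> d = x) * (if x = y then q else r)"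

text \<open>
  On the left of the axis strands are counted outwards, hence from right to left.
\<close>

definition flip :: "'r weight \<Rightarrow> 'r weight" where
  "flip w x y c d = w y x d c"

text \<open>The factor of a removed curl with crossing \<open>p\<close>; the value on cups and caps
  is a dummy.\<close>

fun kink :: "'r \<Rightarrow> 'r \<Rightarrow> piece \<Rightarrow> 'r" where
  "kink q r Xo = q" | "kink q r Xu = r" | "kink q r _ = q"

lemma power2_inv: fixes a b :: "'r::comm_ring_1" assumes "a * b = 1"
  shows "a\<^sup>2 * b\<^sup>2 = 1" "a * (b * c) = c" "a * (a * (b * (b * c))) = c" "b * a = 1" "a\<^sup>2 * (b\<^sup>2 * c) = c"
proof -
  show "a\<^sup>2 * b\<^sup>2 = 1" using assms by (metis power_mult_distrib power_one)
  then show "a\<^sup>2 * (b\<^sup>2 * c) = c" by (metis mult.assoc mult_1)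
  show "a * (b * c) = c" for c using assms by (metis mult.assoc mult_1)
  then show "a * (a * (b * (b * c))) = c" by (metis mult.left_commute)
  show "b * a = 1" using assms by (simp add: mult.commute)
qed

text \<open>Singles out the moves under which the bracket is multiplied by a factor, with the
  crossing type that determines it.\<close>

definition is_R1 :: "diagram \<Rightarrow> diagram \<Rightarrow> piece \<Rightarrow> bool" where
  "is_R1 x y p \<longleftrightarrow> (\<exists>i. is_crossing p \<and>
     (x = [(i, Cup), (i, p)] \<and> y = [(i, Cup)] \<or> x = [(i, p), (i, Cap)] \<and> y = [(i, Cap)]))"

text \<open>A move touches at most three strands, so after cutting the label list around them it
  becomes a finite identity in \<open>a\<close> and \<open>b\<close>, checked label by label; only
  the exchange of distant events needs \<open>act_distant\<close>.\<close>

lemma bracket_move: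
  fixes a b :: "'r::comm_ring_1"
  assumes ab: "a * b = 1" and "move x y" "wfs n x m" "length xs = n"
  shows "evf (tag (bw a b) x) \<phi> xs = evf (tag (bw a b) y) \<phi> xs \<and> (\<forall>p. \<not> is_R1 x y p) \<or>
    (\<exists>p. is_R1 x y p \<and> evf (tag (bw a b) x) \<phi> xs = kink (- (a ^ 3)) (- (b ^ 3)) p * evf (tag (bw a b) y) \<phi> xs)"
  using assms(2-)
proof (cases rule: move.cases)
  case (distant i p j p')
  have "if p = Cup then i \<le> length xs else i + 2 \<le> length xs"
    using assms(3,4) unfolding distant by (cases "p = Cup") auto
  moreover have "\<forall>p. \<not> is_R1 x y p" unfolding distant is_R1_def by (cases p) auto
  ultimately show ?thesis using act_distant[OF distant(3)]
    unfolding distant tag_simps evf.simps by blast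
next
  case (straighten1 i)
  with assms have "i + 1 \<le> length xs" by auto
  then obtain us x vs where "xs = us @ x # vs" "length us = i"
    by (metis Suc_eq_plus1 id_take_nth_drop length_take less_eq_Suc_le min.absorb2 less_or_eq_imp_le)
  with straighten1 show ?thesis
    by (cases x) (auto simp: is_R1_def sum_bool cupw_def capw_def power2_inv[OF ab] algebra_simps)
next
  case (straighten2 i)
  with assms have "i + 1 \<le> length xs" by auto
  then obtain us x vs where "xs = us @ x # vs" "length us = i"
    by (metis Suc_eq_plus1 id_take_nth_drop length_take less_eq_Suc_le min.absorb2 less_or_eq_imp_le)
  with straighten2 show ?thesis
    by (cases x) (auto simp: is_R1_def sum_bool cupw_def capw_def power2_inv[OF ab] algebra_simps)
next
  case (slide_cup p i)
  with assms have "i + 1 \<le> length xs" by (auto simp: is_crossing_def)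
  then obtain us x vs where "xs = us @ x # vs" "length us = i"
    by (metis Suc_eq_plus1 id_take_nth_drop length_take less_eq_Suc_le min.absorb2 less_or_eq_imp_le)
  with slide_cup show ?thesis
    by (cases x) (auto simp: is_R1_def is_crossing_def sum_bool cupw_def capw_def hv_def power2_inv[OF ab] algebra_simps power2_eq_square)
next
  case (slide_cap p i)
  with assms have "i + 3 \<le> length xs" by (auto simp: is_crossing_def)
  then obtain us x y z vs where "xs = us @ x # y # z # vs" "length us = i"
    by (rule split_at3)
  with slide_cap show ?thesis
    by (cases x; cases y; cases z) (auto simp: is_R1_def is_crossing_def sum_bool cupw_def capw_def hv_def power2_inv[OF ab] algebra_simps power2_eq_square)
next
  case (R1_cup p i)
  with assms have "i \<le> length xs" by (auto simp: is_crossing_def)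
  then obtain us vs where "xs = us @ vs" "length us = i"
    by (rule split_at)
  with R1_cup show ?thesis
    by (intro disjI2 exI[of _ p]) (auto simp: is_R1_def is_crossing_def sum_bool cupw_def capw_def hv_def power2_inv[OF ab] algebra_simps power2_eq_square power3_eq_cube)
next
  case (R1_cap p i)
  with assms have "i + 2 \<le> length xs" by (auto simp: is_crossing_def)
  then obtain us x y vs where "xs = us @ x # y # vs" "length us = i"
    by (rule split_at2)
  with R1_cap show ?thesis
    by (intro disjI2 exI[of _ p]) (cases x; cases y; auto simp: is_R1_def is_crossing_def sum_bool cupw_def capw_def hv_def power2_inv[OF ab] algebra_simps power2_eq_square power3_eq_cube)
next
  case (R2 p i)
  with assms have "i + 2 \<le> length xs" by (auto simp: is_crossing_def)
  then obtain us x y vs where "xs = us @ x # y # vs" "length us = i"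
    by (rule split_at2)
  with R2 show ?thesis
    by (cases x; cases y) (auto simp: is_R1_def is_crossing_def sum_bool cupw_def capw_def hv_def power2_inv[OF ab] algebra_simps power2_eq_square power3_eq_cube)
next
  case (R3 p i)
  with assms have "i + 3 \<le> length xs" by (auto simp: is_crossing_def)
  then obtain us x y z vs where "xs = us @ x # y # z # vs" "length us = i"
    by (rule split_at3)
  with R3 show ?thesis
    by (cases x; cases y; cases z) (auto simp: is_R1_def is_crossing_def sum_bool cupw_def capw_def hv_def power2_inv[OF ab] algebra_simps power2_eq_square power3_eq_cube)
qed

subsection \<open>Laurent polynomials\<close>

lemma unit_inverse_eq: "x * y = 1 \<Longrightarrow> unit_inverse x = (y::'a::comm_ring_1)"
  unfolding unit_inverse_def
  by (rule the_equality) (auto, metis mult.assoc mult.commute mult_1)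

lemma unit_power_0 [simp]: "unit_power x 0 = 1"
  by (simp add: unit_power_def)

lemma unit_power_nat: "unit_power x (int n) = x ^ n"
  by (simp add: unit_power_def)

lemma unit_power_neg:
  assumes "x * y = (1::'a::comm_ring_1)" shows "unit_power x (- int n) = y ^ n"
  using assms by (cases "n = 0") (auto simp add: unit_power_def unit_inverse_eq)

lemma unit_power_field:
  fixes x :: "'a::field" assumes "x \<noteq> 0" shows "unit_power x k = x powi k"
proof -
  have "unit_inverse x = inverse x" using assms by (intro unit_inverse_eq) simp
  then show ?thesis by (simp add: unit_power_def power_int_def)
qed

lemma power_cancel:
  assumes "x * y = (1::'a::comm_ring_1)" "n \<le> m" shows "x ^ m * y ^ n = x ^ (m - n)"
proof -
  have "x ^ m * y ^ n = x ^ (m - n) * (x ^ n * y ^ n)"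
    using assms by (simp add: mult.assoc[symmetric] power_add[symmetric])
  also have "x ^ n * y ^ n = 1" using assms by (metis power_mult_distrib power_one)
  finally show ?thesis by simp
qed

lemma unit_power_add:
  assumes xy: "x * y = (1::'a::comm_ring_1)"
  shows "unit_power x (i + j) = unit_power x i * unit_power x j"
proof -
  have yx: "y * x = 1" using xy by (simp add: mult.commute)
  \<comment> \<open>On a difference of naturals the power is a product of natural powers of
    \<open>x\<close> and its inverse, whichever number is larger; additivity is then
    immediate.\<close>
  have *: "unit_power x (int m - int n) = x ^ m * y ^ n" for m n
  proof (cases "n \<le> m")
    case True
    then show ?thesis using power_cancel[OF xy True] unit_power_nat[of x "m - n"]
      by (simp add: of_nat_diff)
  next
    case False
    then have "int m - int n = - int (n - m)" by simp
    then have "unit_power x (int m - int n) = y ^ (n - m)"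
      using unit_power_neg[OF xy] by metis
    then show ?thesis using power_cancel[OF yx, of m n] False by (simp add: mult.commute)
  qed
  obtain m n where i: "i = int m - int n" by (metis int_diff_cases)
  obtain m' n' where j: "j = int m' - int n'" by (metis int_diff_cases)
  have "i + j = int (m + m') - int (n + n')" by (simp add: i j)
  then have "unit_power x (i + j) = x ^ (m + m') * y ^ (n + n')" by (simp only: *)
  moreover have "unit_power x i = x ^ m * y ^ n" "unit_power x j = x ^ m' * y ^ n'"
    by (simp_all only: i j *)
  ultimately show ?thesis by (simp add: power_add ac_simps)
qed

text \<open>Homomorphisms from the monoid of exponents to the multiplicative monoid. Their extension
  \<open>subst\<close> to the group ring treats one and two variables alike.\<close>

definition mhom :: "('k::comm_monoid_add \<Rightarrow> 'a::comm_ring_1) \<Rightarrow> bool" where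
  "mhom u \<longleftrightarrow> u 0 = 1 \<and> (\<forall>i j. u (i + j) = u i * u j)"

definition subst :: "('k::comm_monoid_add \<Rightarrow> 'a::comm_ring_1) \<Rightarrow> ('k \<Rightarrow>\<^sub>0 int) \<Rightarrow> 'a" where
  "subst u V = (\<Sum>k\<in>Poly_Mapping.keys V. of_int (Poly_Mapping.lookup V k) * u k)"

lemma subst1_eq: "subst1 V y = subst (unit_power y) V"
  by (simp add: subst1_def subst_def)

lemma subst2_eq: "subst2 W x y = subst (\<lambda>(i, j). unit_power x i * unit_power y j) W"
  by (simp add: subst2_def subst_def case_prod_beta mult.assoc)

lemma subst_superset:
  "finite K \<Longrightarrow> Poly_Mapping.keys V \<subseteq> K \<Longrightarrow>
   subst u V = (\<Sum>k\<in>K. of_int (Poly_Mapping.lookup V k) * u k)"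
  unfolding subst_def by (rule sum.mono_neutral_left) (auto simp: in_keys_iff)

lemma subst_diff: "subst u (f - g) = subst u f - subst u g"
proof -
  let ?K = "Poly_Mapping.keys f \<union> Poly_Mapping.keys g"
  have "Poly_Mapping.keys (f - g) \<subseteq> ?K" by (auto simp: in_keys_iff lookup_minus)
  then show ?thesis
    by (simp add: subst_superset[of ?K] lookup_minus left_diff_distrib sum_subtractf)
qed

lemma subst_0 [simp]: "subst u 0 = 0"
  by (simp add: subst_def)

lemma subst_uminus: "subst u (- f) = - subst u f"
  using subst_diff[of u 0 f] by simp

lemma subst_add: "subst u (f + g) = subst u f + subst u g"
  using subst_diff[of u f "- g"] by (simp add: subst_uminus)

lemma subst_single: "subst u (Poly_Mapping.single k c) = of_int c * u k"
  by (simp add: subst_def)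

text \<open>A finitely supported integer function is an element of a free abelian group, so
  \<open>frag_induction\<close> in both factors reduces the claim to monomials.\<close>

lemma subst_mult: assumes "mhom u" shows "subst u (f * g) = subst u f * subst u g"
proof (induction f rule: frag_induction[OF subset_UNIV, case_names zero one diff])
  case (one x)
  show ?case
  proof (induction g rule: frag_induction[OF subset_UNIV, case_names zero one diff])
    case (one y)
    then show ?case using assms by (simp add: mult_single subst_single mhom_def)
  qed (auto simp: subst_diff right_diff_distrib)
qed (auto simp: subst_diff left_diff_distrib)

lemma subst_1 [simp]: "mhom u \<Longrightarrow> subst u 1 = 1"
  using subst_single[of u 0 1] by (simp add: mhom_def)

lemma subst_of_int [simp]: "mhom u \<Longrightarrow> subst u (of_int c) = of_int c"
  using subst_single[of u 0 c] by (metis mhom_def mult.right_neutral of_int_eq_id id_apply single_of_int)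

lemma mhom_power: "x * y = 1 \<Longrightarrow> mhom (unit_power x)"
  by (auto simp: mhom_def unit_power_add)

lemma mhom_power2:
  "x * x' = 1 \<Longrightarrow> y * y' = 1 \<Longrightarrow> mhom (\<lambda>(i, j). unit_power x i * unit_power y j)"
  unfolding mhom_def by (auto simp: unit_power_add zero_prod_def split: prod.splits)

lemma subst_comp:
  assumes "mhom v" shows "subst v (subst u W) = subst (\<lambda>k. subst v (u k)) W"
proof -
  have *: "subst v (sum f S) = (\<Sum>k\<in>S. subst v (f k))" for f and S :: "'c set"
    by (induction S rule: infinite_finite_induct) (auto simp: subst_add)
  show ?thesis unfolding subst_def[of u] * using assms
    by (simp add: subst_mult subst_def[of _ W])
qed

lemma subst_unit_power:
  assumes v: "mhom v" and xy: "x * y = 1"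
  shows "subst v (unit_power x k) = unit_power (subst v x) k"
proof -
  have pow: "subst v (z ^ n) = subst v z ^ n" for z n
    by (induction n) (auto simp: v subst_mult)
  have *: "subst v x * subst v y = 1" using v xy by (simp add: subst_mult[symmetric])
  show ?thesis
  proof (cases "k \<ge> 0")
    case False
    then have k: "k = - int (nat (- k))" by simp
    show ?thesis
      by (subst (1 2) k) (simp only: unit_power_neg[OF xy] unit_power_neg[OF *] pow)
  qed (simp add: unit_power_def pow)
qed

lemma var_t_unit: "var_t * Poly_Mapping.single (-1) 1 = 1"
  by (simp add: var_t_def mult_single)

lemma subst1_var_t: "mhom (unit_power y) \<Longrightarrow> subst1 var_t y = y"
  by (simp add: subst1_eq var_t_def subst_single unit_power_def)

lemma subst1_subst2:
  assumes "x * x' = 1" "z * z' = (1::laurent)" "y * y' = 1"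
  shows "subst1 (subst2 W x z) y = subst2 W (subst1 x y) (subst1 z y)"
  using assms
  by (simp add: subst1_eq subst2_eq subst_comp mhom_power subst_mult subst_unit_power case_prod_unfold)

section \<open>Independence of the monomials in A and B\<close>

lemma var_A_0 [simp]: "var_A \<noteq> 0" and var_B_0 [simp]: "var_B \<noteq> 0"
  by (simp_all add: var_A_def var_B_def Zero_fract_def eq_fract)

lemma var_A_power: "var_A ^ n = Fraction_Field.Fract [:monom 1 n:] 1"
proof (induction n)
  case (Suc n)
  then show ?case by (simp add: var_A_def) (simp add: monom_Suc ac_simps)
qed (simp add: One_fract_def one_pCons[symmetric])

lemma var_B_power: "var_B ^ n = Fraction_Field.Fract (monom 1 n) 1"
proof (induction n)
  case (Suc n)
  then show ?case by (simp add: var_B_def) (simp add: monom_Suc ac_simps)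
qed (simp add: One_fract_def one_pCons[symmetric])

lemma of_int_ratfun: "(of_int c :: ratfun) = Fraction_Field.Fract [:[:c:]:] 1"
proof -
  have "(of_int c :: int poly poly) = [:[:c:]:]" by (simp add: of_int_poly)
  moreover have "(of_int c :: ratfun) = Fraction_Field.Fract (of_int c) 1"
  proof (induction c)
    case (nonneg n)
    show ?case by (induction n) (auto simp: One_fract_def Zero_fract_def add.commute)
  next
    case (neg n)
    have "(of_int (int m) :: ratfun) = Fraction_Field.Fract (of_int (int m)) 1" for m
      by (induction m) (auto simp: One_fract_def Zero_fract_def add.commute)
    from this[of "Suc n"] show ?case by (metis minus_fract of_int_minus)
  qed
  ultimately show ?thesis by simp
qed

lemma monomials_independent:
  fixes c :: "'k \<Rightarrow> int" and p q :: "'k \<Rightarrow> int"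
  assumes "finite S" "inj_on (\<lambda>k. (p k, q k)) S"
    and zero: "(\<Sum>k\<in>S. of_int (c k) * (var_B powi p k * var_A powi q k)) = (0::ratfun)"
    and "k \<in> S"
  shows "c k = 0"
proof -
  \<comment> \<open>A common shift of all exponents that makes them nonnegative: after
    multiplication by the corresponding monomial the sum is a genuine polynomial, and its
    coefficients can be compared.\<close>
  define N where "N = (\<Sum>k\<in>S. \<bar>p k\<bar> + \<bar>q k\<bar>)"
  have "\<bar>p k\<bar> + \<bar>q k\<bar> \<le> N" if "k \<in> S" for k
    unfolding N_def using assms(1) that by (intro member_le_sum) auto
  then have N: "p k + N \<ge> 0" "q k + N \<ge> 0" if "k \<in> S" for k using that by (fastforce)+
  define P where "P = (\<Sum>k\<in>S. monom (monom (c k) (nat (q k + N))) (nat (p k + N)))"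
  have mono: "of_int (c k) * (var_B powi p k * var_A powi q k) * (var_B powi N * var_A powi N)
     = Fraction_Field.Fract (monom (monom (c k) (nat (q k + N))) (nat (p k + N))) 1"
    if "k \<in> S" for k
  proof -
    have "of_int (c k) * (var_B powi p k * var_A powi q k) * (var_B powi N * var_A powi N)
      = of_int (c k) * ((var_B powi p k * var_B powi N) * (var_A powi q k * var_A powi N))"
      by (simp add: ac_simps)
    also have "\<dots> = of_int (c k) * (var_B ^ nat (p k + N) * var_A ^ nat (q k + N))"
      using N[OF that] by (simp add: power_int_add[symmetric]) (simp add: power_int_def)
    also have "\<dots> = Fraction_Field.Fract ([:[:c k:]:] * (monom 1 (nat (p k + N)) * [:monom 1 (nat (q k + N)):])) 1"
      by (simp add: var_A_power var_B_power of_int_ratfun)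
    also have "[:[:c k:]:] * (monom 1 (nat (p k + N)) * [:monom 1 (nat (q k + N)):])
      = monom (monom (c k) (nat (q k + N))) (nat (p k + N))"
      by (simp add: smult_monom mult.commute)
    finally show ?thesis .
  qed
  have fsum: "(\<Sum>k\<in>T. Fraction_Field.Fract (f k) 1) = Fraction_Field.Fract (sum f T) (1::int poly poly)"
    if "finite T" for f and T :: "'k set"
    using that by (induction T) (auto simp: Zero_fract_def)
  have "Fraction_Field.Fract P 1 = (\<Sum>k\<in>S. of_int (c k) * (var_B powi p k * var_A powi q k)) * (var_B powi N * var_A powi N)"
    unfolding P_def fsum[OF assms(1), symmetric] sum_distrib_right by (intro sum.cong) (auto simp: mono)
  then have "Fraction_Field.Fract P 1 = 0" by (simp only: zero mult_zero_left)
  then have "P = 0" by (simp add: Zero_fract_def eq_fract)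
  then have "0 = coeff (coeff P (nat (p k + N))) (nat (q k + N))" by simp
  also have "\<dots> = (\<Sum>j\<in>S. if j = k then c j else 0)"
    unfolding P_def coeff_sum
  proof (intro sum.cong refl)
    fix j assume j: "j \<in> S"
    have "(nat (q j + N) = nat (q k + N) \<and> nat (p j + N) = nat (p k + N)) = (j = k)"
      using N[OF j] N[OF \<open>k \<in> S\<close>] assms(2) j \<open>k \<in> S\<close> by (auto simp: inj_on_def eq_nat_nat_iff)
    then show "coeff (coeff (monom (monom (c j) (nat (q j + N))) (nat (p j + N))) (nat (p k + N))) (nat (q k + N))
      = (if j = k then c j else 0)" by (auto simp: coeff_monom)
  qed
  also have "\<dots> = c k" using assms(1,4) by simp
  finally show ?thesis by simp
qed

text \<open>The uniqueness half of the description of \<open>W_poly\<close>: distinct exponents of s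
  and t give distinct monomials in B and A.\<close>

lemma subst2_inject:
  assumes "subst2 V (var_B powi (-4)) (var_A powi (-4)) = subst2 W (var_B powi (-4)) (var_A powi (-4))"
  shows "V = W"
proof -
  have pw: "unit_power (z powi (-4)) i = z powi (-4 * i)" if "z \<noteq> 0" for z :: ratfun and i
    using that by (simp only: unit_power_field power_int_eq_0_iff power_int_mult simp_thms)
  have "subst2 (V - W) (var_B powi (-4)) (var_A powi (-4)) = 0"
    using assms by (simp add: subst2_eq subst_diff)
  then have z: "(\<Sum>k\<in>Poly_Mapping.keys (V - W). of_int (Poly_Mapping.lookup (V - W) k) *
      (var_B powi (-4 * fst k) * var_A powi (-4 * snd k))) = 0"
    unfolding subst2_eq subst_def case_prod_beta by (simp only: pw var_A_0 var_B_0 not_False_eq_True)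
  have "Poly_Mapping.lookup (V - W) k = 0" if "k \<in> Poly_Mapping.keys (V - W)" for k
    by (rule monomials_independent[OF _ _ z that]) (auto simp: inj_on_def)
  then have "V - W = 0" by (intro poly_mapping_eqI) (metis in_keys_iff lookup_zero)
  then show ?thesis by simp
qed

lemma subst1_inject:
  assumes "subst1 V (var_A powi (-4)) = subst1 W (var_A powi (-4))"
  shows "V = W"
proof -
  have pw: "unit_power (z powi (-4)) i = z powi (-4 * i)" if "z \<noteq> 0" for z :: ratfun and i
    using that by (simp only: unit_power_field power_int_eq_0_iff power_int_mult simp_thms)
  have "subst1 (V - W) (var_A powi (-4)) = 0"
    using assms by (simp add: subst1_eq subst_diff)
  then have z: "(\<Sum>k\<in>Poly_Mapping.keys (V - W). of_int (Poly_Mapping.lookup (V - W) k) *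
      (var_B powi 0 * var_A powi (-4 * k))) = 0"
    unfolding subst1_eq subst_def by (simp add: pw del: power_int_minus power_int_numeral_neg_numeral)
  have "Poly_Mapping.lookup (V - W) k = 0" if "k \<in> Poly_Mapping.keys (V - W)" for k
    by (rule monomials_independent[OF _ _ z that]) (auto simp: inj_on_def)
  then have "V - W = 0" by (intro poly_mapping_eqI) (metis in_keys_iff lookup_zero)
  then show ?thesis by simp
qed

section \<open>Invariance under the diagram moves\<close>

lemma orientation_move:
  fixes q r :: "'r::comm_ring_1"
  assumes qr: "q * r = 1" and "move x y" "wfs n x m" "length xs = n"
  shows "evf (tag (ow q r) x) \<phi> xs = evf (tag (ow q r) y) \<phi> xs \<and> (\<forall>p. \<not> is_R1 x y p) \<or>
    (\<exists>p. is_R1 x y p \<and> evf (tag (ow q r) x) \<phi> xs = kink q r p * evf (tag (ow q r) y) \<phi> xs)"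
  using assms(2-)
proof (cases rule: move.cases)
  case (distant i p j p')
  have "if p = Cup then i \<le> length xs else i + 2 \<le> length xs"
    using assms(3,4) unfolding distant by (cases "p = Cup") auto
  moreover have "\<forall>p. \<not> is_R1 x y p" unfolding distant is_R1_def by (cases p) auto
  ultimately show ?thesis using act_distant[OF distant(3)]
    unfolding distant tag_simps evf.simps by blast
next
  case (straighten1 i)
  with assms have "i + 1 \<le> length xs" by auto
  then obtain us x vs where "xs = us @ x # vs" "length us = i"
    by (metis Suc_eq_plus1 id_take_nth_drop length_take less_eq_Suc_le min.absorb2 less_or_eq_imp_le)
  with straighten1 show ?thesis
    by (cases x) (auto simp: sum_bool is_R1_def)
next
  case (straighten2 i)
  with assms have "i + 1 \<le> length xs" by auto
  then obtain us x vs where "xs = us @ x # vs" "length us = i"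
    by (metis Suc_eq_plus1 id_take_nth_drop length_take less_eq_Suc_le min.absorb2 less_or_eq_imp_le)
  with straighten2 show ?thesis
    by (cases x) (auto simp: sum_bool is_R1_def)
next
  case (slide_cup p i)
  with assms have "i + 1 \<le> length xs" by (auto simp: is_crossing_def)
  then obtain us x vs where "xs = us @ x # vs" "length us = i"
    by (metis Suc_eq_plus1 id_take_nth_drop length_take less_eq_Suc_le min.absorb2 less_or_eq_imp_le)
  with slide_cup show ?thesis
    by (cases x) (auto simp: is_crossing_def sum_bool is_R1_def algebra_simps)
next
  case (slide_cap p i)
  with assms have "i + 3 \<le> length xs" by (auto simp: is_crossing_def)
  then obtain us x y z vs where "xs = us @ x # y # z # vs" "length us = i"
    by (rule split_at3)
  with slide_cap show ?thesis
    by (cases x; cases y; cases z) (auto simp: is_crossing_def sum_bool is_R1_def algebra_simps)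
next
  case (R1_cup p i)
  with assms have "i \<le> length xs" by (auto simp: is_crossing_def)
  then obtain us vs where "xs = us @ vs" "length us = i"
    by (rule split_at)
  with R1_cup show ?thesis
    by (intro disjI2 exI[of _ p]) (auto simp: is_R1_def is_crossing_def sum_bool algebra_simps)
next
  case (R1_cap p i)
  with assms have "i + 2 \<le> length xs" by (auto simp: is_crossing_def)
  then obtain us x y vs where "xs = us @ x # y # vs" "length us = i"
    by (rule split_at2)
  with R1_cap show ?thesis
    by (intro disjI2 exI[of _ p]) (cases x; cases y; auto simp: is_R1_def is_crossing_def sum_bool algebra_simps)
next
  case (R2 p i)
  with assms have "i + 2 \<le> length xs" by (auto simp: is_crossing_def)
  then obtain us x y vs where "xs = us @ x # y # vs" "length us = i"
    by (rule split_at2)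
  with R2 show ?thesis
    by (cases x; cases y) (auto simp: is_crossing_def sum_bool is_R1_def power2_inv[OF qr] algebra_simps)
next
  case (R3 p i)
  with assms have "i + 3 \<le> length xs" by (auto simp: is_crossing_def)
  then obtain us x y z vs where "xs = us @ x # y # z # vs" "length us = i"
    by (rule split_at3)
  with R3 show ?thesis
    by (cases x; cases y; cases z) (auto simp: is_crossing_def sum_bool is_R1_def algebra_simps)
qed

lemma is_R1_unique: "is_R1 x y p \<Longrightarrow> is_R1 x y p' \<Longrightarrow> p = p'"
  by (auto simp: is_R1_def)

text \<open>The part below the move acts linearly, so a local factor comes out of the whole state
  sum. The rule is quantified over the weights because bracket and orientation weights are used with
  the same \<open>x\<close> and \<open>y\<close>.\<close>

lemma local_move_ev:
  assumes "local_move D E"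
  obtains x y where "move x y"
    "\<And>(w :: piece \<Rightarrow> 'r::comm_ring_1 weight) c.
       (\<And>\<phi> n m xs. wfs n x m \<Longrightarrow> length xs = n \<Longrightarrow> evf (tag w x) \<phi> xs = c * evf (tag w y) \<phi> xs)
       \<Longrightarrow> ev w D = c * ev w E"
proof -
  obtain u x y v where D: "D = u @ x @ v" and E: "E = u @ y @ v" and "move x y"
    and wf: "wfs 0 D 0" using assms
    by (auto simp: local_move_def link_diagram_def wf_from_wfs)
  obtain n m where n: "wfs 0 u n" "wfs n x m" using wf by (auto simp: D wfs_append)
  show ?thesis
  proof (rule that[OF \<open>move x y\<close>])
    fix w :: "piece \<Rightarrow> 'r weight" and c
    assume *: "\<And>\<phi> n m xs. wfs n x m \<Longrightarrow> length xs = n \<Longrightarrow> evf (tag w x) \<phi> xs = c * evf (tag w y) \<phi> xs"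
    have "ev w D = evf (tag w u) (\<lambda>xs. c * evf (tag w y) (evf (tag w v) eps) xs) []"
      unfolding ev_def D tag_simps evf_append
      by (rule evf_cong[where n = 0 and m = n]) (use n * in auto)
    then show "ev w D = c * ev w E"
      by (simp add: ev_def E evf_scale)
  qed
qed

text \<open>A curl changes the bracket by -a^3 or -b^3 and the orientation sum by the inverse
  factor. The orientation sum takes the place of the power of the writhe, so no orientation has to
  be transported along the moves.\<close>

lemma bracket_orientation_invariant:
  fixes a b :: "'r::comm_ring_1"
  assumes ab: "a * b = 1" and "local_move D E"
  shows "ev (bw a b) D * ev (ow (- (b ^ 3)) (- (a ^ 3))) D =
    ev (bw a b) E * ev (ow (- (b ^ 3)) (- (a ^ 3))) E"
proof -
  obtain x y where "move x y" and *: "\<And>(w :: piece \<Rightarrow> 'r::comm_ring_1 weight) c.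
       (\<And>\<phi> n m xs. wfs n x m \<Longrightarrow> length xs = n \<Longrightarrow> evf (tag w x) \<phi> xs = c * evf (tag w y) \<phi> xs)
       \<Longrightarrow> ev w D = c * ev w E"
    using local_move_ev[OF assms(2), where 'r = 'r] by metis
  have cube: "(a ^ 3) * (b ^ 3) = 1" using ab by (metis power_mult_distrib power_one)
  then have qr: "(- (b ^ 3)) * (- (a ^ 3)) = 1" by (simp add: mult.commute)
  let ?o = "ow (- (b ^ 3)) (- (a ^ 3))"
  show ?thesis
  proof (cases "\<exists>p. is_R1 x y p")
    case True
    then obtain p where p: "is_R1 x y p" by blast
    have b: "ev (bw a b) D = kink (- (a ^ 3)) (- (b ^ 3)) p * ev (bw a b) E"
    proof (rule *)
      fix \<phi> n m and xs :: "bool list" assume "wfs n x m" "length xs = n"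
      from p obtain i where "is_crossing p" and
        xy: "x = [(i, Cup), (i, p)] \<and> y = [(i, Cup)] \<or> x = [(i, p), (i, Cap)] \<and> y = [(i, Cap)]"
        by (auto simp: is_R1_def)
      from bracket_move[OF ab \<open>move x y\<close> \<open>wfs n x m\<close> \<open>length xs = n\<close>, of \<phi>]
      show "evf (tag (bw a b) x) \<phi> xs = kink (- (a ^ 3)) (- (b ^ 3)) p * evf (tag (bw a b) y) \<phi> xs"
        using p is_R1_unique by blast
    qed
    moreover have "ev ?o D = kink (- (b ^ 3)) (- (a ^ 3)) p * ev ?o E"
    proof (rule *)
      fix \<phi> n m and xs :: "bool list" assume "wfs n x m" "length xs = n"
      from orientation_move[OF qr \<open>move x y\<close> this, of \<phi>]
      show "evf (tag ?o x) \<phi> xs = kink (- (b ^ 3)) (- (a ^ 3)) p * evf (tag ?o y) \<phi> xs"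
        using p is_R1_unique by blast
    qed
    moreover have "kink (- (a ^ 3)) (- (b ^ 3)) p * kink (- (b ^ 3)) (- (a ^ 3)) p = 1"
      using cube by (cases p) (auto simp: mult.commute)
    ultimately show ?thesis
      by (simp only: mult.assoc mult.left_commute[of "ev (bw a b) E"]) (simp only: mult.assoc[symmetric] mult_1)
  next
    case False
    have "ev (bw a b) D = 1 * ev (bw a b) E"
    proof (rule *)
      fix \<phi> n m and xs :: "bool list" assume "wfs n x m" "length xs = n"
      from bracket_move[OF ab \<open>move x y\<close> this, of \<phi>]
      show "evf (tag (bw a b) x) \<phi> xs = 1 * evf (tag (bw a b) y) \<phi> xs"
        using False by auto
    qed
    moreover have "ev ?o D = 1 * ev ?o E"
    proof (rule *)
      fix \<phi> n m and xs :: "bool list" assume "wfs n x m" "length xs = n"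
      from orientation_move[OF qr \<open>move x y\<close> this, of \<phi>]
      show "evf (tag ?o x) \<phi> xs = 1 * evf (tag ?o y) \<phi> xs"
        using False by auto
    qed
    ultimately show ?thesis by simp
  qed
qed

subsection \<open>Crossingless diagrams\<close>

text \<open>
  \<open>circ S k\<close>: planar isotopies turn \<open>S\<close> into \<open>k\<close> nested or separate circles.
\<close>

inductive circ :: "diagram \<Rightarrow> nat \<Rightarrow> bool" where
  circ_Nil: "circ [] 0"
| circ_round: "circ (u @ v) k \<Longrightarrow> circ (u @ [(i, Cup), (i, Cap)] @ v) (Suc k)"
| circ_left: "circ (u @ v) k \<Longrightarrow> circ (u @ [(i, Cup), (Suc i, Cap)] @ v) k"
| circ_right: "circ (u @ v) k \<Longrightarrow> circ (u @ [(Suc i, Cup), (i, Cap)] @ v) k"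
| circ_above: "i + 2 \<le> j \<Longrightarrow> circ (u @ [(j - 2, Cap), (i, Cup)] @ v) k
    \<Longrightarrow> circ (u @ [(i, Cup), (j, Cap)] @ v) k"
| circ_below: "j + 2 \<le> i \<Longrightarrow> circ (u @ [(j, Cap), (i - 2, Cup)] @ v) k
    \<Longrightarrow> circ (u @ [(i, Cup), (j, Cap)] @ v) k"

definition crossingless :: "('b \<times> piece) list \<Rightarrow> bool" where
  "crossingless S \<longleftrightarrow> (\<forall>(i, p)\<in>set S. \<not> is_crossing p)"

lemma crossingless_simps [simp]:
  "crossingless []" "crossingless (x # S) \<longleftrightarrow> \<not> is_crossing (snd x) \<and> crossingless S"
  "crossingless (S @ S') \<longleftrightarrow> crossingless S \<and> crossingless S'"
  by (auto simp: crossingless_def)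

lemma is_crossing_simps [simp]:
  "is_crossing Xo" "is_crossing Xu" "\<not> is_crossing Cup" "\<not> is_crossing Cap"
  by (auto simp: is_crossing_def)

definition cups :: "nat list \<Rightarrow> diagram" where "cups is = map (\<lambda>i. (i, Cup)) is"

lemma wfs_cups: "wfs n (cups is) m \<Longrightarrow> m = n + 2 * length is"
proof (induction "is" arbitrary: n)
  case (Cons i "is")
  then show ?case using Cons.IH[of "n + 2"] by (simp add: cups_def)
qed (simp add: cups_def)

lemma crossingless_cases:
  assumes "crossingless S"
  obtains "is" where "S = cups is" | "is" j v where "S = cups is @ (j, Cap) # v"
proof -
  have "(\<exists>is. S = cups is) \<or> (\<exists>is j v. S = cups is @ (j, Cap) # v)"
    using assms
  proof (induction S)
    case (Cons e S)
    obtain i p where e: "e = (i, p)" by (cases e)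
    consider "p = Cap" | "p = Cup" using Cons e by (cases p) auto
    then show ?case
    proof cases
      case 1
      then have "e # S = cups [] @ (i, Cap) # S" by (simp add: e cups_def)
      then show ?thesis by blast
    next
      case 2
      from Cons have "(\<exists>is. S = cups is) \<or> (\<exists>is j v. S = cups is @ (j, Cap) # v)" by auto
      then show ?thesis
      proof (elim disjE exE)
        fix "is" assume "S = cups is"
        then have "e # S = cups (i # is)" by (simp add: e 2 cups_def)
        then show ?thesis by blast
      next
        fix "is" j v assume "S = cups is @ (j, Cap) # v"
        then have "e # S = cups (i # is) @ (j, Cap) # v" by (simp add: e 2 cups_def)
        then show ?thesis by blast
      qed
    qed
  qed (auto simp: cups_def)
  then show ?thesis using that by blast
qed

lemma wfs_above:
  assumes "i + 2 \<le> j" "wfs n (u @ [(i, Cup), (j, Cap)] @ v) m"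
  shows "wfs n (u @ [(j - 2, Cap), (i, Cup)] @ v) m"
proof -
  obtain a where a: "wfs n u a" "j \<le> a" "wfs a v m" using assms by (auto simp: wfs_append)
  then have "Suc (Suc (a - 2)) = a" using assms by simp
  with a show ?thesis using assms by (auto simp: wfs_append intro!: exI[of _ a])
qed

lemma wfs_below:
  assumes "j + 2 \<le> i" "wfs n (u @ [(i, Cup), (j, Cap)] @ v) m"
  shows "wfs n (u @ [(j, Cap), (i - 2, Cup)] @ v) m"
proof -
  obtain a where a: "wfs n u a" "i \<le> a" "wfs a v m" using assms by (auto simp: wfs_append)
  then have "Suc (Suc (a - 2)) = a" using assms by simp
  with a show ?thesis using assms by (auto simp: wfs_append intro!: exI[of _ a])
qed

text \<open>Below the lowest cap there are only cups. The cap either cancels with the cup just below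
  it, which shortens the diagram, or is exchanged with it. The bound on \<open>n\<close> covers
  closed diagrams and one-strand tangles.\<close>

lemma circ_exists:
  assumes "n \<le> 1" "crossingless S" "wfs n S n"
  shows "\<exists>k. circ S k"
  using assms(2,3)
proof (induction "length S" arbitrary: S rule: less_induct)
  case less
  from less(2) show ?case
  proof (cases rule: crossingless_cases)
    case (1 "is")
    then show ?thesis using wfs_cups[of n "is" n] less(3) circ_Nil by (auto simp: cups_def)
  next
    case (2 "is" j v)
    \<comment> \<open>Inner induction on the number of cups below the cap; exchanges keep the
      length, so the outer induction does not see them.\<close>
    have "\<exists>k. circ (cups is @ (j, Cap) # v) k"
      if "length (cups is @ (j, Cap) # v) = length S" "wfs n (cups is @ (j, Cap) # v) n"
        "crossingless v" for "is" j v
      using that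
    proof (induction "is" arbitrary: j v rule: rev_induct)
      case Nil
      \<comment> \<open>A cap as lowest event would need two strands, but at most one
        enters.\<close>
      then show ?case using assms(1) by (auto simp: cups_def)
    next
      case (snoc i "is")
      have eq: "cups (is @ [i]) @ (j, Cap) # v = cups is @ [(i, Cup), (j, Cap)] @ v"
        by (simp add: cups_def)
      obtain a where a: "wfs n (cups is) a" "wfs a ([(i, Cup), (j, Cap)] @ v) n"
        using snoc.prems(2) unfolding eq by (subst (asm) wfs_append) blast
      have c: "crossingless (cups is)" by (auto simp: cups_def crossingless_def)
      have IH: "\<exists>k. circ (cups is @ v) k" if "wfs a v n"
        using that a(1) snoc.prems c unfolding eq
        by (intro less(1)) (auto simp: wfs_append)
      consider "i = j" | "j = Suc i" | "i = Suc j" | "i + 2 \<le> j" | "j + 2 \<le> i" by linarith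
      then show ?case
      proof cases
        case 1 then show ?thesis using a IH unfolding eq using circ_round[of "cups is" v _ i] by auto
      next
        case 2 then show ?thesis using a IH unfolding eq using circ_left[of "cups is" v _ i] by auto
      next
        case 3 then show ?thesis using a IH unfolding eq using circ_right[of "cups is" v _ j] by auto
      next
        case 4
        have "\<exists>k. circ (cups is @ (j - 2, Cap) # (i, Cup) # v) k"
          using snoc.prems wfs_above[OF 4, of n "cups is" v n] unfolding eq
          by (intro snoc.IH) auto
        with 4 show ?thesis unfolding eq using circ_above[of i j "cups is" v] by auto
      next
        case 5
        have "\<exists>k. circ (cups is @ (j, Cap) # (i - 2, Cup) # v) k"
          using snoc.prems wfs_below[OF 5, of n "cups is" v n] unfolding eq
          by (intro snoc.IH) auto
        with 5 show ?thesis unfolding eq using circ_below[of j i "cups is" v] by auto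
      qed
    qed
    from this[of "is" j v] show ?thesis using 2 less by auto
  qed
qed

text \<open>The two snake identities and the loop value \<open>d\<close>. This is all that a vertex
  model needs in order to be evaluated along \<open>circ\<close>; it holds for the bracket, for its
  reflected version and for the count of orientations.\<close>

definition zigzag :: "(piece \<Rightarrow> 'r::comm_ring_1 weight) \<Rightarrow> 'r \<Rightarrow> bool" where
  "zigzag w d \<longleftrightarrow>
    (\<forall>x y. (\<Sum>c\<in>UNIV. w Cup x c x c * w Cap c y c y) = of_bool (x = y)) \<and>
    (\<forall>x y. (\<Sum>c\<in>UNIV. w Cap x c x c * w Cup c y c y) = of_bool (x = y)) \<and>
    (\<Sum>x\<in>UNIV. \<Sum>y\<in>UNIV. w Cup x y x y * w Cap x y x y) = d"

lemma split_at1: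
  assumes "i + 1 \<le> length xs" obtains us x vs where "xs = us @ x # vs" "length us = i"
  using assms by (metis Suc_eq_plus1 id_take_nth_drop length_take less_eq_Suc_le min.absorb2 less_or_eq_imp_le)

lemma evf_round:
  assumes "zigzag w d" "i \<le> length xs"
  shows "evf (tag w [(i, Cup), (i, Cap)]) \<phi> xs = d * \<phi> xs"
proof -
  obtain us vs where "xs = us @ vs" "length us = i" using split_at assms(2) by metis
  moreover have "d = (\<Sum>x\<in>UNIV. \<Sum>y\<in>UNIV. w Cup x y x y * w Cap x y x y)"
    using assms(1) by (simp add: zigzag_def)
  ultimately show ?thesis by (auto simp: sum_bool algebra_simps)
qed

lemma evf_straighten:
  assumes "zigzag w d" "i < length xs"
  shows "evf (tag w [(i, Cup), (Suc i, Cap)]) \<phi> xs = \<phi> xs"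
    and "evf (tag w [(Suc i, Cup), (i, Cap)]) \<phi> xs = \<phi> xs"
proof -
  obtain us x vs where xs: "xs = us @ x # vs" "length us = i" using split_at1 assms(2)
    by (metis Suc_eq_plus1 Suc_leI)
  have z1: "w Cup a True a True * w Cap True b True b + w Cup a False a False * w Cap False b False b = of_bool (a = b)" for a b
    using assms(1) unfolding zigzag_def sum_bool by blast
  have z2: "w Cap a True a True * w Cup True b True b + w Cap a False a False * w Cup False b False b = of_bool (a = b)" for a b
    using assms(1) unfolding zigzag_def sum_bool by blast
  have "evf (tag w [(i, Cup), (Suc i, Cap)]) \<phi> xs =
     (w Cup True True True True * w Cap True x True x + w Cup True False True False * w Cap False x False x) * \<phi> (us @ True # vs)
   + (w Cup False True False True * w Cap True x True x + w Cup False False False False * w Cap False x False x) * \<phi> (us @ False # vs)"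
    using xs by (auto simp: sum_bool algebra_simps)
  also have "\<dots> = \<phi> xs" unfolding z1 by (simp add: xs)
  finally show "evf (tag w [(i, Cup), (Suc i, Cap)]) \<phi> xs = \<phi> xs" .
  have "evf (tag w [(Suc i, Cup), (i, Cap)]) \<phi> xs =
     (w Cap x True x True * w Cup True True True True + w Cap x False x False * w Cup False True False True) * \<phi> (us @ True # vs)
   + (w Cap x True x True * w Cup True False True False + w Cap x False x False * w Cup False False False False) * \<phi> (us @ False # vs)"
    using xs by (auto simp: sum_bool algebra_simps)
  also have "\<dots> = \<phi> xs" unfolding z2 by (simp add: xs)
  finally show "evf (tag w [(Suc i, Cup), (i, Cap)]) \<phi> xs = \<phi> xs" .
qed

lemma evf_replace:
  assumes "wfs n (u @ x @ v) m" "length xs = n"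
    and "\<And>k l xs \<phi>. wfs k x l \<Longrightarrow> length xs = k \<Longrightarrow> evf (tag w x) \<phi> xs = c * evf (tag w y) \<phi> xs"
  shows "evf (tag w (u @ x @ v)) \<phi> xs = c * evf (tag w (u @ y @ v)) \<phi> xs"
proof -
  obtain k l where k: "wfs n u k" "wfs k x l" using assms(1) by (auto simp: wfs_append)
  have "evf (tag w (u @ x @ v)) \<phi> xs = evf (tag w u) (\<lambda>xs. c * evf (tag w y) (evf (tag w v) \<phi>) xs) xs"
    unfolding tag_simps evf_append
    by (rule evf_cong[where n = n and m = k]) (use k assms in auto)
  then show ?thesis by (simp add: evf_scale)
qed

text \<open>Every clause of \<open>circ\<close> is an instance of a \<open>zigzag\<close> identity
  or of a distant exchange, applied in context.\<close>

lemma circ_evf: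
  assumes "circ S k" "zigzag w d" "wfs n S m" "length xs = n"
  shows "evf (tag w S) \<phi> xs = d ^ k * \<phi> xs"
  using assms(1,3,4)
proof (induction S k)
  case (circ_round u v k i)
  have "evf (tag w (u @ [(i, Cup), (i, Cap)] @ v)) \<phi> xs = d * evf (tag w (u @ [] @ v)) \<phi> xs"
    using circ_round.prems by (rule evf_replace) (auto simp del: tag_simps simp: evf_round[OF assms(2)] tag_simps(1))
  moreover have "wfs n (u @ v) m" using circ_round.prems by (auto simp: wfs_append)
  ultimately show ?case using circ_round.IH[of] circ_round.prems(2) by (simp add: algebra_simps)
next
  case (circ_left u v k i)
  have "evf (tag w (u @ [(i, Cup), (Suc i, Cap)] @ v)) \<phi> xs = 1 * evf (tag w (u @ [] @ v)) \<phi> xs"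
    using circ_left.prems
    by (rule evf_replace) (auto simp del: tag_simps simp: evf_straighten[OF assms(2)] tag_simps(1))
  moreover have "wfs n (u @ v) m" using circ_left.prems by (auto simp: wfs_append)
  ultimately show ?case using circ_left.IH[of] circ_left.prems(2) by (simp add: algebra_simps)
next
  case (circ_right u v k i)
  have "evf (tag w (u @ [(Suc i, Cup), (i, Cap)] @ v)) \<phi> xs = 1 * evf (tag w (u @ [] @ v)) \<phi> xs"
    using circ_right.prems
    by (rule evf_replace) (auto simp del: tag_simps simp: evf_straighten[OF assms(2)] tag_simps(1))
  moreover have "wfs n (u @ v) m" using circ_right.prems by (auto simp: wfs_append)
  ultimately show ?case using circ_right.IH[of] circ_right.prems(2) by (simp add: algebra_simps)
next
  case (circ_above i j u v k)
  have "evf (tag w (u @ [(i, Cup), (j, Cap)] @ v)) \<phi> xs = 1 * evf (tag w (u @ [(j - 2, Cap), (i, Cup)] @ v)) \<phi> xs"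
    using circ_above.prems
    by (rule evf_replace) (use circ_above(1) in \<open>auto simp del: act.simps intro!: act_distant[of i Cup j, simplified]\<close>)
  then show ?case using circ_above.IH[OF wfs_above[OF circ_above(1,4)]] circ_above.prems(2) by simp
next
  case (circ_below j i u v k)
  have "Suc (Suc (i - 2)) = i" using circ_below(1) by simp
  then have *: "act (i, Cup, w Cup) (act (j, Cap, w Cap) \<phi>) xs =
      act (j, Cap, w Cap) (act (i - 2, Cup, w Cup) \<phi>) xs" if "i \<le> length xs" for xs \<phi>
    using act_distant[of j Cap "i - 2" xs "w Cap" Cup "w Cup" \<phi>] circ_below(1) that by simp
  have "evf (tag w (u @ [(i, Cup), (j, Cap)] @ v)) \<phi> xs = 1 * evf (tag w (u @ [(j, Cap), (i - 2, Cup)] @ v)) \<phi> xs"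
    using circ_below.prems
    by (rule evf_replace) (auto simp del: act.simps simp: *)
  then show ?case using circ_below.IH[OF wfs_below[OF circ_below(1,4)]] circ_below.prems(2) by simp
qed auto

text \<open>A zigzag needs a strand to sit on, so straightening cannot produce the empty diagram and
  some circle must be split off. This lets the circle value be factored out of the bracket.\<close>

lemma circ_pos: "circ S k \<Longrightarrow> wfs 0 S m \<Longrightarrow> S \<noteq> [] \<Longrightarrow> k \<ge> 1"
proof (induction S k rule: circ.induct)
  case (circ_left u v k i)
  then show ?case by (cases "u @ v = []") (auto simp: wfs_append)
next
  case (circ_right u v k i)
  then show ?case by (cases "u @ v = []") (auto simp: wfs_append)
next
  case (circ_above i j u v k)
  have "wfs 0 (u @ [(j - 2, Cap), (i, Cup)] @ v) m"
    using wfs_above[OF circ_above(1,4)] .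
  then show ?case using circ_above by auto
next
  case (circ_below j i u v k)
  have "wfs 0 (u @ [(j, Cap), (i - 2, Cup)] @ v) m"
    using wfs_below[OF circ_below(1,4)] .
  then show ?case using circ_below by auto
qed auto

text \<open>
  \<open>shading D - 2\<close> will be the residue modulo 4 of the exponents of \<open>A\<close> in the bracket of \<open>D\<close>.
\<close>

fun shade :: "nat \<times> piece \<Rightarrow> int" where
  "shade (i, Cup) = 2 * (int i + 1)" | "shade (i, Cap) = 2 * int i"
| "shade (i, Xo) = -1" | "shade (i, Xu) = 1"

definition shading :: "diagram \<Rightarrow> int" where "shading D = (\<Sum>e\<leftarrow>D. shade e)"

lemma mod4_add: "x mod 4 = y mod 4 \<Longrightarrow> (x + 4 * z + c) mod 4 = (y + c) mod (4::int)"
  by presburger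

text \<open>Straightening a zigzag and exchanging a cup with a cap change \<open>shading\<close> by
  multiples of 4, whereas splitting off a circle at position \<open>i\<close> changes it by 4 i +
  2.\<close>

lemma circ_shading: "circ S k \<Longrightarrow> shading S mod 4 = 2 * int k mod 4"
proof (induction S k rule: circ.induct)
  case (circ_above i j u v k)
  then have "shading (u @ [(i, Cup), (j, Cap)] @ v) = shading (u @ [(j - 2, Cap), (i, Cup)] @ v) + 4"
    by (simp add: shading_def of_nat_diff algebra_simps)
  then show ?case using circ_above.IH by presburger
next
  case (circ_below j i u v k)
  then have "shading (u @ [(i, Cup), (j, Cap)] @ v) = shading (u @ [(j, Cap), (i - 2, Cup)] @ v) + 4"
    by (simp add: shading_def of_nat_diff algebra_simps)
  then show ?case using circ_below.IH by presburger
next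
  case (circ_round u v k i)
  have "shading (u @ [(i, Cup), (i, Cap)] @ v) = shading (u @ v) + 4 * int i + 2"
    by (simp add: shading_def algebra_simps)
  then show ?case using mod4_add[OF circ_round.IH, of "int i" 2] by (simp add: algebra_simps)
next
  case (circ_left u v k i)
  have "shading (u @ [(i, Cup), (Suc i, Cap)] @ v) = shading (u @ v) + 4 * (int i + 1)"
    by (simp add: shading_def algebra_simps)
  then show ?case using mod4_add[OF circ_left.IH, of "int i + 1" 0] by simp
next
  case (circ_right u v k i)
  have "shading (u @ [(Suc i, Cup), (i, Cap)] @ v) = shading (u @ v) + 4 * (int i + 1)"
    by (simp add: shading_def algebra_simps)
  then show ?case using mod4_add[OF circ_right.IH, of "int i + 1" 0] by simp
qed (simp add: shading_def)

lemma zigzag_bw: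
  assumes "a * b = 1"
  shows "zigzag (bw a b) (- (a\<^sup>2) - b\<^sup>2)"
    and "zigzag (\<lambda>p. flip (bw a b p)) (- (a\<^sup>2) - b\<^sup>2)"
  unfolding zigzag_def sum_bool flip_def
  by (auto simp: cupw_def capw_def power2_inv[OF assms] mult.commute[of "b\<^sup>2" "a\<^sup>2"])

lemma zigzag_ow: "zigzag (ow q r) 2"
  unfolding zigzag_def sum_bool by auto

subsection \<open>Labellings as paths\<close>

text \<open>A history lists the states after each event, without the initial one. The type of states
  is left open because both label lists and pairs of label lists occur.\<close>

fun paths :: "('s \<Rightarrow> 's set) list \<Rightarrow> 's \<Rightarrow> 's list set" where
  "paths [] x = {[]}"
| "paths (S # P) x = (\<Union>y\<in>S x. (#) y ` paths P y)"

fun weight :: "('s \<Rightarrow> 's \<Rightarrow> 'r::comm_ring_1) list \<Rightarrow> 's \<Rightarrow> 's list \<Rightarrow> 'r" where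
  "weight (w # W) x (y # ys) = w x y * weight W y ys"
| "weight _ _ _ = 1"

lemma paths_iff:
  "r \<in> paths P x \<longleftrightarrow> length r = length P \<and> (\<forall>l<length P. r ! l \<in> (P ! l) ((x # r) ! l))"
proof (induction P arbitrary: x r)
  case (Cons S P)
  show ?case
  proof (cases r)
    case (Cons y ys)
    have "(\<forall>l<Suc (length P). (y # ys) ! l \<in> ((S # P) ! l) ((x # y # ys) ! l)) \<longleftrightarrow>
      y \<in> S x \<and> (\<forall>l<length P. ys ! l \<in> (P ! l) ((y # ys) ! l))"
      by (simp add: All_less_Suc2)
    then show ?thesis using Cons.IH[of ys y] by (auto simp: Cons image_iff)
  qed auto
qed auto

lemma finite_paths: "(\<And>S x. S \<in> set P \<Longrightarrow> finite (S x)) \<Longrightarrow> finite (paths P x)"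
  by (induction P arbitrary: x) auto

lemma sum_paths_Cons:
  assumes "finite (S x)" "\<And>y. finite (paths P y)"
  shows "(\<Sum>r\<in>paths (S # P) x. f r) = (\<Sum>y\<in>S x. \<Sum>r\<in>paths P y. f (y # r))"
proof -
  have "(\<Sum>r\<in>paths (S # P) x. f r) = (\<Sum>y\<in>S x. \<Sum>r\<in>(#) y ` paths P y. f r)"
    unfolding paths.simps by (rule sum.UNION_disjoint) (use assms in auto)
  also have "\<dots> = (\<Sum>y\<in>S x. \<Sum>r\<in>paths P y. f (y # r))"
    by (rule sum.cong[OF refl]) (auto simp: sum.reindex inj_on_def)
  finally show ?thesis .
qed

fun succs :: "nat \<times> piece \<Rightarrow> bool list \<Rightarrow> bool list set" where
  "succs (i, Cup) xs = {ins i True False xs, ins i False True xs}"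
| "succs (i, Cap) xs = (if xs ! i \<noteq> xs ! Suc i then {del i xs} else {})"
| "succs (i, _) xs = {ins i (xs ! Suc i) (xs ! i) (del i xs)}"

text \<open>Weights under which a label follows its strand through a crossing and changes at an
  extremum. For them the labellings that contribute are the orientations.\<close>

fun permw :: "piece \<Rightarrow> 'r::comm_ring_1 weight \<Rightarrow> bool" where
  "permw Cup w \<longleftrightarrow> (\<forall>c. w c c c c = 0)"
| "permw Cap w \<longleftrightarrow> (\<forall>c. w c c c c = 0)"
| "permw _ w \<longleftrightarrow> (\<forall>x y c d. c \<noteq> y \<or> d \<noteq> x \<longrightarrow> w x y c d = 0)"

fun locw :: "'r event \<Rightarrow> bool list \<Rightarrow> bool list \<Rightarrow> 'r" where
  "locw (i, Cup, w) xs ys = w (ys ! i) (ys ! Suc i) (ys ! i) (ys ! Suc i)"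
| "locw (i, Cap, w) xs ys = w (xs ! i) (xs ! Suc i) (xs ! i) (xs ! Suc i)"
| "locw (i, _, w) xs ys = w (xs ! i) (xs ! Suc i) (xs ! Suc i) (xs ! i)"

lemma finite_succs [simp]: "finite (succs e xs)"
  by (cases "(e, xs)" rule: succs.cases) auto

lemma act_succs:
  assumes "permw p w" "if p = Cup then i \<le> length xs else i + 2 \<le> length xs"
  shows "act (i, p, w) \<phi> xs = (\<Sum>ys\<in>succs (i, p) xs. locw (i, p, w) xs ys * \<phi> ys)"
proof (cases "p = Cup")
  case True
  then obtain us vs where xs: "xs = us @ vs" "length us = i" using split_at assms(2) by metis
  then show ?thesis using True assms(1) by (auto simp: sum_bool)
next
  case False
  then obtain us x y vs where xs: "xs = us @ x # y # vs" "length us = i"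
    using split_at2 assms(2) by metis
  show ?thesis
  proof (cases "p = Cap")
    case True
    then show ?thesis using xs assms(1) by (cases x; cases y) auto
  next
    case c: False
    have "w x y (\<not> y) d = 0" "w x y c (\<not> x) = 0" for x y c d
      using False c assms(1) by (cases p; auto)+
    then have "w x True False d = 0" "w x False True d = 0" "w True y c False = 0" "w False y c True = 0"
      for x y c d by (metis (full_types))+
    then show ?thesis using False c xs
      by (cases p; cases x; cases y) (auto simp: sum_bool)
  qed
qed

definition runs :: "diagram \<Rightarrow> bool list \<Rightarrow> bool list list set" where
  "runs D xs = paths (map succs D) xs"

lemma finite_runs [simp]: "finite (runs D xs)"
  unfolding runs_def by (rule finite_paths) auto

lemma succs_length:
  assumes "if p = Cup then i \<le> length xs else i + 2 \<le> length xs" "ys \<in> succs (i, p) xs"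
  shows "length ys = strands_after p (length xs)"
  using assms by (cases p) (auto split: if_splits)

definition perm_events :: "'r::comm_ring_1 event list \<Rightarrow> bool" where
  "perm_events E \<longleftrightarrow> (\<forall>(i, p, w)\<in>set E. permw p w)"

lemma evf_runs:
  assumes "perm_events E" "wfs (length xs) (untag E) m"
  shows "evf E \<phi> xs = (\<Sum>r\<in>runs (untag E) xs. weight (map locw E) xs r * \<phi> (last (xs # r)))"
  using assms
proof (induction E arbitrary: xs)
  case Nil
  then show ?case by (simp add: runs_def)
next
  case (Cons e E)
  obtain i p w where e: "e = (i, p, w)" by (cases e)
  have ok: "permw p w" "if p = Cup then i \<le> length xs else i + 2 \<le> length xs"
    using Cons.prems by (auto simp: e perm_events_def)
  have "evf (e # E) \<phi> xs = (\<Sum>ys\<in>succs (i, p) xs. locw e xs ys * evf E \<phi> ys)"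
    using act_succs[OF ok] by (simp add: e)
  also have "\<dots> = (\<Sum>ys\<in>succs (i, p) xs. \<Sum>r\<in>runs (untag E) ys.
      weight (map locw (e # E)) xs (ys # r) * \<phi> (last (xs # ys # r)))"
  proof (intro sum.cong refl)
    fix ys assume ys: "ys \<in> succs (i, p) xs"
    have "evf E \<phi> ys = (\<Sum>r\<in>runs (untag E) ys. weight (map locw E) ys r * \<phi> (last (ys # r)))"
      using Cons.prems succs_length[OF ok(2) ys] by (intro Cons.IH) (auto simp: e perm_events_def)
    then show "locw e xs ys * evf E \<phi> ys = (\<Sum>r\<in>runs (untag E) ys.
      weight (map locw (e # E)) xs (ys # r) * \<phi> (last (xs # ys # r)))"
      by (simp add: sum_distrib_left mult.assoc)
  qed
  also have "\<dots> = (\<Sum>r\<in>runs (untag (e # E)) xs. weight (map locw (e # E)) xs r * \<phi> (last (xs # r)))"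
    unfolding runs_def by (simp add: e sum_paths_Cons[OF finite_succs finite_runs[unfolded runs_def]] del: paths.simps map_map)
  finally show ?case .
qed

lemma runs_length:
  assumes "wfs (length xs) D m" "r \<in> runs D xs"
  shows "length (last (xs # r)) = m"
  using assms
proof (induction D arbitrary: xs r)
  case (Cons e D)
  obtain i p where e: "e = (i, p)" by (cases e)
  from Cons.prems(2) obtain ys r' where r: "r = ys # r'" "ys \<in> succs (i, p) xs" "r' \<in> runs D ys"
    by (auto simp: runs_def e)
  have "if p = Cup then i \<le> length xs else i + 2 \<le> length xs"
    using Cons.prems(1) by (cases "p = Cup") (auto simp: e)
  from succs_length[OF this r(2)] show ?case using Cons.IH[OF _ r(3)] Cons.prems(1)
    by (simp add: e r(1))
qed (auto simp: runs_def)

lemma ev_runs: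
  assumes "perm_events E" "wfs 0 (untag E) 0"
  shows "evf E eps [] = (\<Sum>r\<in>runs (untag E) []. weight (map locw E) [] r)"
proof -
  have "evf E eps [] = (\<Sum>r\<in>runs (untag E) []. weight (map locw E) [] r * eps (last ([] # r)))"
    using assms by (intro evf_runs) auto
  also have "\<dots> = (\<Sum>r\<in>runs (untag E) []. weight (map locw E) [] r)"
  proof (intro sum.cong refl)
    fix r assume "r \<in> runs (untag E) []"
    then have "last ([] # r) = []" using runs_length[of "[]" "untag E" 0 r] assms by simp
    then show "weight (map locw E) [] r * eps (last ([] # r)) = weight (map locw E) [] r"
      by (simp only: eps_def) simp
  qed
  finally show ?thesis .
qed

subsection \<open>Orientations\<close>

lemma nth_append3:
  "(us @ a # b # vs) ! j = (if j < length us then us ! j else if j = length us then a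
     else if j = Suc (length us) then b else vs ! (j - length us - 2))"
proof -
  consider "j < length us" | "j = length us" | "j = Suc (length us)" | k where "j = length us + 2 + k"
    by (metis add_2_eq_Suc' le_Suc_ex not_less_eq_eq less_antisym not_le)
  then show ?thesis by cases (auto simp: nth_append)
qed

text \<open>Connects transitions of whole label lists with the strandwise description by
  \<open>through\<close>, in which components and orientations are defined.\<close>

lemma succs_iff:
  assumes "if p = Cup then i \<le> length xs else i + 2 \<le> length xs"
  shows "ys \<in> succs (i, p) xs \<longleftrightarrow> length ys = strands_after p (length xs) \<and>
    (\<forall>j j'. j < length xs \<longrightarrow> through (i, p) j = Some j' \<longrightarrow> xs ! j = ys ! j') \<and>
    (p = Cup \<longrightarrow> ys ! i \<noteq> ys ! Suc i) \<and> (p = Cap \<longrightarrow> xs ! i \<noteq> xs ! Suc i)" (is "_ \<longleftrightarrow> ?r")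
proof (cases "p = Cup")
  case True
  then obtain us vs where xs: "xs = us @ vs" "length us = i" using split_at assms by metis
  show ?thesis
  proof
    assume ?r
    then have "i + 2 \<le> length ys" using xs True by simp
    then obtain us' a b vs' where ys: "ys = us' @ a # b # vs'" "length us' = i" by (rule split_at2)
    have len: "length vs' = length vs" using \<open>?r\<close> xs ys True by simp
    have *: "j < length xs \<Longrightarrow> xs ! j = ys ! (if j < i then j else j + 2)" for j
      using \<open>?r\<close> True by simp
    have "us ! j = us' ! j" if "j < i" for j
      using *[of j] that xs ys by (simp add: nth_append)
    then have "us = us'" using xs ys by (intro nth_equalityI) auto
    moreover have "vs ! j = vs' ! j" if "j < length vs" for j
      using *[of "i + j"] that xs ys by (simp add: nth_append nth_append3)
    then have "vs = vs'" using len by (intro nth_equalityI) auto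
    moreover have "a \<noteq> b" using \<open>?r\<close> ys True by auto
    ultimately show "ys \<in> succs (i, p) xs" using xs ys True by auto
  qed (use xs True in \<open>auto simp: nth_append nth_append3\<close>)
next
  case False
  then obtain us x y vs where xs: "xs = us @ x # y # vs" "length us = i"
    using split_at2 assms by metis
  consider "p = Cap" | "is_crossing p" using False by (cases p) auto
  then show ?thesis
  proof cases
    case 1
    show ?thesis
    proof
      assume ?r
      have "through (i, p) j = Some (if j < i then j else j - 2)" if "j < i \<or> i + 2 \<le> j" for j
        using 1 that by auto
      then have *: "j < length xs \<Longrightarrow> j < i \<or> i + 2 \<le> j \<Longrightarrow> xs ! j = ys ! (if j < i then j else j - 2)" for j
        using \<open>?r\<close> by blast
      have "ys = us @ vs"
      proof (rule nth_equalityI)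
        fix j assume "j < length ys"
        then have "j < length us + length vs" using \<open>?r\<close> 1 xs by simp
        then show "ys ! j = (us @ vs) ! j"
          using *[of "if j < i then j else j + 2"] xs
          by (cases "j < i") (auto simp: nth_append nth_append3)
      qed (use \<open>?r\<close> 1 xs in simp)
      then show "ys \<in> succs (i, p) xs" using \<open>?r\<close> 1 xs by auto
    qed (use xs 1 in \<open>auto simp: nth_append nth_append3 split: if_splits\<close>)
  next
    case 2
    have th: "through (i, p) j = Some (if j = i then i + 1 else if j = i + 1 then i else j)" for j
      using 2 by (cases p) auto
    have succ: "succs (i, p) xs = {us @ y # x # vs}" using 2 xs by (cases p) auto
    have p: "strands_after p n = n" "p \<noteq> Cup" "p \<noteq> Cap" for n using 2 by (cases p; simp)+
    show ?thesis unfolding th succ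
    proof
      assume r: "length ys = strands_after p (length xs) \<and>
        (\<forall>j j'. j < length xs \<longrightarrow> Some (if j = i then i + 1 else if j = i + 1 then i else j) = Some j' \<longrightarrow> xs ! j = ys ! j') \<and>
        (p = Cup \<longrightarrow> ys ! i \<noteq> ys ! Suc i) \<and> (p = Cap \<longrightarrow> xs ! i \<noteq> xs ! Suc i)"
      then have *: "j < length xs \<Longrightarrow> xs ! j = ys ! (if j = i then i + 1 else if j = i + 1 then i else j)" for j
        by simp
      have "ys = us @ y # x # vs"
      proof (rule nth_equalityI)
        fix j assume "j < length ys"
        then have "j < length us + length vs + 2" using r p xs by simp
        then show "ys ! j = (us @ y # x # vs) ! j"
          using *[of "if j = i then i + 1 else if j = i + 1 then i else j"] xs
          by (auto simp: nth_append3 split: if_splits)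
      qed (use r p xs in simp)
      then show "ys \<in> {us @ y # x # vs}" by simp
    qed (use xs p in \<open>auto simp: nth_append3\<close>)
  qed
qed

lemma width_0 [simp]: "width D 0 = 0"
  by (simp add: width_def)

lemma width_Suc: "l < length D \<Longrightarrow> width D (Suc l) = strands_after (snd (D ! l)) (width D l)"
  by (simp add: width_def take_Suc_conv_app_nth)

lemma wfs_width:
  "wfs n D m \<Longrightarrow> wfs (fold (\<lambda>e. strands_after (snd e)) (take l D) n) (drop l D) m"
  by (induction n D m arbitrary: l rule: wfs.induct) (auto simp: take_Cons drop_Cons split: nat.splits)

lemma wf_nth:
  assumes "link_diagram D" "l < length D" "D ! l = (i, p)"
  shows "if p = Cup then i \<le> width D l else i + 2 \<le> width D l"
proof -
  have "wfs (width D l) (drop l D) 0"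
    using assms(1) wfs_width[of 0 D 0 l] by (simp add: link_diagram_def wf_from_wfs width_def)
  also have "drop l D = (i, p) # drop (Suc l) D" using assms by (simp add: Cons_nth_drop_Suc[symmetric])
  finally show ?thesis by (cases "p = Cup") auto
qed

definition level :: "diagram \<Rightarrow> (point \<Rightarrow> bool) \<Rightarrow> nat \<Rightarrow> bool list" where
  "level D up l = map (\<lambda>j. up (l, j)) [0..<width D l]"

lemma length_level [simp]: "length (level D up l) = width D l"
  by (simp add: level_def)

lemma nth_level [simp]: "j < width D l \<Longrightarrow> level D up l ! j = up (l, j)"
  by (simp add: level_def)

lemma through_less:
  assumes "if p = Cup then i \<le> n else i + 2 \<le> n" "j < n" "through (i, p) j = Some j'"
  shows "j' < strands_after p n"
  using assms by (cases p) (auto split: if_splits)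

text \<open>The conditions in \<open>orientation\<close> each concern a single event, where
  \<open>succs_iff\<close> applies to the levels just below and just above it.\<close>

lemma orientation_iff:
  assumes "link_diagram D"
  shows "orientation D up \<longleftrightarrow> (\<forall>l<length D. level D up (Suc l) \<in> succs (D ! l) (level D up l))"
proof -
  have loc: "level D up (Suc l) \<in> succs (i, p) (level D up l) \<longleftrightarrow>
      (\<forall>j j'. j < width D l \<longrightarrow> through (i, p) j = Some j' \<longrightarrow> up (l, j) = up (Suc l, j')) \<and>
      (p = Cup \<longrightarrow> up (Suc l, i) \<noteq> up (Suc l, Suc i)) \<and> (p = Cap \<longrightarrow> up (l, i) \<noteq> up (l, Suc i))"
    if l: "l < length D" "D ! l = (i, p)" for l i p
  proof -
    note wf = wf_nth[OF assms l]
    have w: "width D (Suc l) = strands_after p (width D l)" using l by (simp add: width_Suc)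
    have "level D up (Suc l) ! j' = up (Suc l, j')" if "j < width D l" "through (i, p) j = Some j'" for j j'
      using through_less[OF wf that] w by simp
    then have "(\<forall>j j'. j < width D l \<longrightarrow> through (i, p) j = Some j' \<longrightarrow> level D up l ! j = level D up (Suc l) ! j') \<longleftrightarrow>
        (\<forall>j j'. j < width D l \<longrightarrow> through (i, p) j = Some j' \<longrightarrow> up (l, j) = up (Suc l, j'))"
      by (metis nth_level)
    moreover have "(p = Cup \<longrightarrow> level D up (Suc l) ! i \<noteq> level D up (Suc l) ! Suc i) \<longleftrightarrow>
        (p = Cup \<longrightarrow> up (Suc l, i) \<noteq> up (Suc l, Suc i))"
      using wf w by auto
    moreover have "(p = Cap \<longrightarrow> level D up l ! i \<noteq> level D up l ! Suc i) \<longleftrightarrow>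
        (p = Cap \<longrightarrow> up (l, i) \<noteq> up (l, Suc i))"
      using wf by auto
    moreover have "if p = Cup then i \<le> length (level D up l) else i + 2 \<le> length (level D up l)"
      using wf by (cases "p = Cup") auto
    ultimately show ?thesis using w by (simp only: succs_iff length_level simp_thms)
  qed
  show ?thesis
  proof
    assume o: "orientation D up"
    show "\<forall>l<length D. level D up (Suc l) \<in> succs (D ! l) (level D up l)"
    proof (intro allI impI)
      fix l assume l: "l < length D"
      obtain i p where ip: "D ! l = (i, p)" by (cases "D ! l")
      have "((l, j), (Suc l, j')) \<in> rising D" if "j < width D l" "through (i, p) j = Some j'" for j j'
        using that l ip by (auto simp: rising_def)
      moreover have "((Suc l, i), (Suc l, Suc i)) \<in> turning D" if "p = Cup"
        using that l ip by (auto simp: turning_def)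
      moreover have "((l, i), (l, Suc i)) \<in> turning D" if "p = Cap"
        using that l ip by (auto simp: turning_def)
      ultimately show "level D up (Suc l) \<in> succs (D ! l) (level D up l)"
        unfolding ip loc[OF l ip] using o unfolding orientation_def by fast
    qed
  next
    assume r: "\<forall>l<length D. level D up (Suc l) \<in> succs (D ! l) (level D up l)"
    show "orientation D up"
      unfolding orientation_def
    proof (intro conjI ballI)
      fix e assume "e \<in> rising D"
      then obtain l j j' where e: "e = ((l, j), (Suc l, j'))" "l < length D" "j < width D l"
        "through (D ! l) j = Some j'" by (auto simp: rising_def)
      moreover obtain i p where "D ! l = (i, p)" by (cases "D ! l")
      ultimately show "case e of (x, y) \<Rightarrow> up x = up y" using r loc[of l i p] by auto
    next
      fix e assume "e \<in> turning D"
      then obtain l i where "e = ((Suc l, i), (Suc l, Suc i)) \<and> l < length D \<and> D ! l = (i, Cup) \<or>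
          e = ((l, i), (l, Suc i)) \<and> l < length D \<and> D ! l = (i, Cap)"
        by (auto simp: turning_def)
      then show "case e of (x, y) \<Rightarrow> up x \<noteq> up y"
        using r[rule_format, of l] loc[of l i Cup] loc[of l i Cap] by auto
    qed
  qed
qed

definition oriented_by :: "diagram \<Rightarrow> bool list list \<Rightarrow> point \<Rightarrow> bool" where
  "oriented_by D r = (\<lambda>(l, j). ([] # r) ! l ! j)"

definition run_of :: "diagram \<Rightarrow> (point \<Rightarrow> bool) \<Rightarrow> bool list list" where
  "run_of D up = map (level D up) [1..<Suc (length D)]"

lemma nth_run_of: "l \<le> length D \<Longrightarrow> ([] # run_of D up) ! l = level D up l"
  by (cases l) (auto simp: run_of_def level_def nth_Cons simp del: upt_Suc)

lemma run_of_in_runs: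
  assumes "link_diagram D" "orientation D up" shows "run_of D up \<in> runs D []"
proof -
  have "run_of D up ! l \<in> succs (D ! l) (([] # run_of D up) ! l)" if "l < length D" for l
    using assms that nth_run_of[of "Suc l" D up] nth_run_of[of l D up] by (simp add: orientation_iff)
  then show ?thesis unfolding runs_def paths_iff by (simp add: run_of_def del: upt_Suc)
qed

lemma run_level_length:
  assumes "link_diagram D" "r \<in> runs D []" "l \<le> length D"
  shows "length (([] # r) ! l) = width D l"
  using assms(3)
proof (induction l)
  case (Suc l)
  obtain i p where ip: "D ! l = (i, p)" by (cases "D ! l")
  have "r ! l \<in> succs (D ! l) (([] # r) ! l)"
    using assms(2) Suc.prems unfolding runs_def paths_iff by simp
  then have "r ! l \<in> succs (i, p) (([] # r) ! l)" by (simp only: ip)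
  moreover have "if p = Cup then i \<le> length (([] # r) ! l) else i + 2 \<le> length (([] # r) ! l)"
    using Suc wf_nth[OF assms(1) _ ip] by (cases "p = Cup") auto
  ultimately have "length (r ! l) = strands_after p (length (([] # r) ! l))"
    by (rule succs_length[rotated])
  then show ?case using Suc ip by (simp add: width_Suc)
qed simp

lemma oriented_by_level:
  assumes "link_diagram D" "r \<in> runs D []" "l \<le> length D"
  shows "level D (oriented_by D r) l = ([] # r) ! l"
  using run_level_length[OF assms] by (intro nth_equalityI) (auto simp: oriented_by_def)

lemma oriented_by_orientation:
  assumes "link_diagram D" "r \<in> runs D []" shows "orientation D (oriented_by D r)"
  unfolding orientation_iff[OF assms(1)]
proof (intro allI impI)
  fix l assume "l < length D"
  then show "level D (oriented_by D r) (Suc l) \<in> succs (D ! l) (level D (oriented_by D r) l)"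
    using oriented_by_level[OF assms, of l] oriented_by_level[OF assms, of "Suc l"] assms(2)
    by (auto simp: runs_def paths_iff)
qed

lemma run_of_oriented_by:
  assumes "link_diagram D" "r \<in> runs D []" shows "run_of D (oriented_by D r) = r"
proof (rule nth_equalityI)
  show len: "length (run_of D (oriented_by D r)) = length r"
    using assms(2) by (simp add: run_of_def runs_def paths_iff del: upt_Suc)
  fix l assume "l < length (run_of D (oriented_by D r))"
  then have "Suc l \<le> length D" by (simp add: run_of_def del: upt_Suc)
  then show "run_of D (oriented_by D r) ! l = r ! l"
    using oriented_by_level[OF assms, of "Suc l"] nth_run_of[of "Suc l" D "oriented_by D r"] by simp
qed

text \<open>Orientations in a form that can be counted: as functions they would be arbitrary outside
  \<open>points D\<close>.\<close>

definition up_sets :: "diagram \<Rightarrow> point set set" where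
  "up_sets D = {U. U \<subseteq> points D \<and> orientation D (\<lambda>x. x \<in> U)}"

lemma level_cong:
  "(\<And>j. j < width D l \<Longrightarrow> up (l, j) = up' (l, j)) \<Longrightarrow> level D up l = level D up' l"
  by (auto simp: level_def)

lemma orientation_cong:
  assumes "link_diagram D" "\<And>x. x \<in> points D \<Longrightarrow> up x = up' x"
  shows "orientation D up = orientation D up'"
proof -
  have "level D up l = level D up' l" if "l \<le> length D" for l
    using that assms(2) by (intro level_cong) (auto simp: points_def)
  then show ?thesis unfolding orientation_iff[OF assms(1)] by auto
qed

lemma card_runs_up_sets:
  assumes "link_diagram D" shows "card (runs D []) = card (up_sets D)"
proof (rule bij_betw_same_card)
  let ?f = "\<lambda>r. {x \<in> points D. oriented_by D r x}" and ?g = "\<lambda>U. run_of D (\<lambda>x. x \<in> U)"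
  show "bij_betw ?f (runs D []) (up_sets D)"
  proof (rule bij_betw_byWitness[where f' = ?g])
    show "\<forall>r\<in>runs D []. ?g (?f r) = r"
    proof
      fix r assume r: "r \<in> runs D []"
      have "run_of D (\<lambda>x. x \<in> ?f r) = run_of D (oriented_by D r)"
        unfolding run_of_def by (auto intro!: level_cong simp: points_def simp del: upt_Suc)
      then show "?g (?f r) = r" using run_of_oriented_by[OF assms r] by simp
    qed
    show "\<forall>U\<in>up_sets D. ?f (?g U) = U"
    proof
      fix U assume U: "U \<in> up_sets D"
      then have "oriented_by D (run_of D (\<lambda>x. x \<in> U)) x = (x \<in> U)" if "x \<in> points D" for x
        using that by (auto simp: oriented_by_def points_def nth_run_of)
      then show "?f (?g U) = U" using U by (auto simp: up_sets_def)
    qed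
    show "?f ` runs D [] \<subseteq> up_sets D"
    proof
      fix U assume "U \<in> ?f ` runs D []"
      then obtain r where r: "r \<in> runs D []" "U = ?f r" by blast
      have "orientation D (\<lambda>x. x \<in> U) = orientation D (oriented_by D r)"
        using r(2) by (intro orientation_cong[OF assms]) auto
      then show "U \<in> up_sets D" using r oriented_by_orientation[OF assms r(1)] by (auto simp: up_sets_def)
    qed
    show "?g ` up_sets D \<subseteq> runs D []"
      using run_of_in_runs[OF assms] by (auto simp: up_sets_def)
  qed
qed

subsection \<open>Components\<close>

definition edges :: "diagram \<Rightarrow> (point \<times> point) set" where
  "edges D = rising D \<union> turning D"

lemma connected_points_edges: "connected_points D = (edges D \<union> (edges D)\<inverse>)\<^sup>*"
  by (simp add: connected_points_def edges_def Let_def)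

lemma equiv_connected: "equiv UNIV (connected_points D)"
proof -
  have "sym (edges D \<union> (edges D)\<inverse>)" by (auto simp: sym_def)
  then show ?thesis unfolding connected_points_edges
    by (intro equivI) (auto simp: refl_rtrancl trans_rtrancl sym_rtrancl)
qed

lemma edges_points:
  assumes "link_diagram D" "(x, y) \<in> edges D" shows "x \<in> points D \<and> y \<in> points D"
proof -
  consider (r) l j j' where "x = (l, j)" "y = (Suc l, j')" "l < length D" "j < width D l"
      "through (D ! l) j = Some j'"
    | (u) l i where "x = (Suc l, i)" "y = (Suc l, Suc i)" "l < length D" "D ! l = (i, Cup)"
    | (a) l i where "x = (l, i)" "y = (l, Suc i)" "l < length D" "D ! l = (i, Cap)"
    using assms(2) unfolding edges_def rising_def turning_def by blast
  then show ?thesis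
  proof cases
    case r
    moreover obtain i p where ip: "D ! l = (i, p)" by (cases "D ! l")
    ultimately show ?thesis
      using through_less[OF wf_nth[OF assms(1) r(3) ip]] by (auto simp: points_def width_Suc)
  next
    case u
    then show ?thesis using wf_nth[OF assms(1) u(3,4)] by (auto simp: points_def width_Suc)
  next
    case a
    then show ?thesis using wf_nth[OF assms(1) a(3,4)] by (auto simp: points_def)
  qed
qed

lemma connected_closed:
  assumes "(x, y) \<in> connected_points D" "\<And>x y. (x, y) \<in> edges D \<Longrightarrow> x \<in> G \<longleftrightarrow> y \<in> G"
  shows "x \<in> G \<longleftrightarrow> y \<in> G"
  using assms(1) unfolding connected_points_edges
  by (induction rule: rtrancl_induct) (use assms(2) in auto)

lemma component_subset:
  assumes "link_diagram D" "C \<in> components D" shows "C \<subseteq> points D"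
proof -
  obtain x where x: "x \<in> points D" "C = connected_points D `` {x}"
    using assms(2) by (auto simp: components_def quotient_def)
  have "y \<in> points D" if "(x, y) \<in> connected_points D" for y
    using connected_closed[OF that, of "points D"] edges_points[OF assms(1)] x by blast
  then show ?thesis using x by auto
qed

lemma finite_points: "finite (points D)"
proof -
  have "points D = (SIGMA l:{..length D}. {..<width D l})" by (auto simp: points_def)
  then show ?thesis by simp
qed

lemma finite_components: "finite (components D)"
  unfolding components_def quotient_def using finite_points by simp

lemma components_disjoint:
  assumes "C \<in> components D" "C' \<in> components D" "x \<in> C" "x \<in> C'" shows "C = C'"
proof -
  have "C \<in> UNIV // connected_points D" "C' \<in> UNIV // connected_points D"
    using assms by (auto simp: components_def quotient_def)
  from quotient_disj[OF equiv_connected this] show ?thesis using assms by blast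
qed

lemma component_of: "x \<in> points D \<Longrightarrow> connected_points D `` {x} \<in> components D"
  and in_component: "x \<in> connected_points D `` {x}"
  by (auto simp: components_def quotient_def connected_points_edges)

lemma orientation_differ:
  assumes "link_diagram D" "orientation D up" "orientation D up'" "(x, y) \<in> edges D"
  shows "(up x \<noteq> up' x) = (up y \<noteq> up' y)"
  using assms(2-4) unfolding orientation_def edges_def by fastforce

text \<open>The set where two orientations differ is closed under edges, hence a union of
  components; conversely any set of components can be reversed. So symmetric difference with
  \<open>U0\<close> is a bijection to sets of components.\<close>

lemma card_up_sets:
  assumes D: "link_diagram D" and U0: "U0 \<in> up_sets D"
  shows "card (up_sets D) = 2 ^ card (components D)"
proof -
  let ?d = "\<lambda>U V. (U - V) \<union> (V - U)"
  let ?f = "\<lambda>U. {C \<in> components D. C \<subseteq> ?d U U0}" and ?g = "\<lambda>CC. ?d (\<Union>CC) U0"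
  have closed: "x \<in> \<Union>CC \<longleftrightarrow> y \<in> \<Union>CC" if "CC \<subseteq> components D" "(x, y) \<in> edges D" for CC x y
  proof -
    have c: "(x, y) \<in> connected_points D" "(y, x) \<in> connected_points D"
      using that(2) unfolding connected_points_edges by auto
    have "y \<in> C" if "C \<in> components D" "x \<in> C" "(x, y) \<in> connected_points D" for C x y
    proof -
      have "C \<in> UNIV // connected_points D" using that by (auto simp: components_def quotient_def)
      then show ?thesis using in_quotient_imp_closed[OF equiv_connected _ that(2,3)] by blast
    qed
    then show ?thesis using c that(1) by blast
  qed
  have "bij_betw ?f (up_sets D) (Pow (components D))"
  proof (rule bij_betw_byWitness[where f' = ?g])
    have union: "\<Union>(?f U) = ?d U U0" if U: "U \<in> up_sets D" for U
    proof
      show "?d U U0 \<subseteq> \<Union>(?f U)"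
      proof
        fix x assume x: "x \<in> ?d U U0"
        then have "x \<in> points D" using U U0 by (auto simp: up_sets_def)
        moreover have "connected_points D `` {x} \<subseteq> ?d U U0"
        proof
          fix y assume "y \<in> connected_points D `` {x}"
          then have "(x, y) \<in> connected_points D" by simp
          moreover have "a \<in> ?d U U0 \<longleftrightarrow> b \<in> ?d U U0" if "(a, b) \<in> edges D" for a b
            using orientation_differ[OF D _ _ that, of "\<lambda>x. x \<in> U" "\<lambda>x. x \<in> U0"] U U0
            unfolding up_sets_def by blast
          ultimately show "y \<in> ?d U U0" using connected_closed[of x y D "?d U U0"] x by blast
        qed
        ultimately show "x \<in> \<Union>(?f U)" using component_of in_component by blast
      qed
    qed auto
    show "\<forall>U\<in>up_sets D. ?g (?f U) = U"
    proof
      fix U assume "U \<in> up_sets D"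
      then have "?g (?f U) = ?d (?d U U0) U0" by (simp only: union)
      then show "?g (?f U) = U" by blast
    qed
    show "\<forall>CC\<in>Pow (components D). ?f (?g CC) = CC"
    proof
      fix CC assume CC: "CC \<in> Pow (components D)"
      have "?d (?g CC) U0 = \<Union>CC" by blast
      then have "?f (?g CC) = {C \<in> components D. C \<subseteq> \<Union>CC}" by simp
      also have "\<dots> = CC"
      proof
        show "{C \<in> components D. C \<subseteq> \<Union>CC} \<subseteq> CC"
        proof
          fix C assume C: "C \<in> {C \<in> components D. C \<subseteq> \<Union>CC}"
          then obtain x where "C = connected_points D `` {x}" unfolding components_def quotient_def by blast
          then have "x \<in> C" using in_component by simp
          then obtain C' where "C' \<in> CC" "x \<in> C'" using C by blast
          then have "C = C'" using components_disjoint[of C D C' x] C CC \<open>x \<in> C\<close> by blast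
          then show "C \<in> CC" using \<open>C' \<in> CC\<close> by simp
        qed
      qed (use CC in auto)
      finally show "?f (?g CC) = CC" .
    qed
    show "?f ` up_sets D \<subseteq> Pow (components D)" by auto
    show "?g ` Pow (components D) \<subseteq> up_sets D"
    proof
      fix U assume "U \<in> ?g ` Pow (components D)"
      then obtain CC where CC: "CC \<subseteq> components D" "U = ?g CC" by auto
      have o: "orientation D (\<lambda>x. x \<in> U0)" and "U0 \<subseteq> points D" using U0 by (auto simp: up_sets_def)
      have "orientation D (\<lambda>x. x \<in> U)"
        unfolding orientation_def
      proof (intro conjI ballI; clarify)
        fix x y :: point assume e: "(x, y) \<in> rising D"
        then have "x \<in> U0 \<longleftrightarrow> y \<in> U0" using o unfolding orientation_def by blast
        moreover have "x \<in> \<Union>CC \<longleftrightarrow> y \<in> \<Union>CC" using e by (intro closed[OF CC(1)]) (simp add: edges_def)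
        ultimately show "x \<in> U \<longleftrightarrow> y \<in> U" unfolding CC(2) by blast
      next
        fix x y :: point assume e: "(x, y) \<in> turning D" "x \<in> U \<longleftrightarrow> y \<in> U"
        then have "x \<in> U0 \<longleftrightarrow> y \<notin> U0" using o unfolding orientation_def by blast
        moreover have "x \<in> \<Union>CC \<longleftrightarrow> y \<in> \<Union>CC" using e by (intro closed[OF CC(1)]) (simp add: edges_def)
        ultimately show False using e(2) unfolding CC(2) by blast
      qed
      moreover have "\<Union>CC \<subseteq> points D" using component_subset[OF D] CC(1) by blast
      then have "U \<subseteq> points D" using \<open>U0 \<subseteq> points D\<close> unfolding CC(2) by blast
      ultimately show "U \<in> up_sets D" unfolding up_sets_def by blast
    qed
  qed
  from bij_betw_same_card[OF this] show ?thesis by (simp add: card_Pow finite_components)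
qed

section \<open>Skein induction and the existence of orientations\<close>

definition ncr :: "diagram \<Rightarrow> nat" where
  "ncr D = length (filter (\<lambda>e. is_crossing (snd e)) D)"

lemma wfs_smoothings:
  assumes "wfs n (u @ (i, p) # v) m" "is_crossing p"
  shows "wfs n (u @ [(i, Cap), (i, Cup)] @ v) m" "wfs n (u @ v) m"
proof -
  obtain k where k: "wfs n u k" "i + 2 \<le> k" "wfs k v m"
    using assms by (cases p) (auto simp: wfs_append)
  then have "Suc (Suc (k - 2)) = k" by simp
  with k show "wfs n (u @ [(i, Cap), (i, Cup)] @ v) m" "wfs n (u @ v) m"
    by (auto simp: wfs_append intro!: exI[of _ k])
qed

lemma not_crossingless:
  assumes "\<not> crossingless D" obtains u i p v where "D = u @ (i, p) # v" "is_crossing p"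
  using assms unfolding crossingless_def by (auto dest!: split_list)

text \<open>Skein induction: both smoothings are well formed and have one crossing fewer.\<close>

lemma crossing_induct [consumes 1, case_names crossingless smoothing]:
  assumes "wfs n D m"
    and "\<And>D. wfs n D m \<Longrightarrow> crossingless D \<Longrightarrow> P D"
    and "\<And>u i p v. wfs n (u @ (i, p) # v) m \<Longrightarrow> is_crossing p \<Longrightarrow>
      P (u @ [(i, Cap), (i, Cup)] @ v) \<Longrightarrow> P (u @ v) \<Longrightarrow> P (u @ (i, p) # v)"
  shows "P D"
  using assms(1)
proof (induction "ncr D" arbitrary: D rule: less_induct)
  case less
  show ?case
  proof (cases "crossingless D")
    case False
    then obtain u i p v where D: "D = u @ (i, p) # v" "is_crossing p" by (rule not_crossingless)
    show ?thesis unfolding D(1)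
      using less.prems D(2) unfolding D(1)
    proof (rule assms(3))
      show "P (u @ [(i, Cap), (i, Cup)] @ v)" "P (u @ v)"
        using wfs_smoothings[of n u i p v m] less.prems D
        by (auto intro!: less.hyps simp: ncr_def)
    qed
  qed (use assms(2) less in blast)
qed

lemma act_hv:
  assumes "is_crossing p" "i + 2 \<le> length xs" "w = hv a b h v"
  shows "act (i, p, w) \<phi> xs = h * evf (tag (bw a b) [(i, Cap), (i, Cup)]) \<phi> xs + v * \<phi> xs"
proof -
  obtain us x y vs where xs: "xs = us @ x # y # vs" "length us = i"
    using split_at2 assms(2) by metis
  show ?thesis using assms xs
    by (cases p; cases x; cases y) (auto simp: sum_bool hv_def algebra_simps)
qed

fun hcoeff :: "'r \<Rightarrow> 'r \<Rightarrow> piece \<Rightarrow> 'r" where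
  "hcoeff a b Xo = a" | "hcoeff a b _ = b"

lemma bw_hv: "is_crossing p \<Longrightarrow> bw a b p = hv a b (hcoeff a b p) (hcoeff b a p)"
  by (cases p) (auto intro!: ext)

lemma evf_smoothing:
  assumes "wfs n (u @ (i, p) # v) m" "is_crossing p" "length xs = n"
  shows "evf (tag (bw a b) (u @ (i, p) # v)) \<phi> xs =
    hcoeff a b p * evf (tag (bw a b) (u @ [(i, Cap), (i, Cup)] @ v)) \<phi> xs +
    hcoeff b a p * evf (tag (bw a b) (u @ v)) \<phi> xs"
proof -
  obtain k where k: "wfs n u k" "i + 2 \<le> k"
    using assms by (cases p) (auto simp: wfs_append)
  have "evf (tag (bw a b) (u @ (i, p) # v)) \<phi> xs =
    evf (tag (bw a b) u) (\<lambda>xs. hcoeff a b p * evf (tag (bw a b) [(i, Cap), (i, Cup)]) (evf (tag (bw a b) v) \<phi>) xs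
      + hcoeff b a p * evf (tag (bw a b) v) \<phi> xs) xs"
    unfolding tag_simps evf_append evf.simps(2)
    by (rule evf_cong[where n = n and m = k])
       (use k assms in \<open>auto simp: act_hv[OF assms(2) _ bw_hv[OF assms(2)]]\<close>)
  then show ?thesis by (simp add: evf_linear del: act.simps)
qed

lemma ev_smoothing:
  assumes "wfs 0 (u @ (i, p) # v) 0" "is_crossing p"
  shows "ev (bw a b) (u @ (i, p) # v) =
    hcoeff a b p * ev (bw a b) (u @ [(i, Cap), (i, Cup)] @ v) + hcoeff b a p * ev (bw a b) (u @ v)"
  unfolding ev_def by (rule evf_smoothing[OF assms]) simp

lemma circ_ev:
  assumes "circ S k" "zigzag w d" "wfs 0 S 0" shows "ev w S = d ^ k"
  using circ_evf[OF assms, of "[]" eps] by (simp add: ev_def eps_def)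

text \<open>
  At \<open>A = 1\<close> the bracket is a signed sum over orientations, and the circle value \<open>-2\<close> is \<open>1\<close> modulo 3.  So the
  bracket does not vanish there, which shows that orientations exist.
\<close>

lemma bracket_mod3:
  assumes "wfs 0 D 0"
  shows "\<exists>X::int. ev (bw (1::'r::comm_ring_1) 1) D = of_int X \<and> X mod 3 = (- 1) ^ ncr D mod 3"
  using assms
proof (induction rule: crossing_induct)
  case (crossingless D)
  then obtain k where "circ D k" using circ_exists[of 0 D] by auto
  then have "ev (bw (1::'r) 1) D = of_int ((- 2) ^ k)"
    using circ_ev[OF _ zigzag_bw(1)[of 1 1] crossingless(1)] by simp
  moreover have "(- 2 :: int) ^ k mod 3 = 1 ^ k mod 3" by (rule power_mod[of "-2" 3 k, simplified, symmetric, THEN trans]) simp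
  moreover have "ncr D = 0" using crossingless(2) by (auto simp: ncr_def crossingless_def filter_empty_conv)
  ultimately show ?case by (intro exI[of _ "(- 2) ^ k"]) simp
next
  case (smoothing u i p v)
  then obtain X Y :: int where XY: "ev (bw (1::'r) 1) (u @ [(i, Cap), (i, Cup)] @ v) = of_int X"
    "X mod 3 = (- 1) ^ ncr (u @ v) mod 3" "ev (bw (1::'r) 1) (u @ v) = of_int Y"
    "Y mod 3 = (- 1) ^ ncr (u @ v) mod 3" by (auto simp: ncr_def)
  have one: "hcoeff (1::'r) 1 p = 1" by (cases p) auto
  have "ncr (u @ (i, p) # v) = Suc (ncr (u @ v))" using smoothing(2) by (simp add: ncr_def)
  \<comment> \<open>Doubling is negation modulo 3, so adding the equal residues of the two
    smoothings flips the sign once, as the additional crossing requires.\<close>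
  moreover have "(X + Y) mod 3 = (- 1) ^ Suc (ncr (u @ v)) mod 3"
    using XY(2,4) by (cases "even (ncr (u @ v))") (simp_all, presburger+)
  moreover have "ev (bw (1::'r) 1) (u @ (i, p) # v) = of_int (X + Y)"
    using ev_smoothing[OF smoothing(1,2), of "1::'r" 1] XY(1,3) one by simp
  ultimately show ?case by metis
qed

text \<open>At A = 1 the cup-cap term cancels the identity term on opposite labels and leaves their
  exchange, so a crossing merely swaps labels.\<close>

lemma perm_events_bw1: "perm_events (tag (bw 1 1) D)"
proof -
  have "permw p (bw 1 1 p)" for p
    by (cases p) (auto simp: cupw_def capw_def hv_def)
  then show ?thesis by (auto simp: perm_events_def tag_def)
qed

lemma perm_events_ow: "perm_events (tag (ow q r) D)"
proof -
  have "permw p (ow q r p)" for p by (cases p) auto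
  then show ?thesis by (auto simp: perm_events_def tag_def)
qed

lemma mod3_nonzero: "(0::int) mod 3 \<noteq> (- 1) ^ n mod 3"
  by (cases "even n") auto

lemma runs_nonempty: assumes "link_diagram D" shows "runs D [] \<noteq> {}"
proof
  assume e: "runs D [] = {}"
  have wf: "wfs 0 D 0" using assms by (simp add: link_diagram_def wf_from_wfs)
  obtain X :: int where X: "ev (bw (1::int) 1) D = of_int X" "X mod 3 = (- 1) ^ ncr D mod 3"
    using bracket_mod3[OF wf, where 'r = int] by blast
  have "ev (bw (1::int) 1) D = 0"
    using ev_runs[OF perm_events_bw1, of D] wf e by (simp add: ev_def)
  then show False using X mod3_nonzero[of "ncr D"] by simp
qed

lemma card_runs: assumes "link_diagram D" shows "card (runs D []) = 2 ^ card (components D)"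
proof -
  have "card (up_sets D) \<noteq> 0"
    using runs_nonempty[OF assms] card_runs_up_sets[OF assms] by (metis card_0_eq finite_runs)
  then obtain U where "U \<in> up_sets D" by (metis card.empty ex_in_conv)
  then show ?thesis using card_up_sets[OF assms] card_runs_up_sets[OF assms] by simp
qed

lemma weight_prod:
  "length r = length W \<Longrightarrow> weight W x r = (\<Prod>l<length W. (W ! l) ((x # r) ! l) (r ! l))"
proof (induction W arbitrary: x r)
  case (Cons w W)
  then obtain y ys where "r = y # ys" by (cases r) auto
  then show ?case using Cons by (simp add: prod.lessThan_Suc_shift del: prod.lessThan_Suc)
qed simp

lemma length_runs: "r \<in> runs D xs \<Longrightarrow> length r = length D"
  by (simp add: runs_def paths_iff)

lemma locw_ow1:
  assumes "ys \<in> succs (i, p) xs" "if p = Cup then i \<le> length xs else i + 2 \<le> length xs"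
  shows "locw (i, p, ow 1 1 p) xs ys = 1"
proof (cases "p = Cup")
  case True
  then obtain us vs where "xs = us @ vs" "length us = i" using split_at assms(2) by metis
  then show ?thesis using assms True by auto
next
  case False
  then show ?thesis using assms by (cases p) (auto split: if_splits)
qed

lemma runs_step:
  assumes "link_diagram D" "r \<in> runs D []" "l < length D" "D ! l = (i, p)"
  shows "r ! l \<in> succs (i, p) (([] # r) ! l)"
    and "if p = Cup then i \<le> length (([] # r) ! l) else i + 2 \<le> length (([] # r) ! l)"
proof -
  show "r ! l \<in> succs (i, p) (([] # r) ! l)"
    using assms(2-4) unfolding runs_def paths_iff by force
  show "if p = Cup then i \<le> length (([] # r) ! l) else i + 2 \<le> length (([] # r) ! l)"
    using run_level_length[OF assms(1,2), of l] wf_nth[OF assms(1,3,4)] assms(3)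
    by (cases "p = Cup") auto
qed

lemma ev_count:
  assumes "link_diagram D" shows "ev (ow (1::'r::comm_ring_1) 1) D = of_nat (card (runs D []))"
proof -
  have wf: "wfs 0 D 0" using assms by (simp add: link_diagram_def wf_from_wfs)
  have "weight (map locw (tag (ow (1::'r) 1) D)) [] r = 1" if r: "r \<in> runs D []" for r
  proof -
    have len: "length (tag (ow (1::'r) 1) D) = length D" by (simp add: tag_def)
    have "weight (map locw (tag (ow (1::'r) 1) D)) [] r =
      (\<Prod>l<length D. locw (tag (ow (1::'r) 1) D ! l) (([] # r) ! l) (r ! l))"
      using length_runs[OF r] by (simp add: weight_prod len)
    also have "\<dots> = 1"
    proof (intro prod.neutral ballI)
      fix l assume "l \<in> {..<length D}"
      moreover obtain i p where ip: "D ! l = (i, p)" by (cases "D ! l")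
      ultimately show "locw (tag (ow (1::'r) 1) D ! l) (([] # r) ! l) (r ! l) = 1"
        using locw_ow1[OF runs_step[OF assms r _ ip]] by (simp add: tag_def)
    qed
    finally show ?thesis .
  qed
  then show ?thesis using ev_runs[OF perm_events_ow[of "1::'r" 1 D]] wf by (simp add: ev_def)
qed

text \<open>Giving every orientation weight 1 is a vertex model with loop value 2. Its value is 2 ^
  k by isotopy, and it counts the orientations, of which there are two for each component.\<close>

lemma card_components:
  assumes "circ S k" "wfs 0 S 0" shows "card (components S) = k"
proof -
  have "link_diagram S" using assms(2) by (simp add: link_diagram_def wf_from_wfs)
  then have "(2::int) ^ k = 2 ^ card (components S)"
    using ev_count[of S, where 'r = int] circ_ev[OF assms(1) zigzag_ow[of "1::int" 1] assms(2)] card_runs[of S]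
    by simp
  then show ?thesis by simp
qed

lemma ev_crossingless:
  assumes "crossingless S" "wfs 0 S 0" "zigzag w d" shows "ev w S = d ^ card (components S)"
proof -
  obtain k where k: "circ S k" using circ_exists[of 0 S] assms by auto
  then show ?thesis using circ_ev[OF k assms(3,2)] card_components[OF k assms(2)] by simp
qed

subsection \<open>Knot diagrams\<close>

definition neg :: "bool list list \<Rightarrow> bool list list" where "neg = map (map Not)"

lemma knot_link: "knot_diagram D \<Longrightarrow> link_diagram D"
  by (simp add: knot_diagram_def)

lemma knot_nonempty: "knot_diagram D \<Longrightarrow> D \<noteq> []"
  by (auto simp: knot_diagram_def components_def points_def width_def)

lemma ex_orientation: assumes "link_diagram D" shows "\<exists>up. orientation D up"
proof -
  obtain r where "r \<in> runs D []" using runs_nonempty[OF assms] by blast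
  then show ?thesis using oriented_by_orientation[OF assms] by blast
qed

lemma chosen_orientation: "link_diagram D \<Longrightarrow> orientation D (chosen_orientation D)"
  unfolding chosen_orientation_def using someI_ex[OF ex_orientation] .

lemma orientation_Not: "orientation D up \<Longrightarrow> orientation D (\<lambda>x. \<not> up x)"
  unfolding orientation_def by auto

lemma run_of_Not: "run_of D (\<lambda>x. \<not> up x) = neg (run_of D up)"
  by (simp add: run_of_def neg_def level_def)

lemma link_Cons_Cup:
  assumes "link_diagram D" "D \<noteq> []" obtains D' where "D = (0, Cup) # D'"
  using assms by (cases D rule: list.exhaust) (auto simp: link_diagram_def split: if_splits)

text \<open>One component leaves two orientations. Reversal has no fixed one, as the label of the
  first strand above the initial cup shows.\<close>

lemma knot_runs:
  assumes D: "knot_diagram D"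
  defines "r \<equiv> run_of D (chosen_orientation D)"
  shows "runs D [] = {r, neg r}" "r \<noteq> neg r"
proof -
  note L = knot_link[OF D]
  have r: "r \<in> runs D []" "neg r \<in> runs D []"
    unfolding r_def run_of_Not[symmetric]
    using run_of_in_runs[OF L] orientation_Not chosen_orientation[OF L] by blast+
  obtain D' where D': "D = (0, Cup) # D'" using link_Cons_Cup[OF L knot_nonempty[OF D]] .
  have "width D 1 = 2" using width_Suc[of 0 D] by (simp add: D')
  moreover have "length (r ! 0) = width D 1"
    using run_level_length[OF L r(1), of 1] by (simp add: D')
  moreover have "0 < length r" using length_runs[OF r(1)] by (simp add: D')
  ultimately have "neg r ! 0 ! 0 = (\<not> r ! 0 ! 0)" by (simp add: neg_def)
  then show ne: "r \<noteq> neg r" by metis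
  have "card (runs D []) = 2" using card_runs[OF L] D by (simp add: knot_diagram_def)
  then have "runs D [] = {r, neg r}"
    using r ne by (intro card_seteq[symmetric]) auto
  then show "runs D [] = {r, neg r}" .
qed

definition symw :: "'r weight \<Rightarrow> bool" where
  "symw w \<longleftrightarrow> (\<forall>x y c d. w (\<not> x) (\<not> y) (\<not> c) (\<not> d) = w x y c d)"

lemma locw_Not:
  assumes "symw w" "if p = Cup then Suc i < length ys else Suc i < length xs"
  shows "locw (i, p, w) (map Not xs) (map Not ys) = locw (i, p, w) xs ys"
proof -
  have *: "w (\<not> x) (\<not> y) (\<not> c) (\<not> d) = w x y c d" for x y c d
    using assms(1) by (simp only: symw_def)
  have "i < length ys" "Suc i < length ys" if "p = Cup" using assms(2) that by auto
  moreover have "i < length xs" "Suc i < length xs" if "p \<noteq> Cup" using assms(2) that by auto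
  ultimately show ?thesis by (cases p) (auto simp: *)
qed

text \<open>Both orientations of a knot contribute the same product, since they are opposite and the
  weights do not change under reversal. The weights may vary from event to event, so that crossings
  on and off the axis can carry different variables.\<close>

lemma knot_evf:
  assumes D: "knot_diagram D" and E: "untag E = D" "perm_events E" "\<forall>(i, p, w)\<in>set E. symw w"
  defines "up \<equiv> chosen_orientation D"
  shows "evf E eps [] = 2 * (\<Prod>l<length D. locw (E ! l) (level D up l) (level D up (Suc l)))"
proof -
  note L = knot_link[OF D]
  have wf: "wfs 0 D 0" using L by (simp add: link_diagram_def wf_from_wfs)
  define r where "r = run_of D up"
  note runs = knot_runs[OF D, folded up_def, folded r_def]
  have len: "length E = length D" using E(1) by (metis length_map)
  have r: "r \<in> runs D []" "neg r \<in> runs D []" unfolding runs(1) by simp_all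
  have lev: "level D up l = ([] # r) ! l" if "l \<le> length D" for l
    using nth_run_of[OF that] by (simp add: r_def)
  have eq: "locw (E ! l) (([] # neg r) ! l) (neg r ! l) = locw (E ! l) (([] # r) ! l) (r ! l)"
    if l: "l < length D" for l
  proof -
    obtain i p w where e: "E ! l = (i, p, w)" by (cases "E ! l")
    then have ip: "D ! l = (i, p)" using E(1) l len by (metis (no_types, lifting) case_prod_conv nth_map)
    have "(i, p, w) \<in> set E" using e l len by (metis nth_mem)
    then have "symw w" using E(3) by auto
    moreover have "length (r ! l) = strands_after p (length (([] # r) ! l))"
      using succs_length[OF runs_step(2,1)[OF L r(1) l ip]] .
    then have "if p = Cup then Suc i < length (r ! l) else Suc i < length (([] # r) ! l)"
      using runs_step(2)[OF L r(1) l ip] by (cases "p = Cup") auto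
    ultimately have "locw (i, p, w) (map Not (([] # r) ! l)) (map Not (r ! l)) = locw (i, p, w) (([] # r) ! l) (r ! l)"
      by (rule locw_Not)
    moreover have "neg r ! l = map Not (r ! l)" "([] # neg r) ! l = map Not (([] # r) ! l)"
      using l length_runs[OF r(1)] by (auto simp: neg_def nth_Cons split: nat.splits)
    ultimately show ?thesis by (simp add: e)
  qed
  have w: "weight (map locw E) [] r' = (\<Prod>l<length D. locw (E ! l) (([] # r') ! l) (r' ! l))"
    if "r' \<in> runs D []" for r'
    using length_runs[OF that] by (simp add: weight_prod len)
  have "evf E eps [] = (\<Sum>r\<in>runs D []. weight (map locw E) [] r)"
    using ev_runs[OF E(2)] wf unfolding E(1) by simp
  also have "\<dots> = weight (map locw E) [] r + weight (map locw E) [] (neg r)"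
    using runs by simp
  also have "weight (map locw E) [] (neg r) = weight (map locw E) [] r"
    unfolding w[OF r(1)] w[OF r(2)] by (intro prod.cong refl) (auto simp: eq)
  also have "weight (map locw E) [] r = (\<Prod>l<length D. locw (E ! l) (level D up l) (level D up (Suc l)))"
    unfolding w[OF r(1)] by (intro prod.cong refl) (auto simp: lev)
  finally show ?thesis by simp
qed

lemma symw_ow: "symw (ow q r p)"
  by (cases p) (auto simp: symw_def)

lemma locw_ow:
  assumes D: "link_diagram D" "orientation D up" "l < length D" "D ! l = (i, p)" and "q \<noteq> (0::'r::field)"
  shows "locw (i, p, ow q (inverse q) p) (level D up l) (level D up (Suc l)) = q powi crossing_sign D up l"
proof -
  have s: "level D up (Suc l) \<in> succs (i, p) (level D up l)" using D by (metis orientation_iff)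
  have wf: "if p = Cup then i \<le> width D l else i + 2 \<le> width D l" using wf_nth[OF D(1,3,4)] .
  have w: "width D (Suc l) = strands_after p (width D l)" using D by (simp add: width_Suc)
  show ?thesis
  proof (cases "is_crossing p")
    case True
    then have lv: "level D up l ! i = up (l, i)" "level D up l ! Suc i = up (l, Suc i)"
      using wf by (cases p; auto)+
    have q: "q powi (- 1) = inverse q" by (simp add: power_int_def)
    have sign: "crossing_sign D up l = (if (p = Xu) = (up (l, i) = up (l, Suc i)) then 1 else - 1)"
      unfolding crossing_sign_def D(4) using True by simp
    show ?thesis
      using True by (cases p) (auto simp: sign lv q)
  next
    case False
    have ok: "if p = Cup then i \<le> length (level D up l) else i + 2 \<le> length (level D up l)"
      using wf by (cases "p = Cup") auto
    have "(p = Cup \<longrightarrow> level D up (Suc l) ! i \<noteq> level D up (Suc l) ! Suc i) \<and>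
        (p = Cap \<longrightarrow> level D up l ! i \<noteq> level D up l ! Suc i)"
      using iffD1[OF succs_iff[OF ok] s] by blast
    then have "locw (i, p, ow q (inverse q) p) (level D up l) (level D up (Suc l)) = 1"
      using False by (cases p) simp_all
    then show ?thesis using False D(4) by (simp add: crossing_sign_def)
  qed
qed

lemma power_int_sum: "q \<noteq> (0::'r::field) \<Longrightarrow> (\<Prod>l\<in>S. q powi f l) = q powi (\<Sum>l\<in>S. f l)"
  by (induction S rule: infinite_finite_induct) (auto simp: power_int_add)

text \<open>Makes the writhe accessible to local identities of state sums; the factor 2 stands for
  the two orientations.\<close>

lemma ev_writhe:
  assumes "knot_diagram D" "q \<noteq> (0::'r::field)"
  shows "ev (ow q (inverse q)) D = 2 * q powi writhe D"
proof -
  let ?up = "chosen_orientation D" and ?E = "tag (ow q (inverse q)) D"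
  note L = knot_link[OF assms(1)]
  have "ev (ow q (inverse q)) D = 2 * (\<Prod>l<length D. locw (?E ! l) (level D ?up l) (level D ?up (Suc l)))"
    unfolding ev_def by (rule knot_evf[OF assms(1) untag_tag perm_events_ow]) (auto simp: tag_def symw_ow)
  also have "(\<Prod>l<length D. locw (?E ! l) (level D ?up l) (level D ?up (Suc l))) =
      (\<Prod>l<length D. q powi crossing_sign D ?up l)"
  proof (intro prod.cong refl)
    fix l assume "l \<in> {..<length D}"
    moreover obtain i p where "D ! l = (i, p)" by (cases "D ! l")
    ultimately show "locw (?E ! l) (level D ?up l) (level D ?up (Suc l)) = q powi crossing_sign D ?up l"
      using locw_ow[OF L chosen_orientation[OF L] _ _ assms(2), of l] by (simp add: tag_def)
  qed
  also have "\<dots> = q powi writhe D"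
    unfolding writhe_def using assms(2) by (simp add: power_int_sum)
  finally show ?thesis .
qed

section \<open>The exponents of the bracket of a knot modulo 4\<close>

fun alt :: "complex \<Rightarrow> bool list \<Rightarrow> complex" where
  "alt s [] = 1"
| "alt s (x # xs) = (if x then s else 1) * alt (- s) xs"

lemma alt_append: "alt s (us @ vs) = alt s us * alt (s * (- 1) ^ length us) vs"
  by (induction us arbitrary: s) (auto simp: algebra_simps)

lemma i_power4: "\<i> powi (4 * k) = 1"
proof -
  have "\<i> powi (4 * k) = (\<i> powi 4) powi k" by (rule power_int_mult)
  also have "\<i> powi 4 = \<i> ^ 4" by (metis of_nat_numeral power_int_of_nat)
  also have "\<i> ^ 4 = (\<i> ^ 2) ^ 2" by (simp add: power_mult[symmetric])
  also have "\<dots> = 1" by simp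
  finally show ?thesis by simp
qed

lemma i_power2: "\<i> powi (2 * int k) = (- 1) ^ k"
proof -
  have "\<i> powi (2 * int k) = \<i> powi (int (2 * k))" by simp
  also have "\<dots> = (\<i> ^ 2) ^ k" by (simp only: power_int_of_nat power_mult)
  finally show ?thesis by simp
qed

text \<open>\<open>alt 1 xs\<close> is -1 to the number of labels \<open>True\<close> at odd
  positions. It acts as a gauge factor: after inserting it, the product of the two weights does not
  depend on the labels and is the power of \<i> given by \<open>shade\<close>.\<close>

lemma locw_alt:
  assumes ys: "ys \<in> succs (i, p) xs" and ok: "if p = Cup then i \<le> length xs else i + 2 \<le> length xs"
  shows "locw (i, p, bw 1 1 p) xs ys * locw (i, p, ow \<i> (- \<i>) p) xs ys * alt 1 ys =
    \<i> powi shade (i, p) * alt 1 xs"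
proof -
  define s where "s = (- 1 :: complex) ^ i"
  have s2: "s * s = 1" "s * (s * z) = z" for z
    by (simp_all add: s_def power_add[symmetric] mult.assoc[symmetric] flip: mult_2)
  have m1: "\<i> powi (- 1) = - \<i>" by (simp add: power_int_def)
  show ?thesis
  proof (cases p)
    case Cup
    then obtain us vs where xs: "xs = us @ vs" "length us = i" using split_at ok by metis
    have hs: "(- 1) ^ length us = s" by (simp add: s_def xs)
    have "\<i> powi shade (i, p) = - s"
      using i_power2[of "i + 1"] by (simp add: Cup s_def algebra_simps)
    moreover have "ys = us @ True # False # vs \<or> ys = us @ False # True # vs" using ys xs Cup by auto
    ultimately show ?thesis using xs Cup
      by (auto simp: alt_append cupw_def hs algebra_simps)
  next
    case Cap
    then obtain us x y vs where xs: "xs = us @ x # y # vs" "length us = i"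
      using split_at2 ok by (metis piece.distinct(1))
    have hs: "(- 1) ^ length us = s" by (simp add: s_def xs)
    have pw: "\<i> powi shade (i, p) = s"
      using i_power2[of i] by (simp add: Cap s_def algebra_simps)
    show ?thesis unfolding pw using xs Cap ys
      by (cases x; cases y) (auto simp: alt_append capw_def hs s2 algebra_simps)
  next
    case Xo
    then obtain us x y vs where xs: "xs = us @ x # y # vs" "length us = i"
      using split_at2 ok by (metis piece.distinct(3))
    have hs: "(- 1) ^ length us = s" by (simp add: s_def xs)
    show ?thesis using xs Xo ys m1
      by (cases x; cases y) (auto simp: alt_append hv_def capw_def cupw_def hs s2 algebra_simps)
  next
    case Xu
    then obtain us x y vs where xs: "xs = us @ x # y # vs" "length us = i"
      using split_at2 ok by (metis piece.distinct(5))
    have hs: "(- 1) ^ length us = s" by (simp add: s_def xs)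
    show ?thesis using xs Xu ys
      by (cases x; cases y) (auto simp: alt_append hv_def capw_def cupw_def hs s2 algebra_simps)
  qed
qed

text \<open>The gauge factors of consecutive levels telescope.\<close>

lemma weight_alt:
  assumes "r \<in> runs D xs" "wfs (length xs) D m"
  shows "weight (map locw (tag (bw 1 1) D)) xs r * weight (map locw (tag (ow \<i> (- \<i>)) D)) xs r * alt 1 (last (xs # r)) =
    \<i> powi shading D * alt 1 xs"
  using assms
proof (induction D arbitrary: xs r)
  case Nil
  then show ?case by (simp add: runs_def shading_def)
next
  case (Cons e D)
  obtain i p where e: "e = (i, p)" by (cases e)
  from Cons.prems(1) obtain ys r' where r: "r = ys # r'" "ys \<in> succs (i, p) xs" "r' \<in> runs D ys"
    by (auto simp: runs_def e)
  have ok: "if p = Cup then i \<le> length xs else i + 2 \<le> length xs"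
    using Cons.prems(2) by (cases "p = Cup") (auto simp: e)
  have "wfs (length ys) D m" using Cons.prems(2) succs_length[OF ok r(2)] by (simp add: e)
  note IH = Cons.IH[OF r(3) this]
  let ?a = "locw (i, p, bw 1 1 p) xs ys" and ?b = "locw (i, p, ow \<i> (- \<i>) p) xs ys"
  have "weight (map locw (tag (bw 1 1) (e # D))) xs r * weight (map locw (tag (ow \<i> (- \<i>)) (e # D))) xs r * alt 1 (last (xs # r))
    = ?a * ?b * (weight (map locw (tag (bw 1 1) D)) ys r' * weight (map locw (tag (ow \<i> (- \<i>)) D)) ys r' * alt 1 (last (ys # r')))"
    by (simp add: e r(1))
  also have "\<dots> = \<i> powi shading D * (?a * ?b * alt 1 ys)" unfolding IH by simp
  also have "\<dots> = \<i> powi shading (e # D) * alt 1 xs"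
    unfolding locw_alt[OF r(2) ok] by (simp add: e shading_def power_int_add)
  finally show ?case .
qed

lemma shading_even: "even (shading D) \<longleftrightarrow> even (ncr D)"
proof (induction D)
  case (Cons e D)
  then show ?case by (cases e rule: shade.cases) (auto simp: shading_def ncr_def)
qed (simp add: shading_def ncr_def)

text \<open>
  Along each orientation the bracket weights at \<open>A = 1\<close> and the orientation weights at \<open>q = \<i>\<close>
  multiply to the same power of \<open>\<i>\<close>.
\<close>

lemma knot_shading:
  assumes D: "knot_diagram D"
  shows "(shading D - 3 * writhe D - 2) mod 4 = 0"
proof -
  note L = knot_link[OF D]
  have wf: "wfs 0 D 0" using L by (simp add: link_diagram_def wf_from_wfs)
  define w where "w = writhe D"
  define W where "W r = weight (map locw (tag (ow \<i> (- \<i>)) D)) [] r" for r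
  define X :: "bool list list \<Rightarrow> complex" where "X r = weight (map locw (tag (bw 1 1) D)) [] r" for r
  let ?r = "run_of D (chosen_orientation D)"
  note runs = knot_runs[OF D]
  have inv: "inverse \<i> = - \<i>" by simp
  have prod: "X r * W r = \<i> powi shading D" if "r \<in> runs D []" for r
    using weight_alt[OF that, of 0] runs_length[OF _ that, of 0] wf
    by (simp add: X_def W_def)
  have Ww: "W r = \<i> powi w" if "r \<in> runs D []" for r
  proof -
    have "length r = length (tag (ow \<i> (- \<i>)) D)" using length_runs[OF that] by (simp add: tag_def)
    then have "W r = (\<Prod>l<length D. locw (tag (ow \<i> (- \<i>)) D ! l) (([] # r) ! l) (r ! l))"
      by (simp add: W_def weight_prod) (simp add: tag_def)
    also have "\<dots> = (\<Prod>l<length D. \<i> powi crossing_sign D (oriented_by D r) l)"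
    proof (intro prod.cong refl)
      fix l assume "l \<in> {..<length D}"
      moreover obtain i p where ip: "D ! l = (i, p)" by (cases "D ! l")
      ultimately show "locw (tag (ow \<i> (- \<i>)) D ! l) (([] # r) ! l) (r ! l) = \<i> powi crossing_sign D (oriented_by D r) l"
        using locw_ow[OF L oriented_by_orientation[OF L that] _ ip, of \<i>]
          oriented_by_level[OF L that, of l] oriented_by_level[OF L that, of "Suc l"] inv
        by (simp add: tag_def)
    qed
    \<comment> \<open>The run is the chosen orientation or its reversal, and a crossing sign depends
      only on whether two labels agree.\<close>
    also have "\<dots> = (\<Prod>l<length D. \<i> powi crossing_sign D (chosen_orientation D) l)"
    proof (intro prod.cong refl)
      fix l assume l: "l \<in> {..<length D}"
      obtain i p where ip: "D ! l = (i, p)" by (cases "D ! l")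
      have "level D (oriented_by D r) l = level D (chosen_orientation D) l \<or>
          level D (oriented_by D r) l = map Not (level D (chosen_orientation D) l)"
      proof -
        have "([] # ?r) ! l = level D (chosen_orientation D) l"
          using nth_run_of l by simp
        moreover have "([] # neg ?r) ! l = map Not (([] # ?r) ! l)"
          using l by (cases l) (auto simp: neg_def run_of_def simp del: upt_Suc)
        moreover have "r = ?r \<or> r = neg ?r" using that runs by blast
        ultimately show ?thesis using oriented_by_level[OF L that, of l] l by auto
      qed
      then have "(oriented_by D r (l, i) = oriented_by D r (l, Suc i)) =
         (chosen_orientation D (l, i) = chosen_orientation D (l, Suc i))" if "p \<noteq> Cup"
      proof -
        have len: "Suc i < width D l" using wf_nth[OF L _ ip] l that by simp
        have up: "up (l, i) = level D up l ! i" "up (l, Suc i) = level D up l ! Suc i" for up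
          using len by simp_all
        have nth: "map Not (level D up l) ! i = (\<not> level D up l ! i)"
          "map Not (level D up l) ! Suc i = (\<not> level D up l ! Suc i)" for up
          using len by simp_all
        assume "level D (oriented_by D r) l = level D (chosen_orientation D) l \<or>
          level D (oriented_by D r) l = map Not (level D (chosen_orientation D) l)"
        then show ?thesis
          unfolding up[of "oriented_by D r"] up[of "chosen_orientation D"]
          by (elim disjE) (simp_all only: nth simp_thms)
      qed
      then have "crossing_sign D (oriented_by D r) l = crossing_sign D (chosen_orientation D) l"
        unfolding crossing_sign_def ip by (auto simp: is_crossing_def)
      then show "\<i> powi crossing_sign D (oriented_by D r) l = \<i> powi crossing_sign D (chosen_orientation D) l"
        by simp
    qed
    also have "\<dots> = \<i> powi w" by (simp add: power_int_sum w_def writhe_def)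
    finally show ?thesis .
  qed
  have Xr: "X r = \<i> powi (shading D - w)" if "r \<in> runs D []" for r
  proof -
    have "X r * \<i> powi w = \<i> powi (shading D - w) * \<i> powi w"
      using prod[OF that] Ww[OF that] by (simp add: power_int_add[symmetric])
    then show ?thesis by simp
  qed
  have "ev (bw (1::complex) 1) D = (\<Sum>r\<in>runs D []. X r)"
    using ev_runs[OF perm_events_bw1[of D]] wf by (simp add: ev_def X_def)
  also have "\<dots> = X ?r + X (neg ?r)" unfolding runs(1) using runs(2) by simp
  also have "\<dots> = 2 * \<i> powi (shading D - w)" using Xr[of ?r] Xr[of "neg ?r"] by (simp add: runs(1))
  finally have "ev (bw (1::complex) 1) D = 2 * \<i> powi (shading D - w)" .
  moreover obtain Y :: int where Y: "ev (bw (1::complex) 1) D = of_int Y" "Y mod 3 = (- 1) ^ ncr D mod 3"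
    using bracket_mod3[OF wf, where 'r = complex] by blast
  ultimately have eq: "of_int Y = 2 * \<i> powi (shading D - w)" by simp
  \<comment> \<open>An integer of the form 2 \<i>^k is 2 or -2. Its residue modulo 3 then gives the
    parity of the number of crossings, which is that of \<open>shading\<close>; with this parity the
    value of \<open>k\<close> yields the claim.\<close>
  define k where "k = (shading D - w) mod 4"
  have "shading D - w = 4 * ((shading D - w) div 4) + k" by (simp add: k_def)
  then have "\<i> powi (shading D - w) = \<i> powi k"
    by (metis (no_types) i_power4 power_int_add complex_i_not_zero mult_1)
  then have eq: "of_int Y = 2 * \<i> powi k" using eq by simp
  have i3: "\<i> powi 2 = -1" "\<i> powi 3 = - \<i>" by (simp_all add: power_int_def eval_nat_numeral)
  have "0 \<le> k" "k < 4" by (auto simp: k_def)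
  then consider "k = 0" | "k = 1" | "k = 2" | "k = 3" by linarith
  then show ?thesis
  proof cases
    case 1
    then have "Y = 2" using eq by (metis mult.right_neutral of_int_eq_iff of_int_numeral power_int_0_right)
    then have "odd (ncr D)" using Y(2) by (cases "even (ncr D)") auto
    then have "odd (shading D)" by (simp add: shading_even)
    then show ?thesis using 1 unfolding k_def w_def by presburger
  next
    case 3
    then have "of_int Y = (of_int (- 2) :: complex)" using eq i3 by simp
    then have "Y = - 2" by (simp only: of_int_eq_iff)
    then have "even (ncr D)" using Y(2) by (cases "even (ncr D)") auto
    then have "even (shading D)" by (simp add: shading_even)
    then show ?thesis using 3 unfolding k_def w_def by presburger
  next
    case 2
    then have "Im (of_int Y) = 2" using eq by simp
    then show ?thesis by simp
  next
    case 4
    then have "Im (of_int Y) = - 2" using eq i3 by simp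
    then show ?thesis by simp
  qed
qed

subsection \<open>Laurent polynomiality of the bracket\<close>

abbreviation circle :: "'r::field \<Rightarrow> 'r" where "circle a \<equiv> - (a\<^sup>2) - (inverse a)\<^sup>2"

abbreviation bracket :: "'r::field \<Rightarrow> diagram \<Rightarrow> 'r" where
  "bracket a \<equiv> ev (bw a (inverse a))"

lemma mhom_field: "y \<noteq> 0 \<Longrightarrow> mhom (unit_power (y::'r::field))"
  using mhom_power[of y "inverse y"] by simp

lemma subst1_simps:
  assumes "y \<noteq> (0::'r::field)"
  shows "subst1 (V + W) y = subst1 V y + subst1 W y" "subst1 (V - W) y = subst1 V y - subst1 W y"
    "subst1 (V * W) y = subst1 V y * subst1 W y" "subst1 1 y = 1" "subst1 (- V) y = - subst1 V y"
    "subst1 (V ^ n) y = subst1 V y ^ n" "subst1 (Poly_Mapping.single k c) y = of_int c * y powi k"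
    "subst1 var_t y = y"
proof -
  note m = mhom_field[OF assms]
  show *: "subst1 (V * W) y = subst1 V y * subst1 W y" "subst1 1 y = 1" for V W
    using m by (simp_all add: subst1_eq subst_mult)
  show "subst1 (V ^ n) y = subst1 V y ^ n" by (induction n) (simp_all add: *)
  show "subst1 var_t y = y" using m by (rule subst1_var_t)
qed (simp_all add: subst1_eq subst_add subst_diff subst_uminus subst_single unit_power_field assms)

lemma circle_subst1:
  assumes "a \<noteq> (0::'r::field)" shows "circle a = a powi 2 * subst1 (- 1 - var_t) (a powi (- 4))"
proof -
  have "a powi (2 + - 4) = a powi 2 * a powi (- 4)" by (rule power_int_add) (use assms in simp)
  then have "a\<^sup>2 * a powi (- 4) = a powi (- 2)" by simp
  then show ?thesis using assms
    by (simp add: subst1_simps right_diff_distrib) (simp add: power_int_def power_inverse)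
qed

text \<open>By skein induction, starting from the congruence for circles. The polynomial
  \<open>V\<close> is chosen before \<open>a\<close>, so the same one serves for \<open>a\<close>
  and \<open>inverse a\<close>, which is how mirror images are compared later.\<close>

lemma bracket_laurent:
  assumes "wfs 0 D 0" "D \<noteq> []"
  shows "\<exists>V. \<forall>a::'r::field. a \<noteq> 0 \<longrightarrow>
    bracket a D = circle a * (a powi (shading D - 2) * subst1 V (a powi (- 4)))"
  using assms
proof (induction rule: crossing_induct)
  case (crossingless D)
  then obtain k where k: "circ D k" using circ_exists[of 0 D] by auto
  then have "k \<ge> 1" using circ_pos crossingless by blast
  then obtain l where l: "k = Suc l" by (cases k) auto
  define j where "j = (shading D - 2 * int k) div 4"
  have "(shading D - 2 * int k) mod 4 = 0" using circ_shading[OF k] by presburger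
  then have j: "shading D - 2 = 2 * int l + 4 * j" unfolding j_def l by presburger
  show ?case
  proof (intro exI allI impI)
    fix a :: 'r assume a: "a \<noteq> 0"
    have "bracket a D = circle a * circle a ^ l"
      using circ_ev[OF k zigzag_bw(1)[of a "inverse a"] crossingless(1)] a by (simp add: l)
    also have "circle a ^ l = a powi (2 * int l) * subst1 ((- 1 - var_t) ^ l) (a powi (- 4))"
      unfolding circle_subst1[OF a] using a
      by (simp only: power_mult_distrib subst1_simps power_int_eq_0_iff simp_thms)
         (simp add: power_int_mult)
    also have "\<dots> = a powi (shading D - 2) * subst1 ((- 1 - var_t) ^ l * Poly_Mapping.single j 1) (a powi (- 4))"
    proof -
      have "a powi (2 * int l) = a powi (shading D - 2) * a powi (- 4 * j)"
        using a by (simp add: j power_int_add[symmetric])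
      also have "a powi (- 4 * j) = (a powi (- 4)) powi j" by (rule power_int_mult)
      finally show ?thesis using a by (simp only: subst1_simps power_int_eq_0_iff simp_thms of_int_1 mult_1 ac_simps)
    qed
    finally show "bracket a D = circle a * (a powi (shading D - 2) * subst1 ((- 1 - var_t) ^ l * Poly_Mapping.single j 1) (a powi (- 4)))" .
  qed
next
  case (smoothing u i p v)
  have "u \<noteq> []" using smoothing(1,2) by (cases u) (auto simp: is_crossing_def)
  then obtain V1 V2 where V: "\<And>a::'r. a \<noteq> 0 \<Longrightarrow>
      bracket a (u @ [(i, Cap), (i, Cup)] @ v) = circle a * (a powi (shading (u @ [(i, Cap), (i, Cup)] @ v) - 2) * subst1 V1 (a powi (- 4)))"
    "\<And>a::'r. a \<noteq> 0 \<Longrightarrow> bracket a (u @ v) = circle a * (a powi (shading (u @ v) - 2) * subst1 V2 (a powi (- 4)))"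
    using smoothing(3,4) by auto
  define s where "s = shading (u @ v)"
  \<comment> \<open>\<open>e\<close> is the exponent of \<open>a\<close> in the vertical
    coefficient. The inserted cap and cup raise \<open>shading\<close> by 4 i + 2, and
    \<open>k\<close> is the resulting shift of the horizontal term as an exponent of a^-4.\<close>
  define e where "e = (if p = Xo then - 1 else 1 :: int)"
  define k where "k = (if p = Xo then - int i - 1 else - int i)"
  have s1: "shading (u @ [(i, Cap), (i, Cup)] @ v) = s + 4 * int i + 2"
    by (simp add: s_def shading_def algebra_simps)
  have s2: "shading (u @ (i, p) # v) = s + e"
    using smoothing(2) by (cases p) (simp_all add: s_def shading_def e_def)
  show ?case
  proof (intro exI allI impI)
    fix a :: 'r assume a: "a \<noteq> 0"
    have h: "hcoeff a (inverse a) p = a powi (- e)" "hcoeff (inverse a) a p = a powi e"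
      using smoothing(2) by (cases p; simp add: e_def power_int_minus)+
    have pw: "a powi x * a powi y = a powi (x + y)" for x y
      using a by (simp add: power_int_add)
    have "- e + (s + 4 * int i) = (s + e - 2) + - 4 * k"
      using smoothing(2) by (cases p) (simp_all add: e_def k_def)
    then have "a powi (- e) * a powi (s + 4 * int i) = a powi (s + e - 2) * a powi (- 4 * k)"
      by (simp only: pw)
    also have "a powi (- 4 * k) = (a powi (- 4)) powi k" by (rule power_int_mult)
    finally have 1: "a powi (- e) * a powi (s + 4 * int i) = a powi (s + e - 2) * (a powi (- 4)) powi k" .
    have 2: "a powi e * a powi (s - 2) = a powi (s + e - 2)"
      using a by (simp add: power_int_add[symmetric] algebra_simps)
    have "bracket a (u @ (i, p) # v) =
        circle a * ((a powi (- e) * a powi (s + 4 * int i)) * subst1 V1 (a powi (- 4)) +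
          (a powi e * a powi (s - 2)) * subst1 V2 (a powi (- 4)))"
      unfolding ev_smoothing[OF smoothing(1,2)] V(1)[OF a] V(2)[OF a] h s1 s_def[symmetric]
      by (simp add: algebra_simps)
    also have "\<dots> = circle a * (a powi (s + e - 2) *
        subst1 (Poly_Mapping.single k 1 * V1 + V2) (a powi (- 4)))"
      unfolding 1 2 using a by (simp only: subst1_simps power_int_eq_0_iff simp_thms) (simp add: algebra_simps)
    finally show "bracket a (u @ (i, p) # v) = circle a * (a powi (shading (u @ (i, p) # v) - 2) *
        subst1 (Poly_Mapping.single k 1 * V1 + V2) (a powi (- 4)))" unfolding s2 .
  qed
qed

text \<open>By \<open>knot_shading\<close> the writhe factor completes the common exponent of
  \<open>a\<close> to a multiple of 4, that is, to a power of t.\<close>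

lemma knot_laurent:
  assumes D: "knot_diagram D"
  shows "\<exists>V. \<forall>a::'r::field. a \<noteq> 0 \<longrightarrow>
    bracket a D * (- (a powi (- 3))) powi writhe D = circle a * subst1 V (a powi (- 4))"
proof -
  have wf: "wfs 0 D 0" using knot_link[OF D] by (simp add: link_diagram_def wf_from_wfs)
  obtain V where V: "\<And>a::'r. a \<noteq> 0 \<Longrightarrow>
      bracket a D = circle a * (a powi (shading D - 2) * subst1 V (a powi (- 4)))"
    using bracket_laurent[OF wf knot_nonempty[OF D], where 'r = 'r] by blast
  obtain j where j: "shading D - 3 * writhe D - 2 = 4 * j" using knot_shading[OF D] by (metis dvdE mod_0_imp_dvd)
  define c :: int where "c = (if even (writhe D) then 1 else - 1)"
  have "bracket a D * (- (a powi (- 3))) powi writhe D = circle a * subst1 (Poly_Mapping.single (- j) c * V) (a powi (- 4))"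
    if a: "a \<noteq> 0" for a :: 'r
  proof -
    have "(- (a powi (- 3))) powi writhe D = (- 1 * a powi (- 3)) powi writhe D" by simp
    also have "\<dots> = of_int c * a powi (- 3 * writhe D)"
      unfolding power_int_mult_distrib power_int_mult by (simp add: c_def power_int_minus_left)
    finally have w: "(- (a powi (- 3))) powi writhe D = of_int c * a powi (- 3 * writhe D)" .
    have "a powi (shading D - 2) * a powi (- 3 * writhe D) = a powi (- 4 * (- j))"
      using a j by (simp add: power_int_add[symmetric] algebra_simps)
    also have "\<dots> = (a powi (- 4)) powi (- j)" by (rule power_int_mult)
    finally have e: "a powi (shading D - 2) * a powi (- 3 * writhe D) = (a powi (- 4)) powi (- j)" .
    have "bracket a D * (- (a powi (- 3))) powi writhe D = circle a *
        (of_int c * (a powi (shading D - 2) * a powi (- 3 * writhe D)) * subst1 V (a powi (- 4)))"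
      unfolding V[OF a] w by (simp only: ac_simps)
    then show ?thesis unfolding e using a by (simp only: subst1_simps power_int_eq_0_iff simp_thms)
  qed
  then show ?thesis by blast
qed

subsection \<open>The Jones polynomial\<close>

lemma circle_value_eq: "circle_value c = circle c"
  by (simp add: circle_value_def power_int_def power_inverse)

lemma monom_4_plus_1: "monom (1::'r::comm_ring_1) 4 + 1 \<noteq> 0"
proof
  assume "monom (1::'r) 4 + 1 = 0"
  then have "coeff (monom (1::'r) 4 + 1) 0 = 0" by simp
  then show False by simp
qed

lemma circle_nonzero: "circle var_A \<noteq> 0" "circle var_B \<noteq> 0"
proof -
  have *: "circle c = - (inverse c)\<^sup>2 * (c ^ 4 + 1)" if "c \<noteq> 0" for c :: ratfun
    using that by (simp add: field_simps power2_eq_square eval_nat_numeral)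
  have "[:monom (1::int) 4:] + 1 = [:monom 1 4 + 1:]" by (simp add: one_pCons)
  then have "[:monom (1::int) 4:] + 1 \<noteq> 0" using monom_4_plus_1[where 'r = int] by simp
  then have "var_A ^ 4 + 1 \<noteq> 0"
    unfolding var_A_power by (simp add: One_fract_def Zero_fract_def eq_fract)
  then show "circle var_A \<noteq> 0" unfolding *[OF var_A_0] by simp
  have "var_B ^ 4 + 1 \<noteq> 0"
    unfolding var_B_power using monom_4_plus_1[where 'r = "int poly"] by (simp add: One_fract_def Zero_fract_def eq_fract)
  then show "circle var_B \<noteq> 0" unfolding *[OF var_B_0] by simp
qed

text \<open>The state sum is 1 on the empty diagram, the Kauffman bracket is 1 on a circle; this
  accounts for the extra circle value.\<close>

lemma kauffman_from_eq:
  assumes "wfs 0 (S @ D) 0" "crossingless S"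
  shows "kauffman_from S D * circle var_A = bracket var_A (S @ D)"
  using assms
proof (induction S D rule: kauffman_from.induct)
  case (1 S)
  have "bracket var_A S = circle var_A ^ card (components S)"
    using ev_crossingless[OF 1(2) _ zigzag_bw(1)[of var_A "inverse var_A"]] 1(1) by simp
  also have "\<dots> = circle var_A powi (int (card (components S)) - 1) * circle var_A"
    using circle_nonzero by (simp add: power_int_minus_mult)
  finally show ?case by (simp add: circle_value_eq)
next
  case (2 S i p D)
  show ?case
  proof (cases "is_crossing p")
    case True
    have IH: "kauffman_from (S @ [(i, Cap), (i, Cup)]) D * circle var_A = bracket var_A (S @ [(i, Cap), (i, Cup)] @ D)"
      "kauffman_from S D * circle var_A = bracket var_A (S @ D)"
      using 2 True wfs_smoothings[of 0 S i p D 0] by simp_all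
    have eq: "kauffman_from S ((i, p) # D) = hcoeff var_A (inverse var_A) p * kauffman_from (S @ [(i, Cap), (i, Cup)]) D
        + hcoeff (inverse var_A) var_A p * kauffman_from S D"
      using True by (cases p) (auto simp: Let_def)
    show ?thesis unfolding ev_smoothing[OF 2(5) True] append_Cons[symmetric]
      by (simp only: eq IH distrib_right mult.assoc)
  next
    case False
    then have "kauffman_from S ((i, p) # D) = kauffman_from (S @ [(i, p)]) D" by (cases p) auto
    moreover have "kauffman_from (S @ [(i, p)]) D * circle var_A = bracket var_A (S @ (i, p) # D)"
      using False 2 by (cases p) auto
    ultimately show ?thesis by simp
  qed
qed

lemma kauffman_bracket_eq:
  assumes "link_diagram D" shows "kauffman_bracket D * circle var_A = bracket var_A D"
  using kauffman_from_eq[of "[]" D] assms by (simp add: kauffman_bracket_def link_diagram_def wf_from_wfs)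

lemma bracket_writhe_invariant:
  assumes "K \<in> knots" "D \<in> K" "E \<in> K"
  shows "bracket var_A D * (- (var_A powi (- 3))) powi writhe D =
    bracket var_A E * (- (var_A powi (- 3))) powi writhe E"
proof -
  obtain D0 where K: "K = {D. knot_diagram D0 \<and> knot_diagram D \<and> equivclp local_move D0 D}"
    using assms(1) by (auto simp: knots_def quotient_def)
  have D: "knot_diagram D" and E: "knot_diagram E" using assms K by auto
  have "equivclp local_move D E" using assms K by (auto intro: equivclp_trans equivclp_sym)
  \<comment> \<open>The product with the orientation sum is followed along the moves, and only at
    the two ends, which are knots, converted to a power of the writhe.\<close>
  define q where "q = - (var_A powi (- 3))"
  have q: "q = - (inverse var_A ^ 3)" "q \<noteq> 0" "inverse q = - (var_A ^ 3)"
    by (auto simp: q_def power_int_def power_inverse)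
  let ?F = "\<lambda>D. bracket var_A D * ev (ow q (inverse q)) D"
  have step: "?F y = ?F z" if "local_move y z" for y z
    using bracket_orientation_invariant[OF _ that, of var_A "inverse var_A"] unfolding q(3) unfolding q(1) by simp
  have "?F D = ?F E"
    using \<open>equivclp local_move D E\<close>
  proof (induction rule: equivclp_induct)
    case (step y z)
    then show ?case using \<open>\<And>y z. local_move y z \<Longrightarrow> ?F y = ?F z\<close> by metis
  qed simp
  then show ?thesis
    using ev_writhe[OF D q(2)] ev_writhe[OF E q(2)] by (simp add: q_def)
qed

lemma jones_eqI:
  assumes K: "K \<in> knots" "D \<in> K"
    and V: "bracket var_A D * (- (var_A powi (- 3))) powi writhe D = circle var_A * subst1 V (var_A powi (- 4))"
  shows "jones K = V"
  unfolding jones_def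
proof (rule the_equality)
  have norm: "kauffman_bracket E * (- (var_A powi (- 3))) powi writhe E = subst1 V (var_A powi (- 4))"
    if "E \<in> K" for E
  proof -
    have "link_diagram E" using K that by (auto simp: knots_def quotient_def knot_link)
    from kauffman_bracket_eq[OF this]
    have "circle var_A * (kauffman_bracket E * (- (var_A powi (- 3))) powi writhe E) =
        bracket var_A E * (- (var_A powi (- 3))) powi writhe E" by (simp add: ac_simps)
    also have "\<dots> = circle var_A * subst1 V (var_A powi (- 4))"
      using bracket_writhe_invariant[OF K that] V by simp
    finally show ?thesis using mult_left_cancel[OF circle_nonzero(1)] by blast
  qed
  then show "\<forall>D\<in>K. subst1 V (var_A powi - 4) = kauffman_bracket D * (- (var_A powi - 3)) powi writhe D"
    by simp
  show "W = V" if "\<forall>D\<in>K. subst1 W (var_A powi - 4) = kauffman_bracket D * (- (var_A powi - 3)) powi writhe D" for W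
    using bspec[OF that K(2)] norm[OF K(2)] by (intro subst1_inject) simp
qed

subsection \<open>Diagrams with an axis\<close>

fun left_after :: "place \<times> piece \<Rightarrow> nat \<Rightarrow> nat" where
  "left_after (L k, p) a = strands_after p a"
| "left_after (R k, p) a = a"
| "left_after (Axis, Cup) a = a + 1"
| "left_after (Axis, Cap) a = a - 1"
| "left_after (Axis, _) a = a"

fun right_after :: "place \<times> piece \<Rightarrow> nat \<Rightarrow> nat" where
  "right_after (L k, p) b = b"
| "right_after (R k, p) b = strands_after p b"
| "right_after (Axis, Cup) b = b + 1"
| "right_after (Axis, Cap) b = b - 1"
| "right_after (Axis, _) b = b"

fun valid_at :: "place \<times> piece \<Rightarrow> nat \<Rightarrow> nat \<Rightarrow> bool" where
  "valid_at (L k, p) a b \<longleftrightarrow> (if p = Cup then k \<le> a else k + 2 \<le> a)"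
| "valid_at (R k, p) a b \<longleftrightarrow> (if p = Cup then k \<le> b else k + 2 \<le> b)"
| "valid_at (Axis, p) a b \<longleftrightarrow> p = Cup \<or> 1 \<le> a \<and> 1 \<le> b"

fun wf2 :: "nat \<Rightarrow> nat \<Rightarrow> axis_diagram \<Rightarrow> nat \<Rightarrow> nat \<Rightarrow> bool" where
  "wf2 a b [] a' b' \<longleftrightarrow> a = a' \<and> b = b'"
| "wf2 a b (e # D) a' b' \<longleftrightarrow> valid_at e a b \<and> wf2 (left_after e a) (right_after e b) D a' b'"

lemma wf_axis_wf2: "wf_axis_from a b D = wf2 a b D 0 0"
  by (induction a b D rule: wf_axis_from.induct) auto

lemma wf2_append: "wf2 a b (D @ E) a' b' \<longleftrightarrow> (\<exists>c d. wf2 a b D c d \<and> wf2 c d E a' b')"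
  by (induction D arbitrary: a b) auto

text \<open>Both lists are read outwards from the axis, so that a reflection just exchanges them.
  The first argument of \<open>W\<close> tells whether the event lies on the axis.\<close>

fun axact :: "(bool \<Rightarrow> piece \<Rightarrow> 'r::comm_ring_1 weight) \<Rightarrow> place \<times> piece \<Rightarrow>
    (bool list \<Rightarrow> bool list \<Rightarrow> 'r) \<Rightarrow> bool list \<Rightarrow> bool list \<Rightarrow> 'r" where
  "axact W (L k, p) F xs ys = act (k, p, flip (W False p)) (\<lambda>xs. F xs ys) xs"
| "axact W (R k, p) F xs ys = act (k, p, W False p) (F xs) ys"
| "axact W (Axis, Cup) F xs ys = (\<Sum>c\<in>UNIV. \<Sum>d\<in>UNIV. W True Cup c d c d * F (c # xs) (d # ys))"
| "axact W (Axis, Cap) F xs ys = W True Cap (hd xs) (hd ys) (hd xs) (hd ys) * F (tl xs) (tl ys)"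
| "axact W (Axis, p) F xs ys =
     (\<Sum>c\<in>UNIV. \<Sum>d\<in>UNIV. W True p (hd xs) (hd ys) c d * F (c # tl xs) (d # tl ys))"

fun ev2 :: "(bool \<Rightarrow> piece \<Rightarrow> 'r::comm_ring_1 weight) \<Rightarrow> axis_diagram \<Rightarrow>
    (bool list \<Rightarrow> bool list \<Rightarrow> 'r) \<Rightarrow> bool list \<Rightarrow> bool list \<Rightarrow> 'r" where
  "ev2 W [] F = F"
| "ev2 W (e # D) F = axact W e (ev2 W D F)"

lemma ev2_append [simp]: "ev2 W (D @ E) F = ev2 W D (ev2 W E F)"
  by (induction D) auto

definition eps2 :: "bool list \<Rightarrow> bool list \<Rightarrow> 'r::comm_ring_1" where
  "eps2 xs ys = of_bool (xs = [] \<and> ys = [])"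

lemma axact_cong:
  assumes "valid_at e (length xs) (length ys)"
    and "\<And>xs' ys'. length xs' = left_after e (length xs) \<Longrightarrow> length ys' = right_after e (length ys)
      \<Longrightarrow> F xs' ys' = G xs' ys'"
  shows "axact W e F xs ys = axact W e G xs ys"
proof (cases e)
  case (Pair a p)
  show ?thesis
  proof (cases a)
    case (L k)
    then show ?thesis using assms unfolding Pair L
      by (simp only: axact.simps) (rule act_cong[of p k "length xs"]; simp)
  next
    case (R k)
    then show ?thesis using assms unfolding Pair R
      by (simp only: axact.simps) (rule act_cong[of p k "length ys"]; simp)
  next
    case Axis
    then show ?thesis using assms unfolding Pair Axis
      by (cases p; cases xs; cases ys) (auto intro!: sum.cong)
  qed
qed

lemma ev2_cong:
  assumes "wf2 (length xs) (length ys) D a' b'"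
    and "\<And>xs ys. length xs = a' \<Longrightarrow> length ys = b' \<Longrightarrow> F xs ys = G xs ys"
  shows "ev2 W D F xs ys = ev2 W D G xs ys"
  using assms(1)
proof (induction D arbitrary: xs ys)
  case (Cons e D)
  then show ?case unfolding ev2.simps by (intro axact_cong) auto
qed (use assms(2) in auto)

lemma axact_linear:
  "axact W e (\<lambda>xs ys. c * F xs ys + d * G xs ys) xs ys = c * axact W e F xs ys + d * axact W e G xs ys"
  by (cases "(W, e, F, xs, ys)" rule: axact.cases) (simp_all add: act_linear sum_bool algebra_simps)

lemma ev2_linear:
  "ev2 W D (\<lambda>xs ys. c * F xs ys + d * G xs ys) = (\<lambda>xs ys. c * ev2 W D F xs ys + d * ev2 W D G xs ys)"
  by (induction D) (auto simp: axact_linear)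

definition axis_tag :: "(bool \<Rightarrow> piece \<Rightarrow> 'r weight) \<Rightarrow> nat \<Rightarrow> axis_diagram \<Rightarrow> 'r event list" where
  "axis_tag W a D = map2 (\<lambda>(i, p) e. (i, p, W (fst e = Axis) p)) (forget_from a D) D"

lemma length_forget_from [simp]: "length (forget_from a D) = length D"
  by (induction a D rule: forget_from.induct) auto

lemma untag_axis_tag: "untag (axis_tag W a D) = forget_from a D"
proof -
  have "untag (axis_tag W a D) = map fst (zip (forget_from a D) D)"
    unfolding axis_tag_def by (simp add: case_prod_unfold comp_def)
  then show ?thesis by simp
qed

text \<open>Counting strands from the other side reverses the label list and thereby the two ends of
  an event, which is what \<open>flip\<close> does.\<close>

lemma act_rev:
  assumes "if p = Cup then k \<le> length xs else k + 2 \<le> length xs"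
  shows "act (if p = Cup then length xs - k else length xs - k - 2, p, w) \<phi> (rev xs) =
    act (k, p, flip w) (\<lambda>xs. \<phi> (rev xs)) xs"
proof (cases "p = Cup")
  case True
  then obtain us vs where xs: "xs = us @ vs" "length us = k" using split_at assms by metis
  have "ins (length vs) c d (rev xs) = rev (ins k d c xs)" for c d
    using list_simps(1)[of "rev vs" c d "rev us"] list_simps(1)[of us d c vs] xs by simp
  then show ?thesis using True xs by (simp add: sum_bool flip_def algebra_simps)
next
  case False
  then obtain us x y vs where xs: "xs = us @ x # y # vs" "length us = k"
    using split_at2 assms by metis
  have "del (length vs) (rev xs) = rev (us @ vs)" "rev xs ! length vs = y" "rev xs ! Suc (length vs) = x"
    using list_simps(4)[of "rev vs" y x "rev us"] list_simps(6)[of "rev vs" y "x # rev us"]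
      list_simps(7)[of "rev vs" y x "rev us"] xs by simp_all
  moreover have "ins (length vs) c d (rev (us @ vs)) = rev (us @ d # c # vs)" for c d
    using list_simps(1)[of "rev vs" c d "rev us"] by simp
  ultimately show ?thesis using False xs(1)
    by (cases p) (simp_all add: xs(2)[symmetric] sum_bool flip_def algebra_simps)
qed

text \<open>In the plane strands are counted from the left, so the labels on the left of the axis
  appear in reversed order.\<close>

lemma ev2_evf:
  assumes "wf2 (length xs) (length ys) D 0 0"
  shows "ev2 W D eps2 xs ys = evf (axis_tag W (length xs) D) eps (rev xs @ ys)"
  using assms
proof (induction D arbitrary: xs ys)
  case Nil
  then show ?case by (simp add: axis_tag_def eps2_def eps_def)
next
  case (Cons e D)
  define G where "G = (\<lambda>xs ys. evf (axis_tag W (length xs) D) eps (rev xs @ ys))"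
  have "ev2 W (e # D) eps2 xs ys = axact W e G xs ys"
    unfolding ev2.simps G_def by (rule axact_cong) (use Cons in auto)
  also have "\<dots> = evf (axis_tag W (length xs) (e # D)) eps (rev xs @ ys)"
  proof (cases e)
    case (Pair a p)
    show ?thesis
    proof (cases a)
      case (L k)
      let ?i = "if p = Cup then length xs - k else length xs - k - 2"
      let ?\<psi> = "evf (axis_tag W (strands_after p (length xs)) D) eps"
      have ok: "if p = Cup then k \<le> length xs else k + 2 \<le> length xs" using Cons.prems by (cases "p = Cup") (auto simp add: Pair L)
      have "axis_tag W (length xs) (e # D) = (?i, p, W False p) # axis_tag W (strands_after p (length xs)) D"
        by (simp add: axis_tag_def Pair L)
      then have "evf (axis_tag W (length xs) (e # D)) eps (rev xs @ ys) = act (?i, p, W False p) ?\<psi> (rev xs @ ys)"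
        by (simp only: evf.simps)
      also have "\<dots> = act (?i, p, W False p) (\<lambda>us. ?\<psi> (us @ ys)) (rev xs)"
        by (rule act_prefix) (use ok in \<open>cases "p = Cup"; simp\<close>)
      also have "\<dots> = act (k, p, flip (W False p)) (\<lambda>xs. ?\<psi> (rev xs @ ys)) xs"
        by (rule act_rev[OF ok])
      also have "\<dots> = axact W e G xs ys"
        unfolding Pair L axact.simps G_def by (rule act_cong[of _ _ "length xs"]) (use ok in auto)
      finally show ?thesis by simp
    next
      case (R k)
      have "evf (axis_tag W (length xs) (e # D)) eps (rev xs @ ys) =
          act (length (rev xs) + k, p, W False p) (evf (axis_tag W (length xs) D) eps) (rev xs @ ys)"
        by (simp add: axis_tag_def Pair R)
      then show ?thesis unfolding act_shift by (simp add: Pair R G_def)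
    next
      case Axis
      note Ax = this
      show ?thesis
      proof (cases "p = Cup")
        case True
        have "ins (length xs) c d (rev xs @ ys) = rev xs @ c # d # ys" for c d
          using list_simps(1)[of "rev xs"] by simp
        then show ?thesis by (simp add: axis_tag_def Pair Ax True G_def)
      next
        case False
        then obtain x xs' y ys' where xy: "xs = x # xs'" "ys = y # ys'"
          using Cons.prems by (cases xs; cases ys) (auto simp: Pair Ax)
        have "ins (length xs') c d (rev xs' @ ys') = rev xs' @ c # d # ys'" for c d
          using list_simps(1)[of "rev xs'"] by simp
        moreover have "del (length xs') (rev xs' @ x # y # ys') = rev xs' @ ys'"
          using list_simps(4)[of "rev xs'"] by simp
        moreover have "(rev xs' @ x # y # ys') ! length xs' = x" "(rev xs' @ x # y # ys') ! Suc (length xs') = y"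
          using list_simps(6)[of "rev xs'" x] list_simps(7)[of "rev xs'" x y ys'] by simp_all
        ultimately show ?thesis using False
          by (cases p) (simp_all add: axis_tag_def Pair Ax G_def xy)
      qed
    qed
  qed
  finally show ?case .
qed

lemma axis_tag_uniform: "axis_tag (\<lambda>_. w) a D = tag w (forget_from a D)"
proof -
  have "axis_tag (\<lambda>_. w) a D = map ((\<lambda>(i, p). (i, p, w p)) \<circ> fst) (zip (forget_from a D) D)"
    by (simp add: axis_tag_def case_prod_unfold comp_def)
  then show ?thesis by (simp add: tag_def flip: map_map)
qed

lemma ev2_uniform:
  assumes "wf_axis_from 0 0 D" shows "ev2 (\<lambda>_. w) D eps2 [] [] = ev w (forget_axis D)"
  using ev2_evf[of "[]" "[]" D "\<lambda>_. w"] assms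
  by (simp add: wf_axis_wf2 axis_tag_uniform ev_def forget_axis_def)

lemma wf_forget: "wf_axis_from a b D \<Longrightarrow> wfs (a + b) (forget_from a D) 0"
proof (induction D arbitrary: a b)
  case (Cons e D)
  obtain q p where e: "e = (q, p)" by (cases e)
  show ?case
  proof (cases q)
    case (L k)
    have "strands_after p a + b = strands_after p (a + b)" if "p \<noteq> Cup \<longrightarrow> 2 \<le> a"
      using that by (cases p) auto
    then show ?thesis using Cons.IH[of "strands_after p a" b] Cons.prems
      by (auto simp: e L split: if_splits)
  next
    case (R k)
    have "a + strands_after p b = strands_after p (a + b)" if "p \<noteq> Cup \<longrightarrow> 2 \<le> b"
      using that by (cases p) auto
    then show ?thesis using Cons.IH[of a "strands_after p b"] Cons.prems
      by (auto simp: e R split: if_splits)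
  next
    case Axis
    show ?thesis
    proof (cases p)
      case Cup
      then show ?thesis using Cons.IH[of "a + 1" "b + 1"] Cons.prems by (simp add: e Axis)
    next
      case Cap
      then have "1 \<le> a" "1 \<le> b" "wf_axis_from (a - 1) (b - 1) D" using Cons.prems by (auto simp: e Axis)
      moreover from this have "a - 1 + (b - 1) = a + b - 2" by simp
      ultimately show ?thesis using Cons.IH[of "a - 1" "b - 1"] by (simp add: e Axis Cap)
    next
      case Xo
      then show ?thesis using Cons.IH[of a b] Cons.prems by (simp add: e Axis)
    next
      case Xu
      then show ?thesis using Cons.IH[of a b] Cons.prems by (simp add: e Axis)
    qed
  qed
qed simp

lemma wf_forget_axis: "wf_axis_from 0 0 D \<Longrightarrow> wfs 0 (forget_axis D) 0"
  using wf_forget[of 0 0 D] by (simp add: forget_axis_def)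

section \<open>Halves of a symmetric diagram\<close>

definition not_right :: "place \<times> piece \<Rightarrow> bool" where "not_right = (\<lambda>(a, p). \<forall>k. a \<noteq> R k)"
definition not_left :: "place \<times> piece \<Rightarrow> bool" where "not_left = (\<lambda>(a, p). \<forall>k. a \<noteq> L k)"

lemma same_halves_iff:
  "same_halves D E \<longleftrightarrow> filter not_right D = filter not_right E \<and> filter not_left D = filter not_left E"
  by (simp add: same_halves_def not_right_def not_left_def)

lemma not_simps [simp]: "not_right (L k, p)" "\<not> not_right (R k, p)" "not_right (Axis, p)"
  "not_left (R k, p)" "\<not> not_left (L k, p)" "not_left (Axis, p)"
  by (auto simp: not_right_def not_left_def)

lemma axact_commute:
  "axact W (L k, p) (axact W (R l, q) F) xs ys = axact W (R l, q) (axact W (L k, p) F) xs ys"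
proof -
  have eq: "axact W (L k, p) F xs = (\<lambda>y. act (k, p, flip (W False p)) (\<lambda>xs. F xs y) xs)"
    by (rule ext) simp
  show ?thesis unfolding axact.simps(2)[of W l q "axact W (L k, p) F"] eq
    using act_swap[of "(k, p, flip (W False p))" "(l, q, W False q)" F ys xs] by simp
qed

lemma ev2_pull_left:
  "(\<forall>e\<in>set E. \<not> not_right e) \<Longrightarrow> ev2 W (E @ [(L k, p)]) F = ev2 W ((L k, p) # E) F"
proof (induction E)
  case (Cons e E)
  then obtain l q where e: "e = (R l, q)" by (cases e; cases "fst e") (auto simp: not_right_def)
  have "ev2 W ((e # E) @ [(L k, p)]) F = axact W e (ev2 W ((L k, p) # E) F)"
    using Cons by (simp del: axact.simps)
  also have "\<dots> = ev2 W ((L k, p) # e # E) F"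
    unfolding e by (auto intro!: ext simp only: ev2.simps axact_commute)
  finally show ?case by simp
qed simp

lemma ev2_pull_right:
  "(\<forall>e\<in>set E. \<not> not_left e) \<Longrightarrow> ev2 W (E @ [(R k, p)]) F = ev2 W ((R k, p) # E) F"
proof (induction E)
  case (Cons e E)
  then obtain l q where e: "e = (L l, q)" by (cases e; cases "fst e") (auto simp: not_left_def)
  have "ev2 W ((e # E) @ [(R k, p)]) F = axact W e (ev2 W ((R k, p) # E) F)"
    using Cons by (simp del: axact.simps)
  also have "\<dots> = ev2 W ((R k, p) # e # E) F"
    unfolding e by (auto intro!: ext simp only: ev2.simps axact_commute)
  finally show ?case by simp
qed simp

lemma filter_eq_Cons_split:
  assumes "e # T = filter P E"
  obtains E1 E2 where "E = E1 @ e # E2" "\<forall>x\<in>set E1. \<not> P x" "P e" "T = filter P E2"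
  using assms that by (metis Cons_eq_filter_iff)

text \<open>Only events on opposite sides have to be exchanged. In \<open>E\<close> the head of
  \<open>D\<close> is preceded only by events of the other side, so it can be pulled to the front; a
  head on the axis is preceded by nothing.\<close>

lemma ev2_same_halves:
  "same_halves D E \<Longrightarrow> ev2 W D F = ev2 W E F"
proof (induction D arbitrary: E)
  case Nil
  have "E = []"
  proof (rule ccontr)
    assume "E \<noteq> []"
    then obtain e E' where "E = e # E'" by (cases E) auto
    then show False using Nil by (cases e; cases "fst e") (auto simp: same_halves_iff)
  qed
  then show ?case by simp
next
  case (Cons e D)
  obtain a p where e: "e = (a, p)" by (cases e)
  show ?case
  proof (cases a)
    case (L k)
    then obtain E1 E2 where E: "E = E1 @ e # E2" "\<forall>x\<in>set E1. \<not> not_right x" "filter not_right D = filter not_right E2"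
      using Cons.prems filter_eq_Cons_split[of e "filter not_right D" not_right E] by (auto simp: same_halves_iff e)
    have "filter not_right E1 = []" using E(2) by (simp add: filter_empty_conv)
    then have "same_halves D (E1 @ E2)" using Cons.prems E by (auto simp: same_halves_iff e L)
    then have "ev2 W (e # D) F = ev2 W (e # E1) (ev2 W E2 F)" using Cons.IH by simp
    also have "\<dots> = ev2 W (E1 @ [e]) (ev2 W E2 F)" unfolding e L by (simp only: ev2_pull_left[OF E(2)])
    finally show ?thesis by (simp add: E(1))
  next
    case (R k)
    then obtain E1 E2 where E: "E = E1 @ e # E2" "\<forall>x\<in>set E1. \<not> not_left x" "filter not_left D = filter not_left E2"
      using Cons.prems filter_eq_Cons_split[of e "filter not_left D" not_left E] by (auto simp: same_halves_iff e)
    have "filter not_left E1 = []" using E(2) by (simp add: filter_empty_conv)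
    then have "same_halves D (E1 @ E2)" using Cons.prems E by (auto simp: same_halves_iff e R)
    then have "ev2 W (e # D) F = ev2 W (e # E1) (ev2 W E2 F)" using Cons.IH by simp
    also have "\<dots> = ev2 W (E1 @ [e]) (ev2 W E2 F)" unfolding e R by (simp only: ev2_pull_right[OF E(2)])
    finally show ?thesis by (simp add: E(1))
  next
    case Axis
    obtain E1 E2 where E: "E = E1 @ e # E2" "\<forall>x\<in>set E1. \<not> not_left x" "filter not_left D = filter not_left E2"
      using Cons.prems filter_eq_Cons_split[of e "filter not_left D" not_left E] by (auto simp: same_halves_iff e Axis)
    have "E1 = []"
    proof (rule ccontr)
      assume "E1 \<noteq> []"
      then obtain x E1' where x: "E1 = x # E1'" by (cases E1) auto
      then have "not_right x" "x \<noteq> e" using E(2) by (cases x; cases "fst x"; auto simp: e Axis)+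
      then show False using Cons.prems E(1) x by (auto simp: same_halves_iff e Axis)
    qed
    then have "same_halves D E2" using Cons.prems E by (auto simp: same_halves_iff e Axis)
    then show ?thesis using Cons.IH E \<open>E1 = []\<close> by simp
  qed
qed

lemma mirror_mirror [simp]: "mirror (mirror p) = p"
  by (cases p) auto

text \<open>The symmetry of a symmetric diagram, event by event: on the axis the reflection and the
  switch both mirror the crossing and cancel.\<close>

definition conj_event :: "place \<times> piece \<Rightarrow> place \<times> piece" where
  "conj_event = (\<lambda>(a, p). (reflect_place a, if a = Axis then p else mirror p))"

lemma conj_event_simps [simp]: "conj_event (L k, p) = (R k, mirror p)" "conj_event (R k, p) = (L k, mirror p)"
  "conj_event (Axis, p) = (Axis, p)"
  by (auto simp: conj_event_def)

lemma switch_reflect: "switch_on_axis (reflect D) = map conj_event D"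
proof -
  have "(case (case e of (a, p) \<Rightarrow> (reflect_place a, mirror p)) of (a, p) \<Rightarrow> (a, if a = Axis then mirror p else p)) =
    conj_event e" for e
    by (cases e; cases "fst e") auto
  then show ?thesis by (simp add: switch_on_axis_def reflect_def comp_def)
qed

text \<open>Normal form of the symmetric diagram with left half \<open>T\<close>. An event stands
  next to its mirror image, so that pairs can be treated as single steps.\<close>

definition double :: "axis_diagram \<Rightarrow> axis_diagram" where
  "double T = concat (map (\<lambda>(a, p). if a = Axis then [(a, p)] else [(a, p), conj_event (a, p)]) T)"

lemma double_simps [simp]: "double [] = []"
  "double ((L k, p) # T) = (L k, p) # (R k, mirror p) # double T"
  "double ((Axis, p) # T) = (Axis, p) # double T"
  by (auto simp: double_def)

lemma same_halves_double:
  assumes "same_halves (switch_on_axis (reflect D)) D"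
  shows "same_halves D (double (filter not_right D))"
proof -
  have 1: "filter not_right (double (filter not_right D)) = filter not_right D" for D
  proof (induction D)
    case (Cons e D) then show ?case by (cases e; cases "fst e") auto
  qed simp
  have 2: "filter not_left (double (filter not_right D)) = map conj_event (filter not_right D)" for D
  proof (induction D)
    case (Cons e D) then show ?case by (cases e; cases "fst e") auto
  qed simp
  have 3: "filter not_left (map conj_event D) = map conj_event (filter not_right D)" for D
  proof (induction D)
    case (Cons e D) then show ?case by (cases e; cases "fst e") auto
  qed simp
  show ?thesis using assms 1 2 3 unfolding same_halves_iff switch_reflect by metis
qed

section \<open>Smoothing relations for diagrams with an axis\<close>

lemma wf2_smoothings:
  assumes "wf2 a b (S @ (q, p) # D) a' b'" "is_crossing p"
  shows "wf2 a b (S @ [(q, Cap), (q, Cup)] @ D) a' b'" "wf2 a b (S @ D) a' b'"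
proof -
  obtain c d where cd: "wf2 a b S c d" "valid_at (q, p) c d" "wf2 (left_after (q, p) c) (right_after (q, p) d) D a' b'"
    using assms(1) by (auto simp: wf2_append)
  have id: "left_after (q, p) c = c" "right_after (q, p) d = d"
    using assms(2) by (cases q; cases p; simp)+
  have ok: "valid_at (q, Cap) c d" "valid_at (q, Cup) (left_after (q, Cap) c) (right_after (q, Cap) d)"
    "left_after (q, Cup) (left_after (q, Cap) c) = c" "right_after (q, Cup) (right_after (q, Cap) d) = d"
    using cd(2) assms(2) by (cases q; cases p; auto)+
  show "wf2 a b (S @ [(q, Cap), (q, Cup)] @ D) a' b'" "wf2 a b (S @ D) a' b'"
    unfolding wf2_append using cd ok id by - (rule exI[of _ c], rule exI[of _ d], simp)+
qed

lemma act_hv_flip: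
  assumes "is_crossing p" "i + 2 \<le> length xs"
  shows "act (i, p, flip (hv a b h v)) \<phi> xs =
    h * act (i, Cap, flip (bw a b Cap)) (act (i, Cup, flip (bw a b Cup)) \<phi>) xs + v * \<phi> xs"
proof -
  obtain us x y vs where xs: "xs = us @ x # y # vs" "length us = i"
    using split_at2 assms(2) by metis
  show ?thesis using assms xs
    by (cases p; cases x; cases y) (auto simp: sum_bool hv_def flip_def algebra_simps)
qed

lemma axact_smoothing:
  assumes "is_crossing p" "valid_at (q, p) (length xs) (length ys)"
    and W: "W (q = Axis) p = hv a b h v" "W (q = Axis) Cup = bw a b Cup" "W (q = Axis) Cap = bw a b Cap"
  shows "axact W (q, p) F xs ys = h * axact W (q, Cap) (axact W (q, Cup) F) xs ys + v * F xs ys"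
proof (cases q)
  case (L k)
  have "k + 2 \<le> length xs" using assms by (cases p) (auto simp: L)
  then show ?thesis using act_hv_flip[OF assms(1)] W by (simp only: L axact.simps place.distinct simp_thms)
next
  case (R k)
  have eq: "axact W (R k, Cup) F xs = act (k, Cup, bw a b Cup) (F xs)"
    by (rule ext) (use W R in simp)
  have "k + 2 \<le> length ys" using assms by (cases p) (auto simp: R)
  from act_hv[OF assms(1) this refl] show ?thesis using W
    by (simp only: R axact.simps(2) place.distinct simp_thms eq tag_simps evf.simps)
next
  case Axis
  obtain x xs' y ys' where "xs = x # xs'" "ys = y # ys'"
    using assms(1,2) Axis by (cases xs; cases ys; cases p) auto
  then show ?thesis using W assms(1)
    by (cases p; cases x; cases y) (auto simp: Axis sum_bool hv_def algebra_simps)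
qed

lemma ev2_smoothing:
  assumes "wf2 (length xs) (length ys) (S @ (q, p) # D) a' b'" "is_crossing p"
    and W: "W (q = Axis) p = hv a b h v" "W (q = Axis) Cup = bw a b Cup" "W (q = Axis) Cap = bw a b Cap"
  shows "ev2 W (S @ (q, p) # D) F xs ys =
    h * ev2 W (S @ [(q, Cap), (q, Cup)] @ D) F xs ys + v * ev2 W (S @ D) F xs ys"
proof -
  obtain c d where cd: "wf2 (length xs) (length ys) S c d" "valid_at (q, p) c d"
    using assms(1) by (auto simp: wf2_append)
  have "ev2 W (S @ (q, p) # D) F xs ys = ev2 W S (\<lambda>xs ys. h * axact W (q, Cap) (axact W (q, Cup) (ev2 W D F)) xs ys
      + v * ev2 W D F xs ys) xs ys"
    unfolding ev2_append ev2.simps(2)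
    by (rule ev2_cong[OF cd(1)]) (use cd(2) assms in \<open>auto intro!: axact_smoothing\<close>)
  then show ?thesis by (simp add: ev2_linear)
qed

text \<open>
  The last two pairs are the coefficients of the horizontal and the vertical smoothing of a crossing
  \<open>Xo\<close> or \<open>Xu\<close> on the axis.
\<close>

definition axw :: "'r::comm_ring_1 \<Rightarrow> 'r \<Rightarrow> 'r \<times> 'r \<Rightarrow> 'r \<times> 'r \<Rightarrow> bool \<Rightarrow> piece \<Rightarrow> 'r weight" where
  "axw a b o' u' ax p = (if ax \<and> p = Xo then hv a b (fst o') (snd o')
     else if ax \<and> p = Xu then hv a b (fst u') (snd u') else bw a b p)"

lemma axw_uniform: "axw a b (a, b) (b, a) = (\<lambda>_. bw a b)"
  by (auto simp: axw_def bw_hv intro!: ext)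

lemma ev2_axw_crossingless:
  "crossingless S \<Longrightarrow> ev2 (axw a b x y) S F = ev2 (\<lambda>_. bw a b) S F"
proof (induction S)
  case (Cons e S)
  obtain q p where e: "e = (q, p)" by (cases e)
  have "axact (axw a b x y) e G = axact (\<lambda>_. bw a b) e G" for G
    using Cons.prems by (intro ext; cases q; cases p) (auto simp: e axw_def)
  then show ?case using Cons by (simp del: axact.simps)
qed simp

fun axis_turn :: "place \<times> piece \<Rightarrow> nat" where
  "axis_turn (Axis, p) = (if is_crossing p then 0 else 1)"
| "axis_turn _ = 0"

definition turns :: "axis_diagram \<Rightarrow> nat" where "turns D = (\<Sum>e\<leftarrow>D. axis_turn e)"

lemma turns_simps [simp]: "turns [] = 0" "turns (e # D) = axis_turn e + turns D"
  "turns (D @ E) = turns D + turns E"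
  by (auto simp: turns_def)

lemma card_traversals: "card (traversals D) = turns D"
proof (induction D rule: rev_induct)
  case (snoc e D)
  let ?n = "length D"
  have "traversals (D @ [e]) = traversals D \<union> (if fst e = Axis \<and> \<not> is_crossing (snd e) then {?n} else {})"
    by (auto simp: traversals_def nth_append less_Suc_eq)
  moreover have "finite (traversals D)" "?n \<notin> traversals D" by (auto simp: traversals_def)
  ultimately show ?case using snoc by (cases e; cases "fst e") auto
qed (auto simp: traversals_def)

lemma power_int_shift:
  assumes "a \<noteq> (0::'r::field)" "b \<noteq> 0"
  shows "b powi (int (Suc m) - 1) * a powi (- int (Suc m)) = b / a * (b powi (int m - 1) * a powi (- int m))"
proof -
  have b: "b powi int m = b * b powi (int m - 1)"
    using assms(2) by (simp add: power_int_diff)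
  have "- int (Suc m) = - int m + - 1" by simp
  then have "a powi (- int (Suc m)) = a powi (- int m + - 1)" by (simp only:)
  also have "\<dots> = a powi (- int m) / a"
    using assms(1) by (subst power_int_add) (auto simp: power_int_def divide_inverse)
  finally show ?thesis using b by simp
qed

text \<open>With d_A and d_B for the circle values, a state has value d_A^n (d_B / d_A)^m / d_B. A
  horizontal smoothing on the axis adds two traversals, so it raises m by one, and the factor d_B /
  d_A can be put into its coefficient; what remains is the bracket in A alone.\<close>

lemma axis_bracket_from_eq:
  assumes "wf2 0 0 (S @ D) 0 0" "crossingless S"
  defines "W \<equiv> axw var_A (inverse var_A) (var_B * (circle var_B / circle var_A), inverse var_B)
    (inverse var_B * (circle var_B / circle var_A), var_B)"
  shows "axis_bracket_from S D = circle var_B powi (int (turns (S @ D) div 2) - 1) *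
    circle var_A powi (- int (turns (S @ D) div 2)) * ev2 W (S @ D) eps2 [] []"
  using assms(1,2)
proof (induction S D rule: axis_bracket_from.induct)
  case (1 S)
  then have wf: "wf_axis_from 0 0 S" by (simp add: wf_axis_wf2)
  have "crossingless (forget_from a S)" if "crossingless S" for a
    using that by (induction a S rule: forget_from.induct) (auto simp: crossingless_def)
  then have c: "crossingless (forget_axis S)" using 1 by (simp add: forget_axis_def)
  have "ev2 W S eps2 [] [] = bracket var_A (forget_axis S)"
    unfolding W_def by (simp only: ev2_axw_crossingless[OF 1(2)] ev2_uniform[OF wf])
  also have "\<dots> = circle var_A ^ card (components (forget_axis S))"
    using ev_crossingless[OF c wf_forget_axis[OF wf] zigzag_bw(1)[of var_A "inverse var_A"]] by simp
  finally have e: "ev2 W S eps2 [] [] = circle var_A powi int (card (components (forget_axis S)))" by simp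
  have "circle var_A powi (int n - int m) = circle var_A powi (- int m) * circle var_A powi int n" for n m
    by (subst power_int_add[symmetric]) (use circle_nonzero(1) in simp_all)
  then show ?case by (simp add: e card_traversals circle_value_eq Let_def)
next
  case (2 S q p D)
  show ?case
  proof (cases "is_crossing p")
    case False
    then have "axis_bracket_from S ((q, p) # D) = axis_bracket_from (S @ [(q, p)]) D" by (cases p) auto
    then show ?thesis using False 2 by (cases p) auto
  next
    case True
    define c where "c = (if q = Axis then var_B else var_A)"
    define P where "P = circle var_B powi (int (turns (S @ (q, p) # D) div 2) - 1) *
      circle var_A powi (- int (turns (S @ (q, p) # D) div 2))"
    define X Y where "X = ev2 W (S @ [(q, Cap), (q, Cup)] @ D) eps2 [] []" and "Y = ev2 W (S @ D) eps2 [] []"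
    define f where "f = (if q = Axis then circle var_B / circle var_A else 1)"
    have h: "axis_bracket_from (S @ [(q, Cap), (q, Cup)]) D = f * P * X"
    proof -
      have "axis_bracket_from (S @ [(q, Cap), (q, Cup)]) D = circle var_B powi (int (turns ((S @ [(q, Cap), (q, Cup)]) @ D) div 2) - 1) *
        circle var_A powi (- int (turns ((S @ [(q, Cap), (q, Cup)]) @ D) div 2)) * X"
        unfolding X_def using 2 True wf2_smoothings[OF 2(5) True] by simp
      moreover have "turns ((S @ [(q, Cap), (q, Cup)]) @ D) div 2 = (if q = Axis then Suc (turns (S @ (q, p) # D) div 2) else turns (S @ (q, p) # D) div 2)"
        using True by (cases q) auto
      moreover have "circle var_B powi (int (Suc m) - 1) * circle var_A powi (- int (Suc m)) =
          circle var_B / circle var_A * (circle var_B powi (int m - 1) * circle var_A powi (- int m))" for m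
        using power_int_shift[OF circle_nonzero] .
      ultimately show ?thesis by (simp only: f_def P_def if_True if_False mult_1 split: if_split) simp
    qed
    have v: "axis_bracket_from S D = P * Y"
      unfolding Y_def P_def using 2 True wf2_smoothings[OF 2(5) True] by (cases q) auto
    have eq: "axis_bracket_from S ((q, p) # D) =
        hcoeff c (inverse c) p * (f * P * X) + hcoeff (inverse c) c p * (P * Y)"
      using True unfolding h[symmetric] v[symmetric] c_def by (cases p) (simp_all add: Let_def)
    have "W (q = Axis) p = hv var_A (inverse var_A) (f * hcoeff c (inverse c) p) (hcoeff (inverse c) c p)"
      using True by (cases q; cases p) (auto simp: W_def axw_def f_def c_def bw_hv mult.commute intro!: ext)
    moreover have "W (q = Axis) Cup = bw var_A (inverse var_A) Cup" "W (q = Axis) Cap = bw var_A (inverse var_A) Cap"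
      by (auto simp: W_def axw_def)
    ultimately have "ev2 W (S @ (q, p) # D) eps2 [] [] = f * hcoeff c (inverse c) p * X + hcoeff (inverse c) c p * Y"
      unfolding X_def Y_def using 2(5) True by (intro ev2_smoothing) auto
    then show ?thesis unfolding eq P_def[symmetric] by (simp add: algebra_simps)
  qed
qed

lemma act_scale_weight:
  assumes "\<And>x y c d. w' x y c d = k * w x y c d" shows "act (i, p, w') \<phi> xs = k * act (i, p, w) \<phi> xs"
  by (cases p) (simp_all add: assms sum_bool algebra_simps)

lemma ev2_scale_weight:
  assumes "\<And>ax p x y c d. W' ax p x y c d = \<kappa> ax p * W ax p x y c d"
  shows "ev2 W' D F xs ys = (\<Prod>e\<leftarrow>D. \<kappa> (fst e = Axis) (snd e)) * ev2 W D F xs ys"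
proof (induction D arbitrary: xs ys)
  case (Cons e D)
  obtain q p where e: "e = (q, p)" by (cases e)
  have "axact W' e G xs ys = \<kappa> (q = Axis) p * axact W e G xs ys" for G
  proof (cases q)
    case (L k)
    then show ?thesis
      by (simp add: e) (rule act_scale_weight, simp add: flip_def assms)
  next
    case (R k)
    then show ?thesis
      by (simp add: e) (rule act_scale_weight, simp add: assms)
  next
    case Axis
    then show ?thesis by (cases p) (simp_all add: e assms sum_bool algebra_simps)
  qed
  moreover have "ev2 W' D F = (\<lambda>xs ys. (\<Prod>e\<leftarrow>D. \<kappa> (fst e = Axis) (snd e)) * ev2 W D F xs ys + 0 * ev2 W D F xs ys)"
    by (intro ext) (simp add: Cons.IH)
  ultimately show ?case by (simp add: axact_linear e del: axact.simps mult_zero_left add_0_right)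
qed simp

text \<open>The sign of an axis crossing when one strand runs upwards and the other downwards. For a
  knot with a symmetric diagram that has a traversal this is the actual sign.\<close>

fun axis_sign :: "place \<times> piece \<Rightarrow> int" where
  "axis_sign (Axis, Xo) = 1" | "axis_sign (Axis, Xu) = - 1" | "axis_sign _ = 0"

definition axis_signs :: "axis_diagram \<Rightarrow> int" where "axis_signs D = (\<Sum>e\<leftarrow>D. axis_sign e)"

text \<open>
  All dependence on \<open>B\<close> is moved into the coefficients \<open>- 1 - B\<^sup>4\<close> and \<open>- 1 - 1 / B\<^sup>4\<close> of the horizontal
  smoothings, divided by the circle value of \<open>A\<close>; the vertical ones get coefficient 1.
\<close>

definition reduced :: "'r::field \<Rightarrow> 'r \<times> 'r \<Rightarrow> axis_diagram \<Rightarrow> 'r" where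
  "reduced a c D = ev2 (axw a (inverse a) (fst c / circle a, 1) (snd c / circle a, 1)) D eps2 [] []"

lemma ev2_reduced:
  assumes "b \<noteq> (0::'r::field)" and "\<And>P. P = circle b / circle a \<Longrightarrow> W = axw a (inverse a) (b * P, inverse b) (inverse b * P, b)"
  shows "ev2 W D eps2 [] [] = b powi (- axis_signs D) * reduced a (- 1 - b powi 4, - 1 - b powi (- 4)) D"
proof -
  define \<kappa> where "\<kappa> = (\<lambda>ax p. if ax \<and> p = Xo then inverse b else if ax \<and> p = Xu then b else 1)"
  \<comment> \<open>After one power of \<open>b\<close> is pulled out of each axis crossing, the
    coefficients contain only fourth powers of \<open>b\<close>, hence only s.\<close>
  have c: "b * circle b = inverse b * (- 1 - b powi 4)" "inverse b * circle b = b * (- 1 - b powi (- 4))"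
    using assms(1) by (simp_all add: power_int_def field_simps power2_eq_square eval_nat_numeral)
  have "W ax p x y d e = \<kappa> ax p * axw a (inverse a) ((- 1 - b powi 4) / circle a, 1) ((- 1 - b powi (- 4)) / circle a, 1) ax p x y d e" for ax p x y d e
    unfolding assms(2)[OF refl] axw_def \<kappa>_def fst_conv snd_conv hv_def times_divide_eq_right c
    by (simp add: algebra_simps)
  then have "ev2 W D eps2 [] [] = (\<Prod>e\<leftarrow>D. \<kappa> (fst e = Axis) (snd e)) * reduced a (- 1 - b powi 4, - 1 - b powi (- 4)) D"
    unfolding reduced_def fst_conv snd_conv by (rule ev2_scale_weight)
  also have "(\<Prod>e\<leftarrow>D. \<kappa> (fst e = Axis) (snd e)) = b powi (- axis_signs D)"
  proof (induction D)
    case (Cons e D)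
    have "\<kappa> (fst e = Axis) (snd e) = b powi (- axis_sign e)"
      by (cases e rule: axis_sign.cases) (auto simp: \<kappa>_def power_int_minus)
    then show ?case using Cons assms(1) by (simp add: axis_signs_def power_int_add[symmetric])
  qed (simp add: axis_signs_def)
  finally show ?thesis .
qed

subsection \<open>Signs off and on the axis\<close>

definition axow :: "'r::field \<Rightarrow> 'r \<Rightarrow> bool \<Rightarrow> piece \<Rightarrow> 'r weight" where
  "axow q r ax p = (if ax then ow r (inverse r) p else ow q (inverse q) p)"

lemma flip_ow: "flip (ow q r p) = ow q r p"
  by (cases p) (auto simp: flip_def intro!: ext)

text \<open>The orientation sum of \<open>ev_writhe\<close> with separate variables for the
  crossings off and on the axis.\<close>

lemma ev2_alpha_beta:
  assumes K: "knot_diagram (forget_axis D)" and wf: "wf_axis_from 0 0 D" and "q \<noteq> 0" "r \<noteq> (0::'r::field)"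
  shows "ev2 (axow q r) D eps2 [] [] = 2 * (q powi alpha D * r powi beta D)"
proof -
  let ?F = "forget_axis D" and ?E = "axis_tag (axow q r) 0 D"
  let ?up = "chosen_orientation ?F"
  note L = knot_link[OF K]
  have len: "length ?F = length D" by (simp add: forget_axis_def)
  have ev: "ev2 (axow q r) D eps2 [] [] = evf ?E eps []"
    using ev2_evf[of "[]" "[]" D] wf by (simp add: wf_axis_wf2)
  have pw: "permw p (ow a b p)" for a b :: 'r and p by (cases p) auto
  have E: "\<exists>c. e = (i, p, ow c (inverse c) p)" if "(i, p, w) = e" "e \<in> set ?E" for e i p w
    using that by (auto simp: axis_tag_def axow_def split: prod.splits if_splits)
  have "perm_events ?E" unfolding perm_events_def using E pw by fastforce
  moreover have "\<forall>(i, p, w)\<in>set ?E. symw w" using E symw_ow by fastforce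
  ultimately have "evf ?E eps [] = 2 * (\<Prod>l<length D. locw (?E ! l) (level ?F ?up l) (level ?F ?up (Suc l)))"
    using knot_evf[OF K, of ?E] by (simp add: untag_axis_tag len flip: forget_axis_def)
  also have "(\<Prod>l<length D. locw (?E ! l) (level ?F ?up l) (level ?F ?up (Suc l))) =
      (\<Prod>l<length D. if fst (D ! l) = Axis then r powi crossing_sign ?F ?up l else q powi crossing_sign ?F ?up l)"
  proof (intro prod.cong refl)
    fix l assume l: "l \<in> {..<length D}"
    obtain i p where ip: "?F ! l = (i, p)" by (cases "?F ! l")
    have "?E ! l = (i, p, axow q r (fst (D ! l) = Axis) p)"
      using l ip len by (simp add: axis_tag_def forget_axis_def)
    then show "locw (?E ! l) (level ?F ?up l) (level ?F ?up (Suc l)) =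
      (if fst (D ! l) = Axis then r powi crossing_sign ?F ?up l else q powi crossing_sign ?F ?up l)"
      using locw_ow[OF L chosen_orientation[OF L] _ ip assms(3)] locw_ow[OF L chosen_orientation[OF L] _ ip assms(4)] l len
      by (simp add: axow_def)
  qed
  also have "\<dots> = (\<Prod>l\<in>{..<length D} \<inter> {l. fst (D ! l) = Axis}. r powi crossing_sign ?F ?up l) *
      (\<Prod>l\<in>{..<length D} \<inter> - {l. fst (D ! l) = Axis}. q powi crossing_sign ?F ?up l)"
    by (rule prod.If_cases) simp
  also have "{..<length D} \<inter> {l. fst (D ! l) = Axis} = {l. l < length D \<and> fst (D ! l) = Axis}" by auto
  also have "{..<length D} \<inter> - {l. fst (D ! l) = Axis} = {l. l < length D \<and> fst (D ! l) \<noteq> Axis}" by auto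
  finally show ?thesis using assms(3,4) by (simp add: ev power_int_sum alpha_def beta_def mult.commute)
qed

lemma writhe_alpha_beta: "writhe (forget_axis D) = alpha D + beta D"
proof -
  have "length (forget_axis D) = length D" by (simp add: forget_axis_def)
  moreover have "{..<length D} = {l. l < length D \<and> fst (D ! l) \<noteq> Axis} \<union> {l. l < length D \<and> fst (D ! l) = Axis}"
    by auto
  ultimately show ?thesis unfolding writhe_def alpha_def beta_def
    by (simp only:) (rule sum.union_disjoint; auto)
qed

lemma act_mirror: "act (k, mirror p, w) \<phi> xs = act (k, p, w) \<phi> xs"
  by (cases p) auto

lemma ev2_conj:
  assumes "\<And>p. W False (mirror p) = flip (W' False p)" "\<And>p. W True p = flip (W' True p)"
  shows "ev2 W (map conj_event D) F xs ys = ev2 W' D (\<lambda>xs ys. F ys xs) ys xs"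
proof (induction D arbitrary: xs ys)
  case (Cons e D)
  obtain q p where e: "e = (q, p)" by (cases e)
  have ff: "flip (flip w) = w" for w :: "'a weight" by (intro ext) (simp add: flip_def)
  have "axact W (conj_event e) G xs ys = axact W' e (\<lambda>xs ys. G ys xs) ys xs" for G
  proof (cases q)
    case (L k)
    then show ?thesis by (simp add: e act_mirror assms)
  next
    case (R k)
    then show ?thesis by (simp add: e act_mirror assms ff)
  next
    case Axis
    then show ?thesis by (cases p) (simp_all add: e assms flip_def sum_bool algebra_simps)
  qed
  then have "ev2 W (map conj_event (e # D)) F xs ys = axact W' e (\<lambda>xs ys. ev2 W (map conj_event D) F ys xs) ys xs"
    by simp
  also have "(\<lambda>xs ys. ev2 W (map conj_event D) F ys xs) = ev2 W' D (\<lambda>xs ys. F ys xs)"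
    by (intro ext) (rule Cons.IH)
  finally show ?case by simp
qed simp

lemma two_powi_inject: assumes "(2::rat) powi m = 2 powi n" shows "m = n"
proof -
  have less: "(2::rat) powi m < 2 powi n" if "m < n" for m n :: int
  proof -
    have "(2::rat) powi n = 2 powi m * 2 ^ nat (n - m)"
      using power_int_add[of "2::rat" m "n - m"] that by (simp add: power_int_def)
    moreover have "(1::rat) < 2 ^ nat (n - m)" using that by (intro one_less_power) auto
    moreover have "(0::rat) < 2 powi m" by simp
    ultimately show ?thesis by simp
  qed
  show ?thesis using less[of m n] less[of n m] assms by (cases m n rule: linorder_cases) auto
qed

text \<open>The reflection inverts \<open>q\<close> in the orientation sum while the axis, with
  weight 1, is left alone. So the powers q^alpha and q^-alpha agree, and q = 2 forces the exponent
  to vanish.\<close>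

lemma symmetric_alpha:
  assumes K: "knot_diagram (forget_axis D)" and "symmetric D"
  shows "alpha D = 0"
proof -
  have wf: "wf_axis_from 0 0 D" and sh: "same_halves (map conj_event D) D"
    using assms(2) by (auto simp: symmetric_def switch_reflect)
  have key: "q powi (alpha D + alpha D) = 1" if q: "q \<noteq> 0" for q :: rat
  proof -
    have "2 * (q powi alpha D * 1 powi beta D) = ev2 (axow q 1) D eps2 [] []"
      by (rule ev2_alpha_beta[symmetric, OF K wf]) (use q in auto)
    also have "\<dots> = ev2 (axow q 1) (map conj_event D) eps2 [] []"
      by (simp only: ev2_same_halves[OF sh])
    also have "\<dots> = ev2 (axow (inverse q) 1) D (\<lambda>xs ys. eps2 ys xs) [] []"
    proof (rule ev2_conj)
      have m: "ow q (inverse q) (mirror p) = ow (inverse q) (inverse (inverse q)) p" for p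
        by (cases p) (auto intro!: ext)
      show "axow q 1 False (mirror p) = flip (axow (inverse q) 1 False p)" for p
        by (simp only: axow_def flip_ow if_False m)
      show "axow q 1 True p = flip (axow (inverse q) 1 True p)" for p
        by (simp add: axow_def flip_ow)
    qed
    also have "(\<lambda>xs ys. eps2 ys xs) = (eps2 :: bool list \<Rightarrow> bool list \<Rightarrow> rat)"
      by (intro ext) (auto simp: eps2_def)
    also have "ev2 (axow (inverse q) 1) D eps2 [] [] = 2 * (inverse q powi alpha D * 1 powi beta D)"
      by (rule ev2_alpha_beta[OF K wf]) (use q in auto)
    finally have "q powi alpha D = inverse (q powi alpha D)" by (simp add: power_int_inverse)
    then have "q powi alpha D * q powi alpha D = 1" using q by (metis power_int_eq_0_iff right_inverse)
    then show ?thesis by (subst power_int_add) (use q in simp_all)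
  qed
  from key[of 2] have "(2::rat) powi (alpha D + alpha D) = 2 powi 0" by simp
  from two_powi_inject[OF this] show ?thesis by simp
qed

section \<open>Orientations of symmetric diagrams and signs on the axis\<close>

fun half_succs :: "place \<times> piece \<Rightarrow> bool list \<times> bool list \<Rightarrow> (bool list \<times> bool list) set" where
  "half_succs (L k, p) (xs, ys) = succs (k, p) xs \<times> succs (k, mirror p) ys"
| "half_succs (R k, p) (xs, ys) = {}"
| "half_succs (Axis, Cup) (xs, ys) = {(True # xs, False # ys), (False # xs, True # ys)}"
| "half_succs (Axis, Cap) (xs, ys) = (if hd xs \<noteq> hd ys then {(tl xs, tl ys)} else {})"
| "half_succs (Axis, _) (xs, ys) = {(hd ys # tl xs, hd xs # tl ys)}"

fun half_weight :: "'r::field \<Rightarrow> place \<times> piece \<Rightarrow> bool list \<times> bool list \<Rightarrow> bool list \<times> bool list \<Rightarrow> 'r" where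
  "half_weight r (Axis, Xo) (xs, ys) _ = (if hd xs = hd ys then inverse r else r)"
| "half_weight r (Axis, Xu) (xs, ys) _ = (if hd xs = hd ys then r else inverse r)"
| "half_weight r _ _ _ = 1"

fun wf_half :: "nat \<Rightarrow> axis_diagram \<Rightarrow> bool" where
  "wf_half a [] \<longleftrightarrow> a = 0"
| "wf_half a (e # T) \<longleftrightarrow> not_right e \<and> valid_at e a a \<and> wf_half (left_after e a) T"

lemma wf_half_left: "wf2 a b D 0 0 \<Longrightarrow> wf_half a (filter not_right D)"
proof (induction D arbitrary: a b)
  case (Cons e D)
  then show ?case by (cases e; cases "fst e") (fastforce simp del: strands_after.simps)+
qed simp

lemma finite_half_succs [simp]: "finite (half_succs e s)"
  by (cases "(e, s)" rule: half_succs.cases) auto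

lemma act_ow1:
  assumes "if p = Cup then i \<le> length xs else i + 2 \<le> length xs"
  shows "act (i, p, ow 1 1 p) \<phi> xs = (\<Sum>ys\<in>succs (i, p) xs. \<phi> ys)"
proof -
  have "permw p (ow 1 1 p)" by (cases p) auto
  then have "act (i, p, ow 1 1 p) \<phi> xs = (\<Sum>ys\<in>succs (i, p) xs. locw (i, p, ow 1 1 p) xs ys * \<phi> ys)"
    by (rule act_succs[OF _ assms])
  also have "\<dots> = (\<Sum>ys\<in>succs (i, p) xs. \<phi> ys)"
    by (rule sum.cong[OF refl]) (simp only: locw_ow1[OF _ assms] mult_1)
  finally show ?thesis .
qed

lemma half_succs_length:
  assumes "not_right e" "valid_at e (length xs) (length ys)" "length ys = length xs" "s \<in> half_succs e (xs, ys)"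
  shows "length (fst s) = left_after e (length xs)" "length (snd s) = left_after e (length xs)"
proof -
  obtain q p where e: "e = (q, p)" by (cases e)
  have "length (fst s) = left_after e (length xs) \<and> length (snd s) = left_after e (length xs)"
  proof (cases q)
    case (L k)
    have ok: "if p = Cup then k \<le> length xs else k + 2 \<le> length xs" using assms(2) by (simp add: e L)
    have "mirror p = Cup \<longleftrightarrow> p = Cup" by (cases p) auto
    then have ok': "if mirror p = Cup then k \<le> length ys else k + 2 \<le> length ys" using ok assms(3) by (cases "p = Cup") auto
    have "strands_after (mirror p) n = strands_after p n" for n by (cases p) auto
    then show ?thesis
      using assms(3,4) succs_length[OF ok, of "fst s"] succs_length[OF ok', of "snd s"] by (auto simp: e L)
  next
    case Axis
    then show ?thesis using assms by (cases p; cases xs; cases ys) (auto simp: e split: if_splits)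
  qed (use assms in \<open>auto simp: e\<close>)
  then show "length (fst s) = left_after e (length xs)" "length (snd s) = left_after e (length xs)" by auto
qed

lemma axact_half:
  assumes e: "not_right e" "valid_at e (length xs) (length ys)" "length ys = length xs"
  shows "ev2 (axow 1 r) (double [e]) G xs ys = (\<Sum>s\<in>half_succs e (xs, ys). half_weight r e (xs, ys) s * G (fst s) (snd s))"
proof -
  obtain q p where qp: "e = (q, p)" by (cases e)
  show ?thesis
  proof (cases q)
    case (L k)
    have ok: "if p = Cup then k \<le> length xs else k + 2 \<le> length xs" using assms(2) by (simp add: qp L)
    have "mirror p = Cup \<longleftrightarrow> p = Cup" by (cases p) auto
    then have ok': "if mirror p = Cup then k \<le> length ys else k + 2 \<le> length ys" using ok assms(3) by (cases "p = Cup") auto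
    have w: "flip (axow 1 r False p) = ow 1 1 p" "axow 1 r False (mirror p) = ow 1 1 (mirror p)"
      by (simp_all add: axow_def flip_ow)
    have "ev2 (axow 1 r) (double [e]) G xs ys = (\<Sum>xs'\<in>succs (k, p) xs. \<Sum>ys'\<in>succs (k, mirror p) ys. G xs' ys')"
      by (simp only: qp L double_simps ev2.simps axact.simps w act_ow1[OF ok] act_ow1[OF ok'])
    then show ?thesis by (simp add: qp L sum.cartesian_product case_prod_unfold del: succs.simps)
  next
    case Axis
    then show ?thesis using assms
      by (cases p; cases xs; cases ys) (auto simp: qp axow_def sum_bool split: if_splits)
  qed (use assms in \<open>auto simp: qp\<close>)
qed

definition half_runs :: "axis_diagram \<Rightarrow> bool list \<times> bool list \<Rightarrow> (bool list \<times> bool list) list set" where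
  "half_runs T s = paths (map half_succs T) s"

lemma finite_half_runs [simp]: "finite (half_runs T s)"
  unfolding half_runs_def by (rule finite_paths) auto

lemma ev2_half_runs:
  assumes "wf_half (length xs) T" "length ys = length xs"
  shows "ev2 (axow 1 r) (double T) eps2 xs ys = (\<Sum>b\<in>half_runs T (xs, ys). weight (map (half_weight r) T) (xs, ys) b)"
  using assms
proof (induction T arbitrary: xs ys)
  case Nil
  then show ?case by (simp add: eps2_def half_runs_def)
next
  case (Cons e T)
  have e: "not_right e" "valid_at e (length xs) (length ys)" "length ys = length xs"
    using Cons.prems by auto
  have "double (e # T) = double [e] @ double T" by (simp add: double_def)
  then have "ev2 (axow 1 r) (double (e # T)) eps2 xs ys =
      (\<Sum>s\<in>half_succs e (xs, ys). half_weight r e (xs, ys) s * ev2 (axow 1 r) (double T) eps2 (fst s) (snd s))"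
    using axact_half[OF e] by (simp only: ev2_append)
  also have "\<dots> = (\<Sum>s\<in>half_succs e (xs, ys). \<Sum>b\<in>half_runs T s. weight (map (half_weight r) (e # T)) (xs, ys) (s # b))"
  proof (intro sum.cong refl)
    fix s assume s: "s \<in> half_succs e (xs, ys)"
    have "ev2 (axow 1 r) (double T) eps2 (fst s) (snd s) = (\<Sum>b\<in>half_runs T (fst s, snd s). weight (map (half_weight r) T) (fst s, snd s) b)"
      using Cons.prems half_succs_length[OF e s] by (intro Cons.IH) auto
    then show "half_weight r e (xs, ys) s * ev2 (axow 1 r) (double T) eps2 (fst s) (snd s) =
       (\<Sum>b\<in>half_runs T s. weight (map (half_weight r) (e # T)) (xs, ys) (s # b))"
      by (simp add: sum_distrib_left)
  qed
  also have "\<dots> = (\<Sum>b\<in>half_runs (e # T) (xs, ys). weight (map (half_weight r) (e # T)) (xs, ys) b)"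
    unfolding half_runs_def
    by (simp add: sum_paths_Cons[OF finite_half_succs finite_half_runs[unfolded half_runs_def]] del: paths.simps half_succs.simps)
  finally show ?case .
qed

lemma succs_Not:
  assumes "if p = Cup then i \<le> length xs else i + 2 \<le> length xs" "ys \<in> succs (i, p) xs"
  shows "map Not ys \<in> succs (i, p) (map Not xs)"
proof (cases "p = Cup")
  case True
  then obtain us vs where "xs = us @ vs" "length us = i" using split_at assms(1) by metis
  then show ?thesis using assms(2) True list_simps(1)[of "map Not us" _ _ "map Not vs"] by auto
next
  case False
  then obtain us x y vs where xs: "xs = us @ x # y # vs" "length us = i"
    using split_at2 assms(1) by metis
  then show ?thesis using assms(2) False
      list_simps(4)[of "map Not us" "\<not> x" "\<not> y" "map Not vs"] list_simps(6)[of "map Not us" "\<not> x"]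
      list_simps(7)[of "map Not us" "\<not> x" "\<not> y" "map Not vs"] list_simps(1)[of "map Not us" _ _ "map Not vs"]
    by (cases p) (auto split: if_splits)
qed

lemma succs_mirror: "succs (i, mirror p) xs = succs (i, p) xs"
  by (cases p) auto

text \<open>
  Reflecting and reversing an orientation of a symmetric union maps it to an orientation.  A knot has
  only two of them, so these are fixed, and on the axis opposite labels meet.
\<close>

definition swap_neg :: "bool list \<times> bool list \<Rightarrow> bool list \<times> bool list" where
  "swap_neg s = (map Not (snd s), map Not (fst s))"

definition both_neg :: "bool list \<times> bool list \<Rightarrow> bool list \<times> bool list" where
  "both_neg s = (map Not (fst s), map Not (snd s))"

lemma half_runs_neg:
  assumes "wf_half (length xs) T" "length ys = length xs" "b \<in> half_runs T (xs, ys)"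
  shows "map swap_neg b \<in> half_runs T (swap_neg (xs, ys))" "map both_neg b \<in> half_runs T (both_neg (xs, ys))"
proof -
  have "map swap_neg b \<in> half_runs T (swap_neg (xs, ys)) \<and> map both_neg b \<in> half_runs T (both_neg (xs, ys))"
    using assms
  proof (induction T arbitrary: xs ys b)
    case Nil
    then show ?case by (simp add: half_runs_def)
  next
    case (Cons e T)
    have e: "not_right e" "valid_at e (length xs) (length ys)" "length ys = length xs"
      using Cons.prems by auto
    obtain s b' where b: "b = s # b'" "s \<in> half_succs e (xs, ys)" "b' \<in> half_runs T s"
      using Cons.prems(3) by (auto simp: half_runs_def)
    have IH: "map swap_neg b' \<in> half_runs T (swap_neg s) \<and> map both_neg b' \<in> half_runs T (both_neg s)"
      using Cons.IH[of "fst s" "snd s" b'] b Cons.prems half_succs_length[OF e b(2)] by simp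
    obtain q p where qp: "e = (q, p)" by (cases e)
    have "swap_neg s \<in> half_succs e (swap_neg (xs, ys)) \<and> both_neg s \<in> half_succs e (both_neg (xs, ys))"
    proof (cases q)
      case (L k)
      have ok: "if p = Cup then k \<le> length xs else k + 2 \<le> length xs" using e by (simp add: qp L)
      have ok': "if p = Cup then k \<le> length ys else k + 2 \<le> length ys" using ok e by (cases "p = Cup") auto
      show ?thesis using b(2) succs_Not[OF ok] succs_Not[OF ok']
        by (auto simp: qp L swap_neg_def both_neg_def succs_mirror simp del: succs.simps)
    next
      case Axis
      then show ?thesis using e b(2)
        by (cases p; cases xs; cases ys) (auto simp: qp swap_neg_def both_neg_def split: if_splits)
    qed (use e in \<open>auto simp: qp\<close>)
    then show ?case using IH b(1) by (auto simp: half_runs_def)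
  qed
  then show "map swap_neg b \<in> half_runs T (swap_neg (xs, ys))" "map both_neg b \<in> half_runs T (both_neg (xs, ys))"
    by auto
qed

text \<open>At an extremum on the axis the two innermost labels are opposite, so labels that agree
  on both sides leave no room for a traversal.\<close>

lemma half_run_equal:
  assumes "wf_half (length xs) T" "length ys = length xs" "b \<in> half_runs T (xs, ys)"
    and "\<forall>s\<in>set ((xs, ys) # b). fst s = snd s"
  shows "turns T = 0"
  using assms
proof (induction T arbitrary: xs ys b)
  case (Cons e T)
  have e: "not_right e" "valid_at e (length xs) (length ys)" "length ys = length xs"
    using Cons.prems(1,2) by auto
  obtain s b' where b: "b = s # b'" "s \<in> half_succs e (xs, ys)" "b' \<in> half_runs T s"
    using Cons.prems(3) by (auto simp: half_runs_def)
  obtain x y where s: "s = (x, y)" by (cases s)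
  have "turns T = 0"
  proof (rule Cons.IH)
    show "wf_half (length x) T" "length y = length x" using half_succs_length[OF e b(2)] Cons.prems(1) by (auto simp: s)
    show "b' \<in> half_runs T (x, y)" using b(3) by (simp add: s)
    show "\<forall>s\<in>set ((x, y) # b'). fst s = snd s" using Cons.prems(4) b(1) by (simp add: s)
  qed
  moreover have "axis_turn e = 0"
  proof (rule ccontr)
    assume "axis_turn e \<noteq> 0"
    moreover obtain q p where "e = (q, p)" by (cases e)
    ultimately have "e = (Axis, Cup) \<or> e = (Axis, Cap)" by (cases q; cases p) auto
    moreover have "xs = ys" "x = y" using Cons.prems(4) b(1) by (auto simp: s)
    ultimately show False using b(2) by (auto simp: s)
  qed
  ultimately show ?case by simp
qed simp

text \<open>With opposite labels the strands at every axis crossing run in opposite vertical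
  directions, and then the crossing type determines the sign.\<close>

lemma half_run_opposite:
  assumes "wf_half (length xs) T" "length ys = length xs" "b \<in> half_runs T (xs, ys)"
    and "\<forall>s\<in>set ((xs, ys) # b). snd s = map Not (fst s)" "r \<noteq> (0::'r::field)"
  shows "weight (map (half_weight r) T) (xs, ys) b = r powi axis_signs T"
  using assms(1-4)
proof (induction T arbitrary: xs ys b)
  case Nil
  then show ?case by (simp add: axis_signs_def)
next
  case (Cons e T)
  have e: "not_right e" "valid_at e (length xs) (length ys)" "length ys = length xs"
    using Cons.prems(1,2) by auto
  obtain s b' where b: "b = s # b'" "s \<in> half_succs e (xs, ys)" "b' \<in> half_runs T s"
    using Cons.prems(3) by (auto simp: half_runs_def)
  obtain x y where s: "s = (x, y)" by (cases s)
  have IH: "weight (map (half_weight r) T) s b' = r powi axis_signs T"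
    unfolding s
  proof (rule Cons.IH)
    show "wf_half (length x) T" "length y = length x" using half_succs_length[OF e b(2)] Cons.prems(1) by (auto simp: s)
    show "b' \<in> half_runs T (x, y)" using b(3) by (simp add: s)
    show "\<forall>s\<in>set ((x, y) # b'). snd s = map Not (fst s)" using Cons.prems(4) b(1) by (simp add: s)
  qed
  obtain q p where qp: "e = (q, p)" by (cases e)
  have "half_weight r e (xs, ys) s = r powi axis_sign e"
  proof (cases "q = Axis \<and> is_crossing p")
    case True
    then obtain x xs' where "xs = x # xs'" using e by (cases xs; cases p) (auto simp: qp)
    then have "hd ys \<noteq> hd xs" using Cons.prems(4) by simp
    then show ?thesis using True by (cases p) (auto simp: qp power_int_def)
  next
    case False
    then show ?thesis by (cases q; cases p) (auto simp: qp)
  qed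
  then show ?case using IH b assms(5) by (simp add: axis_signs_def power_int_add)
qed

lemma axis_sums_left: "turns (filter not_right D) = turns D" "axis_signs (filter not_right D) = axis_signs D"
proof (induction D)
  case (Cons e D)
  { case 1 then show ?case using Cons by (cases e; cases "fst e") auto }
  { case 2 then show ?case using Cons by (cases e; cases "fst e") (auto simp: axis_signs_def) }
qed (auto simp: axis_signs_def)

lemma map_fixed: "b = map f b \<Longrightarrow> s \<in> set b \<Longrightarrow> s = f s"
proof (induction b)
  case (Cons a b)
  from Cons.prems(1) have "a = f a" "b = map f b" by (metis list.inject list.simps(9))+
  then show ?case using Cons.IH Cons.prems(2) by (metis set_ConsD)
qed simp

lemma both_neg_fixed: assumes "s = both_neg s" shows "fst s = snd s"
proof -
  have nil: "xs = []" if eq: "xs = map Not xs" for xs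
  proof (cases xs)
    case (Cons x xs')
    show ?thesis using eq unfolding Cons by simp
  qed
  from arg_cong[OF assms, of fst] arg_cong[OF assms, of snd]
  have "fst s = map Not (fst s)" "snd s = map Not (snd s)"
    unfolding both_neg_def fst_conv snd_conv .
  from nil[OF this(1)] nil[OF this(2)] have "fst s = []" "snd s = []" .
  then show ?thesis by simp
qed

lemma symmetric_beta:
  assumes K: "knot_diagram (forget_axis D)" and "symmetric D" and t: "turns D \<noteq> 0"
  shows "beta D = axis_signs D"
proof -
  have wf: "wf_axis_from 0 0 D" and sh: "same_halves (switch_on_axis (reflect D)) D"
    using assms(2) by (auto simp: symmetric_def)
  define T where "T = filter not_right D"
  have wfT: "wf_half 0 T" using wf_half_left[of 0 0 D] wf by (simp add: T_def wf_axis_wf2)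
  have ev: "ev2 (axow 1 r) D eps2 [] [] = (\<Sum>b\<in>half_runs T ([], []). weight (map (half_weight r) T) ([], []) b)" for r :: rat
    using ev2_same_halves[OF same_halves_double[OF sh], of "axow 1 r" eps2] ev2_half_runs[of "[]" T "[]" r] wfT
    by (simp add: T_def)
  have ev': "ev2 (axow 1 r) D eps2 [] [] = 2 * r powi beta D" if "r \<noteq> 0" for r :: rat
    using ev2_alpha_beta[OF K wf _ that, of 1] by simp
  have w1: "weight (map (half_weight (1::rat)) T) s b = 1" for T s b
  proof (induction T arbitrary: s b)
    case (Cons e T)
    have "half_weight (1::rat) e s u = 1" for u by (cases "(1::rat, e, s, u)" rule: half_weight.cases) auto
    then show ?case using Cons by (cases b) auto
  qed simp
  \<comment> \<open>At r = 1 the state sum counts the runs; comparison with the knot formula shows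
    that there are two.\<close>
  have "of_nat (card (half_runs T ([], []))) = (2::rat)"
    using ev[of 1] ev'[of 1] by (simp add: w1)
  then have card: "card (half_runs T ([], [])) = 2" by (metis of_nat_eq_iff of_nat_numeral)
  then obtain b where b: "b \<in> half_runs T ([], [])" by (metis card.empty ex_in_conv zero_neq_numeral)
  have neg: "map swap_neg b \<in> half_runs T ([], [])" "map both_neg b \<in> half_runs T ([], [])"
    using half_runs_neg[of "[]" T "[]" b] wfT b by (simp_all add: swap_neg_def both_neg_def)
  have tT: "turns T \<noteq> 0" using t by (simp add: T_def axis_sums_left)
  have neq: "\<not> (\<forall>s\<in>set b. fst s = snd s)"
    using half_run_equal[of "[]" T "[]" b] wfT b tT by auto
  have NotNot: "map Not xs = map Not ys \<longleftrightarrow> xs = ys" for xs ys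
    by (rule inj_map_eq_map) (simp add: inj_def)
  have "b \<noteq> map both_neg b"
  proof (rule notI)
    assume eq: "b = map both_neg b"
    have "fst s = snd s" if "s \<in> set b" for s
      by (rule both_neg_fixed) (rule map_fixed[OF eq that])
    then show False using neq by blast
  qed
  then have runs: "half_runs T ([], []) = {b, map both_neg b}"
    using b neg card by (intro card_seteq[symmetric]) auto
  \<comment> \<open>Otherwise the labels would be equal on both sides throughout, which the
    traversals exclude. As there are only two runs, reflecting and reversing must fix
    \<open>b\<close>.\<close>
  have "map swap_neg b \<noteq> map both_neg b"
  proof (rule notI)
    assume eq: "map swap_neg b = map both_neg b"
    have "fst s = snd s" if "s \<in> set b" for s
    proof -
      have "swap_neg s = both_neg s" using eq that unfolding map_eq_conv by blast
      from arg_cong[OF this, of fst] show ?thesis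
        unfolding swap_neg_def both_neg_def fst_conv NotNot by (rule sym)
    qed
    then show False using neq by blast
  qed
  then have "map swap_neg b = b" using neg(1) unfolding runs by blast
  then have swap: "swap_neg s = s" if "s \<in> set b" for s
    using map_fixed[of b swap_neg s] that by simp
  have "snd s = map Not (fst s)" if "s \<in> set b" for s
    using arg_cong[OF swap[OF that], of snd] unfolding swap_neg_def snd_conv by (rule sym)
  then have opp: "\<forall>s\<in>set b. snd s = map Not (fst s)" by blast
  then have opp': "\<forall>s\<in>set (map both_neg b). snd s = map Not (fst s)" by (simp add: both_neg_def)
  have "2 * (2::rat) powi beta D = 2 powi axis_signs T + 2 powi axis_signs T"
    unfolding ev'[symmetric, of 2, simplified] ev runs
    using half_run_opposite[of "[]" T "[]" b "2::rat"] half_run_opposite[of "[]" T "[]" "map both_neg b" "2::rat"]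
      wfT b neg opp opp' \<open>b \<noteq> map both_neg b\<close> by simp
  then have "(2::rat) powi beta D = 2 powi axis_signs T" by simp
  then have "beta D = axis_signs T" by (rule two_powi_inject)
  then show ?thesis by (simp add: T_def axis_sums_left)
qed

subsection \<open>Integrality\<close>

text \<open>
  A basis of the functionals of two label lists of equal length, one symbol per pair of strands
  symmetric to each other.  It is a Clifford type basis: the odd symbols \<open>SC\<close> and \<open>SD\<close> contribute a
  sign to each label \<open>False\<close> further out (\<open>m\<close> is the parity seen so far, \<open>l\<close> the parity of the number of
  strands from here outwards).  Pairs of mirror crossings act on it with coefficients in
  \<open>\<int>[A\<^sup>4, A\<^sup>-\<^sup>4]\<close>, and this yields the integrality of \<open>W\<close>.
\<close>

datatype symbol = SI | SP | SC | SD

definition charged :: "symbol \<Rightarrow> bool" where "charged s \<longleftrightarrow> s = SC \<or> s = SD"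

lemma charged_simps [simp]: "\<not> charged SI" "\<not> charged SP" "charged SC" "charged SD"
  by (auto simp: charged_def)

text \<open>\<open>SI\<close> is a maximum across the axis. The factor a^2 at every other position
  of a charged symbol turns coefficients b^2 of the crossing tables into 1 or b^4, and the circle
  value in \<open>SP\<close> and \<open>SC\<close> is the normalisation that makes the tables for
  extrema integral as well.\<close>

fun base :: "'r::comm_ring_1 \<Rightarrow> 'r \<Rightarrow> bool \<Rightarrow> symbol \<Rightarrow> bool \<Rightarrow> bool \<Rightarrow> 'r" where
  "base a b l SI x y = capw b x y"
| "base a b l SP x y = (if \<not> x \<and> y then - (a\<^sup>2) - b\<^sup>2 else 0)"
| "base a b l SC x y = (if x \<and> y then (- (a\<^sup>2) - b\<^sup>2) * (if l then a\<^sup>2 else 1) else 0)"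
| "base a b l SD x y = (if \<not> x \<and> \<not> y then (if l then a\<^sup>2 else 1) else 0)"

fun word :: "'r::comm_ring_1 \<Rightarrow> 'r \<Rightarrow> bool \<Rightarrow> bool \<Rightarrow> symbol list \<Rightarrow> bool list \<Rightarrow> bool list \<Rightarrow> 'r" where
  "word a b m l [] [] [] = 1"
| "word a b m l (s # w) (x # xs) (y # ys) =
     (if m \<and> \<not> x then - 1 else 1) * base a b l s x y * word a b (m \<noteq> charged s) (\<not> l) w xs ys"
| "word a b m l _ _ _ = 0"

fun par :: "symbol list \<Rightarrow> bool" where
  "par [] = False" | "par (s # w) = (charged s \<noteq> par w)"

lemma word_append:
  assumes "length xs = length us" "length ys = length us"
  shows "word a b m l (us @ w) (xs @ xs') (ys @ ys') =
    word a b m l us xs ys * word a b (m \<noteq> par us) (l \<noteq> odd (length us)) w xs' ys'"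
  using assms
proof (induction us arbitrary: m l xs ys)
  case (Cons s us)
  then obtain x xs1 y ys1 where "xs = x # xs1" "ys = y # ys1" by (cases xs; cases ys) auto
  moreover have "((m \<noteq> charged s) \<noteq> par us) = (m \<noteq> par (s # us))"
    "((\<not> l) \<noteq> odd (length us)) = (l \<noteq> odd (length (s # us)))" by auto
  ultimately show ?case using Cons.IH[of xs1 ys1 "m \<noteq> charged s" "\<not> l"] Cons.prems by simp
qed simp

text \<open>Expansion in the basis of a mirror pair of crossings applied to two adjacent symbols,
  with t = A^-4 and u = A^4; each triple is a coefficient with the two new symbols. The point is
  that no denominators and no other powers of A occur.\<close>

fun cross_o :: "'r::comm_ring_1 \<Rightarrow> 'r \<Rightarrow> bool \<Rightarrow> symbol \<Rightarrow> symbol \<Rightarrow> ('r \<times> symbol \<times> symbol) list" where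
  "cross_o t u l SI SI = [(1, SI, SI)]"
| "cross_o t u l SI SP = [(1, SP, SI), (1 - t, SD, SC)]"
| "cross_o t u l SI SC = [(1 - t, SI, SC), (t - 1, SP, SC), ((if l then t else 1), SC, SI), (- (if l then t else 1), SC, SP)]"
| "cross_o t u l SI SD = [(u * (if l then t else 1), SD, SI), (- (if l then t else 1), SD, SP)]"
| "cross_o t u l SP SI = [(1, SI, SP), (t - 1, SD, SC)]"
| "cross_o t u l SP SP = [(1, SP, SP)]"
| "cross_o t u l SP SC = [(1 - u, SP, SC), (- u * (if l then t else 1), SC, SP)]"
| "cross_o t u l SP SD = [(- (if l then t else 1), SD, SP)]"
| "cross_o t u l SC SI = [((if l then 1 else t), SI, SC), (- (if l then 1 else t), SP, SC)]"
| "cross_o t u l SC SP = [(- u * (if l then 1 else t), SP, SC)]"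
| "cross_o t u l SC SC = [(1, SC, SC)]"
| "cross_o t u l SC SD = [(- 1, SD, SC)]"
| "cross_o t u l SD SI = [(u * (if l then 1 else t), SI, SD), (- (if l then 1 else t), SP, SD), (1 - u, SD, SI), (1 - t, SD, SP)]"
| "cross_o t u l SD SP = [(- (if l then 1 else t), SP, SD), (1 - t, SD, SP)]"
| "cross_o t u l SD SC = [(u - 1, SI, SP), (1 - u, SP, SI), (- 1, SC, SD), (2 - t - u, SD, SC)]"
| "cross_o t u l SD SD = [(1, SD, SD)]"

fun cross_u :: "'r::comm_ring_1 \<Rightarrow> 'r \<Rightarrow> bool \<Rightarrow> symbol \<Rightarrow> symbol \<Rightarrow> ('r \<times> symbol \<times> symbol) list" where
  "cross_u t u l SI SI = [(1, SI, SI)]"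
| "cross_u t u l SI SP = [(1, SP, SI), (t - 1, SC, SD)]"
| "cross_u t u l SI SC = [(u * (if l then t else 1), SC, SI), (- (if l then t else 1), SC, SP)]"
| "cross_u t u l SI SD = [(1 - t, SI, SD), (t - 1, SP, SD), ((if l then t else 1), SD, SI), (- (if l then t else 1), SD, SP)]"
| "cross_u t u l SP SI = [(1, SI, SP), (1 - t, SC, SD)]"
| "cross_u t u l SP SP = [(1, SP, SP)]"
| "cross_u t u l SP SC = [(- (if l then t else 1), SC, SP)]"
| "cross_u t u l SP SD = [(1 - u, SP, SD), (- u * (if l then t else 1), SD, SP)]"
| "cross_u t u l SC SI = [(u * (if l then 1 else t), SI, SC), (- (if l then 1 else t), SP, SC), (1 - u, SC, SI), (1 - t, SC, SP)]"
| "cross_u t u l SC SP = [(- (if l then 1 else t), SP, SC), (1 - t, SC, SP)]"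
| "cross_u t u l SC SC = [(1, SC, SC)]"
| "cross_u t u l SC SD = [(1 - u, SI, SP), (u - 1, SP, SI), (2 - t - u, SC, SD), (- 1, SD, SC)]"
| "cross_u t u l SD SI = [((if l then 1 else t), SI, SD), (- (if l then 1 else t), SP, SD)]"
| "cross_u t u l SD SP = [(- u * (if l then 1 else t), SP, SD)]"
| "cross_u t u l SD SC = [(- 1, SC, SD)]"
| "cross_u t u l SD SD = [(1, SD, SD)]"

definition cross :: "piece \<Rightarrow> 'r::comm_ring_1 \<Rightarrow> 'r \<Rightarrow> bool \<Rightarrow> symbol \<Rightarrow> symbol \<Rightarrow> ('r \<times> symbol \<times> symbol) list" where
  "cross p = (if p = Xo then cross_o else cross_u)"

text \<open>Conservation of the parity of charges: a local replacement then leaves the signs of all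
  symbols further out unchanged.\<close>

lemma cross_charged:
  "(k, s', u') \<in> set (cross p t u l s v) \<Longrightarrow> (charged s' \<noteq> charged u') = (charged s \<noteq> charged v)"
  unfolding cross_def by (cases s; cases v; cases "p = Xo") auto

lemma cross_left:
  fixes a b :: "'r::comm_ring_1" assumes "a * b = 1"
  shows "(\<Sum>c\<in>UNIV. \<Sum>d\<in>UNIV. flip (bw a b Xo) x0 x1 c d * f c d) =
      (if x0 = x1 then b * f x0 x1 else if x1 then (b - a * a\<^sup>2) * f False True + a * f True False else a * f False True)"
    and "(\<Sum>c\<in>UNIV. \<Sum>d\<in>UNIV. flip (bw a b Xu) x0 x1 c d * f c d) =
      (if x0 = x1 then a * f x0 x1 else if x1 then b * f True False else (a - b * b\<^sup>2) * f True False + b * f False True)"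
    and "(\<Sum>c\<in>UNIV. \<Sum>d\<in>UNIV. bw a b Xo x0 x1 c d * f c d) =
      (if x0 = x1 then b * f x0 x1 else if x0 then (b - a * a\<^sup>2) * f True False + a * f False True else a * f True False)"
    and "(\<Sum>c\<in>UNIV. \<Sum>d\<in>UNIV. bw a b Xu x0 x1 c d * f c d) =
      (if x0 = x1 then a * f x0 x1 else if x0 then b * f False True else (a - b * b\<^sup>2) * f False True + b * f True False)"
  unfolding sum_bool
  by (cases x0; cases x1; auto simp: flip_def hv_def capw_def cupw_def power2_inv[OF assms] power2_eq_square algebra_simps)+

lemma cross_local_o:
  fixes a b :: "'r::comm_ring_1" assumes ab: "a * b = 1"
  shows "(\<Sum>c\<in>UNIV. \<Sum>d\<in>UNIV. flip (bw a b Xo) x0 x1 c d * (\<Sum>e\<in>UNIV. \<Sum>f\<in>UNIV. bw a b Xu y0 y1 e f *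
      word a b m l [s, v] [c, d] [e, f])) =
    (\<Sum>(k, s', v')\<leftarrow>cross_o (b ^ 4) (a ^ 4) l s v. k * word a b m l [s', v'] [x0, x1] [y0, y1])"
  unfolding cross_left[OF ab]
  by (cases s; cases v; cases x0; cases x1; cases y0; cases y1;
      simp add: capw_def ab power2_inv[OF ab] power2_eq_square eval_nat_numeral algebra_simps)

lemma cross_local_u:
  fixes a b :: "'r::comm_ring_1" assumes ab: "a * b = 1"
  shows "(\<Sum>c\<in>UNIV. \<Sum>d\<in>UNIV. flip (bw a b Xu) x0 x1 c d * (\<Sum>e\<in>UNIV. \<Sum>f\<in>UNIV. bw a b Xo y0 y1 e f *
      word a b m l [s, v] [c, d] [e, f])) =
    (\<Sum>(k, s', v')\<leftarrow>cross_u (b ^ 4) (a ^ 4) l s v. k * word a b m l [s', v'] [x0, x1] [y0, y1])"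
  unfolding cross_left[OF ab]
  by (cases s; cases v; cases x0; cases x1; cases y0; cases y1;
      simp add: capw_def ab power2_inv[OF ab] power2_eq_square eval_nat_numeral algebra_simps)

text \<open>The left list has exactly one label \<open>False\<close> at the cap, so a word picks up
  a sign there when the parity \<open>m\<close> is odd; \<open>z\<close> compensates it.\<close>

definition caps :: "'r::comm_ring_1 \<Rightarrow> bool \<Rightarrow> ('r \<times> symbol \<times> symbol) list" where
  "caps t m = (let z = (if m then - 1 else 1) in
    [(z * t, SI, SP), (z, SP, SI), (- z * t, SP, SP), (z * t, SC, SD), (- z * t, SD, SC)])"

lemma cap_local:
  fixes a b :: "'r::comm_ring_1" assumes ab: "a * b = 1"
  shows "(- (a\<^sup>2) - b\<^sup>2) * (capw b x1 x0 * capw b y0 y1) =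
    (\<Sum>(k, s, v)\<leftarrow>caps (b ^ 4) m. k * word a b m l [s, v] [x0, x1] [y0, y1])"
  by (cases m; cases l; cases x0; cases x1; cases y0; cases y1;
      simp add: caps_def capw_def ab power2_inv[OF ab] power2_eq_square eval_nat_numeral algebra_simps)

text \<open>Two adjacent symbols closed by a mirror pair of cups contract to a scalar; this is the
  scalar after division by the circle value.\<close>

fun cup_coeff :: "'r::comm_ring_1 \<Rightarrow> bool \<Rightarrow> symbol \<Rightarrow> symbol \<Rightarrow> 'r" where
  "cup_coeff u m SI SI = (if m then - 1 else 1)"
| "cup_coeff u m SI SP = (if m then - 1 else 1)"
| "cup_coeff u m SP SI = (if m then - u else u)"
| "cup_coeff u m SC SD = (if m then - u else u)"
| "cup_coeff u m SD SC = (if m then u else - u)"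
| "cup_coeff u m _ _ = 0"

lemma cup_local:
  fixes a b :: "'r::comm_ring_1" assumes ab: "a * b = 1"
  shows "(\<Sum>c\<in>UNIV. \<Sum>d\<in>UNIV. cupw a d c * (\<Sum>e\<in>UNIV. \<Sum>f\<in>UNIV. cupw a e f * word a b m l [s, v] [c, d] [e, f])) =
    (- (a\<^sup>2) - b\<^sup>2) * cup_coeff (a ^ 4) m s v"
  unfolding sum_bool
  by (cases m; cases l; cases s; cases v; simp add: capw_def cupw_def ab power2_inv[OF ab] power2_eq_square eval_nat_numeral algebra_simps)

lemma cup_coeff_charged: "cup_coeff u m s v \<noteq> 0 \<Longrightarrow> charged s = charged v"
  by (cases s; cases v) auto

type_synonym param = "ratfun \<times> ratfun"

definition laurent_A :: "ratfun set" where "laurent_A = range (\<lambda>V. subst1 V (var_A powi (- 4)))"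

text \<open>Polynomials over \<open>laurent_A\<close> in the two horizontal coefficients. They stay
  functions of these parameters, so that one integrality argument serves all values of s at
  once.\<close>

inductive_set polyf :: "(param \<Rightarrow> ratfun) set" where
  polyf_const: "c \<in> laurent_A \<Longrightarrow> (\<lambda>_. c) \<in> polyf"
| polyf_fst: "fst \<in> polyf"
| polyf_snd: "snd \<in> polyf"
| polyf_add: "f \<in> polyf \<Longrightarrow> g \<in> polyf \<Longrightarrow> (\<lambda>p. f p + g p) \<in> polyf"
| polyf_mult: "f \<in> polyf \<Longrightarrow> g \<in> polyf \<Longrightarrow> (\<lambda>p. f p * g p) \<in> polyf"

abbreviation Word :: "symbol list \<Rightarrow> bool list \<Rightarrow> bool list \<Rightarrow> ratfun" where
  "Word w \<equiv> word var_A (inverse var_A) False (odd (length w)) w"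

inductive lat :: "nat \<Rightarrow> (param \<Rightarrow> bool list \<Rightarrow> bool list \<Rightarrow> ratfun) \<Rightarrow> bool" for n where
  lat_0: "lat n (\<lambda>p xs ys. 0)"
| lat_add: "lat n F \<Longrightarrow> c \<in> polyf \<Longrightarrow> length w = n \<Longrightarrow> lat n (\<lambda>p xs ys. F p xs ys + c p * Word w xs ys)"

text \<open>Membership in the lattice is tested on lists of length \<open>n\<close> only, because
  functionals obtained from diagrams are meaningless on other lengths.\<close>

definition rep :: "nat \<Rightarrow> (param \<Rightarrow> bool list \<Rightarrow> bool list \<Rightarrow> ratfun) \<Rightarrow> bool" where
  "rep n F \<longleftrightarrow> (\<exists>G. lat n G \<and> (\<forall>p xs ys. length xs = n \<longrightarrow> length ys = n \<longrightarrow> F p xs ys = G p xs ys))"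

lemma powi_neg4: "var_A powi (- 4) \<noteq> 0" by simp

lemma laurent_A_ring:
  "c \<in> laurent_A \<Longrightarrow> d \<in> laurent_A \<Longrightarrow> c + d \<in> laurent_A"
  "c \<in> laurent_A \<Longrightarrow> d \<in> laurent_A \<Longrightarrow> c - d \<in> laurent_A"
  "c \<in> laurent_A \<Longrightarrow> d \<in> laurent_A \<Longrightarrow> c * d \<in> laurent_A"
  "c \<in> laurent_A \<Longrightarrow> - c \<in> laurent_A"
  "0 \<in> laurent_A" "1 \<in> laurent_A" "numeral k \<in> laurent_A" "inverse var_A ^ 4 \<in> laurent_A" "var_A ^ 4 \<in> laurent_A"
proof -
  note s = subst1_simps[OF powi_neg4]
  show "c \<in> laurent_A \<Longrightarrow> d \<in> laurent_A \<Longrightarrow> c + d \<in> laurent_A"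
    unfolding laurent_A_def by (auto simp only: s(1)[symmetric] image_iff)
  show "c \<in> laurent_A \<Longrightarrow> d \<in> laurent_A \<Longrightarrow> c - d \<in> laurent_A"
    unfolding laurent_A_def by (auto simp only: s(2)[symmetric] image_iff)
  show "c \<in> laurent_A \<Longrightarrow> d \<in> laurent_A \<Longrightarrow> c * d \<in> laurent_A"
    unfolding laurent_A_def by (auto simp only: s(3)[symmetric] image_iff)
  show "c \<in> laurent_A \<Longrightarrow> - c \<in> laurent_A"
    unfolding laurent_A_def by (auto simp only: s(5)[symmetric] image_iff)
  have single: "of_int c * (var_A powi (- 4)) powi k \<in> laurent_A" for c k
    unfolding laurent_A_def s(7)[symmetric] by blast
  show "0 \<in> laurent_A" using single[of 0 0] by simp
  show "1 \<in> laurent_A" using single[of 1 0] by simp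
  show "numeral k \<in> laurent_A" using single[of "numeral k" 0] by simp
  have e: "var_A powi (- 4) = inverse var_A ^ 4" by (simp add: power_int_def)
  show "inverse var_A ^ 4 \<in> laurent_A" using single[of 1 1] unfolding e by simp
  show "var_A ^ 4 \<in> laurent_A" using single[of 1 "- 1"] unfolding e by (simp add: power_int_def power_inverse)
qed

lemma lat_plus: "lat n G \<Longrightarrow> lat n F \<Longrightarrow> lat n (\<lambda>p xs ys. F p xs ys + G p xs ys)"
proof (induction rule: lat.induct)
  case (lat_add G c w)
  then have "lat n (\<lambda>p xs ys. (F p xs ys + G p xs ys) + c p * Word w xs ys)" by (intro lat.lat_add) auto
  then show ?case by (simp only: add.assoc)
qed simp

lemma lat_scale: "lat n F \<Longrightarrow> c \<in> polyf \<Longrightarrow> lat n (\<lambda>p xs ys. c p * F p xs ys)"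
proof (induction rule: lat.induct)
  case (lat_add F d w)
  then have "lat n (\<lambda>p xs ys. c p * F p xs ys + (c p * d p) * Word w xs ys)"
    by (intro lat.lat_add polyf_mult) auto
  then show ?case by (simp only: distrib_left mult.assoc)
qed (simp add: lat_0)

lemma rep_plus:
  assumes "rep n F" "rep n G" shows "rep n (\<lambda>p xs ys. F p xs ys + G p xs ys)"
proof -
  obtain F' where F: "lat n F'" "\<forall>p xs ys. length xs = n \<longrightarrow> length ys = n \<longrightarrow> F p xs ys = F' p xs ys"
    using assms(1) unfolding rep_def by blast
  obtain G' where G: "lat n G'" "\<forall>p xs ys. length xs = n \<longrightarrow> length ys = n \<longrightarrow> G p xs ys = G' p xs ys"
    using assms(2) unfolding rep_def by blast
  show ?thesis unfolding rep_def
    by (rule exI[of _ "\<lambda>p xs ys. F' p xs ys + G' p xs ys"]) (simp add: lat_plus[OF G(1) F(1)] F(2) G(2))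
qed

lemma rep_scale:
  assumes "rep n F" "c \<in> polyf" shows "rep n (\<lambda>p xs ys. c p * F p xs ys)"
proof -
  obtain F' where F: "lat n F'" "\<forall>p xs ys. length xs = n \<longrightarrow> length ys = n \<longrightarrow> F p xs ys = F' p xs ys"
    using assms(1) unfolding rep_def by blast
  show ?thesis unfolding rep_def
    by (rule exI[of _ "\<lambda>p xs ys. c p * F' p xs ys"]) (simp add: lat_scale[OF F(1) assms(2)] F(2))
qed

lemma rep_0: "rep n (\<lambda>p xs ys. 0)"
  unfolding rep_def by (rule exI[of _ "\<lambda>p xs ys. 0"]) (simp add: lat_0)

lemma rep_cong:
  assumes "rep n G" "\<And>p xs ys. length xs = n \<Longrightarrow> length ys = n \<Longrightarrow> F p xs ys = G p xs ys"
  shows "rep n F"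
proof -
  obtain H where "lat n H" "\<forall>p xs ys. length xs = n \<longrightarrow> length ys = n \<longrightarrow> G p xs ys = H p xs ys"
    using assms(1) unfolding rep_def by blast
  with assms(2) show ?thesis unfolding rep_def by (intro exI[of _ H]) simp
qed

lemma rep_Word: "length w = n \<Longrightarrow> rep n (\<lambda>p. Word w)"
proof -
  assume "length w = n"
  then have "lat n (\<lambda>p xs ys. 0 + 1 * Word w xs ys)"
    by (intro lat.lat_add lat.lat_0 polyf_const laurent_A_ring)
  then show ?thesis unfolding rep_def by (intro exI[of _ "\<lambda>p xs ys. 0 + 1 * Word w xs ys"]) simp
qed

lemma rep_sum_list:
  assumes "\<And>k s v. (k, s, v) \<in> set ls \<Longrightarrow> k \<in> laurent_A" "length us + 2 + length vs = n"
  shows "rep n (\<lambda>p xs ys. \<Sum>(k, s, v)\<leftarrow>ls. k * Word (us @ s # v # vs) xs ys)"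
  using assms(1)
proof (induction ls)
  case (Cons e ls)
  obtain k s v where e: "e = (k, s, v)" by (cases e)
  have "rep n (\<lambda>p xs ys. k * Word (us @ s # v # vs) xs ys)"
    using Cons.prems assms(2) by (intro rep_scale polyf_const rep_Word) (auto simp: e)
  moreover have "rep n (\<lambda>p xs ys. \<Sum>(k, s, v)\<leftarrow>ls. k * Word (us @ s # v # vs) xs ys)"
    using Cons by auto
  ultimately show ?case by (simp add: e rep_plus)
qed (simp add: rep_0)

text \<open>By linearity it is enough to know the images of basis words. The scalar \<open>k\<close>
  is the power of the circle value that brings them back into the lattice.\<close>

lemma rep_ev2:
  assumes wf: "wf2 m m E n n"
    and basis: "\<And>w. length w = n \<Longrightarrow> rep m (\<lambda>p xs ys. k * ev2 (W p) E (Word w) xs ys)"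
    and "rep n F"
  shows "rep m (\<lambda>p xs ys. k * ev2 (W p) E (F p) xs ys)"
proof -
  obtain G where G: "lat n G" "\<forall>p xs ys. length xs = n \<longrightarrow> length ys = n \<longrightarrow> F p xs ys = G p xs ys"
    using assms(3) unfolding rep_def by blast
  from G(1) have "rep m (\<lambda>p xs ys. k * ev2 (W p) E (G p) xs ys)"
  proof (induction rule: lat.induct)
    case lat_0
    have "ev2 (W p) E (\<lambda>xs ys. 0) xs ys = 0" for p xs ys
      using fun_cong[OF fun_cong[OF ev2_linear[of "W p" E 0 "\<lambda>_ _. 0" 0 "\<lambda>_ _. 0"]], of xs ys] by simp
    then show ?case by (simp add: rep_0)
  next
    case (lat_add G c w)
    have "ev2 (W p) E (\<lambda>xs ys. G p xs ys + c p * Word w xs ys) xs ys =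
        ev2 (W p) E (G p) xs ys + c p * ev2 (W p) E (Word w) xs ys" for p xs ys
      using fun_cong[OF fun_cong[OF ev2_linear[of "W p" E 1 "G p" "c p" "Word w"]], of xs ys] by simp
    then have "(\<lambda>p xs ys. k * ev2 (W p) E (\<lambda>xs ys. G p xs ys + c p * Word w xs ys) xs ys) =
      (\<lambda>p xs ys. k * ev2 (W p) E (G p) xs ys + c p * (k * ev2 (W p) E (Word w) xs ys))"
      by (simp add: algebra_simps)
    then show ?case using rep_plus[OF lat_add.IH rep_scale[OF basis lat_add(2)]] lat_add(3) by simp
  qed
  then show ?thesis
  proof (rule rep_cong)
    fix p and xs ys :: "bool list" assume "length xs = m" "length ys = m"
    then show "k * ev2 (W p) E (F p) xs ys = k * ev2 (W p) E (G p) xs ys"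
      using ev2_cong[of xs ys E n n "F p" "G p" "W p"] wf G(2) by simp
  qed
qed

abbreviation dA :: ratfun where "dA \<equiv> circle var_A"

definition pw :: "param \<Rightarrow> bool \<Rightarrow> piece \<Rightarrow> ratfun weight" where
  "pw p = axw var_A (inverse var_A) (fst p / dA, 1) (snd p / dA, 1)"

lemma A_inv: "var_A * inverse var_A = 1" by simp

lemma pw_simps: "pw p False q = bw var_A (inverse var_A) q" "pw p ax Cup = bw var_A (inverse var_A) Cup"
  "pw p ax Cap = bw var_A (inverse var_A) Cap"
  "pw p True Xo = hv var_A (inverse var_A) (fst p / dA) 1" "pw p True Xu = hv var_A (inverse var_A) (snd p / dA) 1"
  by (auto simp: pw_def axw_def)

lemma split_word:
  assumes "length w = n" "k + 2 \<le> n"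
  obtains us s v vs where "w = us @ s # v # vs" "length us = k"
proof -
  have "w = take k w @ w ! k # w ! Suc k # drop (Suc (Suc k)) w"
    using assms by (simp add: id_take_nth_drop[symmetric] Cons_nth_drop_Suc)
  then show ?thesis using that[of "take k w"] assms by simp
qed

lemma Word_split:
  assumes "length xs1 = length us" "length ys1 = length us" "length xs2 = length vs" "length ys2 = length vs"
  shows "Word (us @ s # v # vs) (xs1 @ x0 # x1 # xs2) (ys1 @ y0 # y1 # ys2) =
    word var_A (inverse var_A) False (odd (length us + length vs)) us xs1 ys1 *
    word var_A (inverse var_A) (par us) (odd (length vs)) [s, v] [x0, x1] [y0, y1] *
    word var_A (inverse var_A) (par us \<noteq> (charged s \<noteq> charged v)) (odd (length vs)) vs xs2 ys2"
proof -
  have "(odd (length us + length vs) \<noteq> odd (length us)) = odd (length vs)"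
    "((par us \<noteq> charged s) \<noteq> charged v) = (par us \<noteq> (charged s \<noteq> charged v))" by auto
  then show ?thesis using word_append[OF assms(1,2), of var_A "inverse var_A" False "odd (length us + length vs)" "s # v # vs" "x0 # x1 # xs2" "y0 # y1 # ys2"]
    by (simp add: mult.assoc)
qed

lemma Word_append_split:
  assumes "length xs1 = length us" "length ys1 = length us"
  shows "Word (us @ vs) (xs1 @ xs2) (ys1 @ ys2) =
    word var_A (inverse var_A) False (odd (length us + length vs)) us xs1 ys1 *
    word var_A (inverse var_A) (par us) (odd (length vs)) vs xs2 ys2"
proof -
  have "(odd (length us + length vs) \<noteq> odd (length us)) = odd (length vs)" by auto
  then show ?thesis using word_append[OF assms, of var_A "inverse var_A" False "odd (length us + length vs)" vs xs2 ys2]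
    by simp
qed

lemma sum_list_factor: "(\<Sum>(k, s, v)\<leftarrow>ls. k * (u * f s v * g)) = u * (\<Sum>(k, s, v)\<leftarrow>ls. k * f s v) * (g :: 'r::comm_ring_1)"
  by (induction ls) (auto simp: algebra_simps)

lemma sum_list_cong3:
  "(\<And>k s v. (k, s, v) \<in> set ls \<Longrightarrow> f k s v = g k s v) \<Longrightarrow> (\<Sum>(k, s, v)\<leftarrow>ls. f k s v) = (\<Sum>(k, s, v)\<leftarrow>ls. g k s v)"
  by (rule arg_cong[where f = sum_list], rule map_cong) auto

text \<open>A word is a product of an inner, a middle and an outer factor; only the middle one, for
  the two symbols at the crossing, is replaced according to the table.\<close>

lemma rep_crossing:
  assumes p: "is_crossing p" "k + 2 \<le> n" "length w = n"
  shows "rep n (\<lambda>q xs ys. 1 * ev2 (pw q) [(L k, p), (R k, mirror p)] (Word w) xs ys)"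
proof -
  obtain us s v vs where w: "w = us @ s # v # vs" "length us = k"
    using split_word assms by metis
  let ?a = var_A and ?b = "inverse var_A"
  let ?ls = "cross p (?b ^ 4) (?a ^ 4) (odd (length vs)) s v"
  have mem: "c \<in> laurent_A" if "(c, s', v') \<in> set ?ls" for c s' v'
    using that unfolding cross_def by (cases s; cases v) (auto split: if_splits intro!: laurent_A_ring)
  show ?thesis
  proof (rule rep_cong[OF rep_sum_list[of ?ls us vs n]])
    fix q and xs ys :: "bool list" assume len: "length xs = n" "length ys = n"
    have k: "k + 2 \<le> length xs" "k + 2 \<le> length ys" using assms(2) len by auto
    obtain xs1 x0 x1 xs2 where xs: "xs = xs1 @ x0 # x1 # xs2" "length xs1 = k"
      using k(1) by (rule split_at2)
    obtain ys1 y0 y1 ys2 where ys: "ys = ys1 @ y0 # y1 # ys2" "length ys1 = k"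
      using k(2) by (rule split_at2)
    have l: "length xs1 = length us" "length ys1 = length us" "length xs2 = length vs" "length ys2 = length vs"
      using xs ys w len assms(3) by auto
    let ?U = "word ?a ?b False (odd (length us + length vs)) us xs1 ys1"
    let ?V = "word ?a ?b (par us \<noteq> (charged s \<noteq> charged v)) (odd (length vs)) vs xs2 ys2"
    let ?loc = "\<lambda>s v c d e f. word ?a ?b (par us) (odd (length vs)) [s, v] [c, d] [e, f]"
    have "1 * ev2 (pw q) [(L k, p), (R k, mirror p)] (Word w) xs ys =
      (\<Sum>c\<in>UNIV. \<Sum>d\<in>UNIV. flip (bw ?a ?b p) x0 x1 c d * (\<Sum>e\<in>UNIV. \<Sum>f\<in>UNIV. bw ?a ?b (mirror p) y0 y1 e f *
        Word (us @ s # v # vs) (xs1 @ c # d # xs2) (ys1 @ e # f # ys2)))"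
      using p(1) xs(2)[symmetric] list_simps[of xs1] list_simps[of ys1] l unfolding xs(1) ys(1) w(1)
      by (cases p) (simp_all add: pw_simps flip_def)
    also have "\<dots> = ?U * (\<Sum>c\<in>UNIV. \<Sum>d\<in>UNIV. flip (bw ?a ?b p) x0 x1 c d * (\<Sum>e\<in>UNIV. \<Sum>f\<in>UNIV. bw ?a ?b (mirror p) y0 y1 e f *
        ?loc s v c d e f)) * ?V"
      unfolding Word_split[OF l] sum_bool by (simp only: algebra_simps)
    also have "\<dots> = ?U * (\<Sum>(c, s', v')\<leftarrow>?ls. c * ?loc s' v' x0 x1 y0 y1) * ?V"
      using p(1) cross_local_o[OF A_inv, of x0 x1 y0 y1 "par us" "odd (length vs)" s v]
        cross_local_u[OF A_inv, of x0 x1 y0 y1 "par us" "odd (length vs)" s v]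
      by (cases p) (simp_all only: mirror.simps cross_def if_True if_False piece.distinct is_crossing_simps simp_thms)
    also have "\<dots> = (\<Sum>(c, s', v')\<leftarrow>?ls. c * (?U * ?loc s' v' x0 x1 y0 y1 * ?V))"
      by (rule sum_list_factor[symmetric])
    also have "\<dots> = (\<Sum>(c, s', v')\<leftarrow>?ls. c * Word (us @ s' # v' # vs) xs ys)"
    proof (rule sum_list_cong3)
      fix c s' v' assume "(c, s', v') \<in> set ?ls"
      then have "(charged s' \<noteq> charged v') = (charged s \<noteq> charged v)" by (rule cross_charged)
      then show "c * (?U * ?loc s' v' x0 x1 y0 y1 * ?V) = c * Word (us @ s' # v' # vs) xs ys"
        unfolding xs(1) ys(1) Word_split[OF l] by simp
    qed
    finally show "1 * ev2 (pw q) [(L k, p), (R k, mirror p)] (Word w) xs ys =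
      (\<Sum>(c, s', v')\<leftarrow>?ls. c * Word (us @ s' # v' # vs) xs ys)" .
  qed (use mem w assms in auto)
qed

lemma rep_cap:
  assumes "k \<le> n" "length w = n"
  shows "rep (n + 2) (\<lambda>q xs ys. dA * ev2 (pw q) [(L k, Cap), (R k, Cap)] (Word w) xs ys)"
proof -
  let ?a = var_A and ?b = "inverse var_A"
  obtain us vs where w: "w = us @ vs" "length us = k" using split_at[of k w] assms by auto
  let ?ls = "caps (?b ^ 4) (par us)"
  have mem: "c \<in> laurent_A" if "(c, s', v') \<in> set ?ls" for c s' v'
    using that by (auto simp: caps_def Let_def simp del: power_inverse intro!: laurent_A_ring)
  show ?thesis
  proof (rule rep_cong[OF rep_sum_list[of ?ls us vs "n + 2"]])
    fix q and xs ys :: "bool list" assume len: "length xs = n + 2" "length ys = n + 2"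
    have k: "k + 2 \<le> length xs" "k + 2 \<le> length ys" using assms len by auto
    obtain xs1 x0 x1 xs2 where xs: "xs = xs1 @ x0 # x1 # xs2" "length xs1 = k"
      using k(1) by (rule split_at2)
    obtain ys1 y0 y1 ys2 where ys: "ys = ys1 @ y0 # y1 # ys2" "length ys1 = k"
      using k(2) by (rule split_at2)
    have l: "length xs1 = length us" "length ys1 = length us" "length xs2 = length vs" "length ys2 = length vs"
      using xs ys w len assms(2) by auto
    let ?U = "word ?a ?b False (odd (length us + length vs)) us xs1 ys1"
    let ?V = "word ?a ?b (par us) (odd (length vs)) vs xs2 ys2"
    let ?loc = "\<lambda>s v. word ?a ?b (par us) (odd (length vs)) [s, v] [x0, x1] [y0, y1]"
    have "ev2 (pw q) [(L k, Cap), (R k, Cap)] (Word w) xs ys =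
      capw ?b x1 x0 * (capw ?b y0 y1 * Word (us @ vs) (xs1 @ xs2) (ys1 @ ys2))"
      using xs(2)[symmetric] list_simps[of xs1] list_simps[of ys1] l unfolding xs(1) ys(1) w(1)
      by (simp add: pw_simps flip_def)
    then have "dA * ev2 (pw q) [(L k, Cap), (R k, Cap)] (Word w) xs ys =
      ?U * (dA * (capw ?b x1 x0 * capw ?b y0 y1)) * ?V"
      unfolding Word_append_split[OF l(1,2)] by (simp only: ac_simps)
    also have "\<dots> = ?U * (\<Sum>(c, s', v')\<leftarrow>?ls. c * ?loc s' v') * ?V"
      unfolding cap_local[OF A_inv, of x1 x0 y0 y1 "par us" "odd (length vs)"] by (rule refl)
    also have "\<dots> = (\<Sum>(c, s', v')\<leftarrow>?ls. c * (?U * ?loc s' v' * ?V))"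
      by (rule sum_list_factor[symmetric])
    also have "\<dots> = (\<Sum>(c, s', v')\<leftarrow>?ls. c * Word (us @ s' # v' # vs) xs ys)"
    proof (rule sum_list_cong3)
      fix c s' v' assume "(c, s', v') \<in> set ?ls"
      then have "(charged s' \<noteq> charged v') = False" by (auto simp: caps_def Let_def)
      then show "c * (?U * ?loc s' v' * ?V) = c * Word (us @ s' # v' # vs) xs ys"
        unfolding xs(1) ys(1) Word_split[OF l] by simp
    qed
    finally show "dA * ev2 (pw q) [(L k, Cap), (R k, Cap)] (Word w) xs ys =
      (\<Sum>(c, s', v')\<leftarrow>?ls. c * Word (us @ s' # v' # vs) xs ys)" .
  qed (use mem w assms in auto)
qed

lemma rep_cup:
  assumes "k \<le> n" "length w = n + 2"
  shows "rep n (\<lambda>q xs ys. inverse dA * ev2 (pw q) [(L k, Cup), (R k, Cup)] (Word w) xs ys)"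
proof -
  let ?a = var_A and ?b = "inverse var_A"
  obtain us s v vs where w: "w = us @ s # v # vs" "length us = k"
  proof -
    have "k + 2 \<le> n + 2" using assms(1) by simp
    then show ?thesis by (rule split_word[OF assms(2)]) (rule that)
  qed
  let ?c = "cup_coeff (?a ^ 4) (par us) s v"
  have mem: "?c \<in> laurent_A"
    by (cases s; cases v) (auto intro!: laurent_A_ring)
  show ?thesis
  proof (rule rep_cong[OF rep_scale[OF rep_Word[of "us @ vs" n] polyf_const[OF mem]]])
    fix q and xs ys :: "bool list" assume len: "length xs = n" "length ys = n"
    have k: "k \<le> length xs" "k \<le> length ys" using assms len by auto
    obtain xs1 xs2 where xs: "xs = xs1 @ xs2" "length xs1 = k"
      using k(1) by (rule split_at)
    obtain ys1 ys2 where ys: "ys = ys1 @ ys2" "length ys1 = k"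
      using k(2) by (rule split_at)
    have l: "length xs1 = length us" "length ys1 = length us" "length xs2 = length vs" "length ys2 = length vs"
      using xs ys w len assms(2) by auto
    let ?U = "word ?a ?b False (odd (length us + length vs)) us xs1 ys1"
    let ?V = "word ?a ?b (par us \<noteq> (charged s \<noteq> charged v)) (odd (length vs)) vs xs2 ys2"
    let ?loc = "\<lambda>c d e f. word ?a ?b (par us) (odd (length vs)) [s, v] [c, d] [e, f]"
    have "ev2 (pw q) [(L k, Cup), (R k, Cup)] (Word w) xs ys =
      (\<Sum>c\<in>UNIV. \<Sum>d\<in>UNIV. cupw ?a d c * (\<Sum>e\<in>UNIV. \<Sum>f\<in>UNIV. cupw ?a e f *
        Word (us @ s # v # vs) (xs1 @ c # d # xs2) (ys1 @ e # f # ys2)))"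
      using xs(2)[symmetric] list_simps[of xs1] list_simps[of ys1] l unfolding xs(1) ys(1) w(1)
      by (simp add: pw_simps flip_def)
    also have "\<dots> = ?U * (\<Sum>c\<in>UNIV. \<Sum>d\<in>UNIV. cupw ?a d c * (\<Sum>e\<in>UNIV. \<Sum>f\<in>UNIV. cupw ?a e f *
        ?loc c d e f)) * ?V"
      unfolding Word_split[OF l] sum_bool by (simp only: algebra_simps)
    also have "\<dots> = ?U * (dA * ?c) * ?V"
      unfolding cup_local[OF A_inv] by (rule refl)
    also have "\<dots> = dA * (?c * (?U * ?V))" by (simp only: ac_simps)
    also have "?c * (?U * ?V) = ?c * Word (us @ vs) xs ys"
    proof (cases "?c = 0")
      case False
      then have "charged s = charged v" by (rule cup_coeff_charged)
      then show ?thesis unfolding xs(1) ys(1) Word_append_split[OF l(1,2)] by simp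
    qed simp
    finally have "ev2 (pw q) [(L k, Cup), (R k, Cup)] (Word w) xs ys = dA * (?c * Word (us @ vs) xs ys)" .
    then have "inverse dA * ev2 (pw q) [(L k, Cup), (R k, Cup)] (Word w) xs ys = (inverse dA * dA) * (?c * Word (us @ vs) xs ys)"
      by (simp only: mult.assoc)
    then show "inverse dA * ev2 (pw q) [(L k, Cup), (R k, Cup)] (Word w) xs ys = ?c * Word (us @ vs) xs ys"
      using left_inverse[OF circle_nonzero(1)] by (simp only: mult_1)
  qed (use w assms in auto)
qed

text \<open>Partial trace over the innermost pair of strands, the effect of a minimum on the
  axis.\<close>

definition trace :: "(bool list \<Rightarrow> bool list \<Rightarrow> ratfun) \<Rightarrow> bool list \<Rightarrow> bool list \<Rightarrow> ratfun" where
  "trace F xs ys = - (var_A\<^sup>2) * F (True # xs) (False # ys) + F (False # xs) (True # ys)"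

text \<open>Here integrality on the axis is decided: the partial trace of a basis word is a multiple
  of the circle value, which pays for the denominator of a horizontal coefficient.\<close>

lemma trace_Word:
  "trace (Word (s # w)) xs ys = (if charged s then 0 else dA * Word w xs ys)"
  by (cases s) (simp_all add: trace_def capw_def algebra_simps)

lemma axact_Axis:
  "axact (pw q) (Axis, Cup) F xs ys = trace F xs ys"
  "axact (pw q) (Axis, Cap) F (x # xs) (y # ys) = capw (inverse var_A) x y * F xs ys"
  "axact (pw q) (Axis, Xo) F (x # xs) (y # ys) =
     fst q / dA * (capw (inverse var_A) x y * trace F xs ys) + F (x # xs) (y # ys)"
  "axact (pw q) (Axis, Xu) F (x # xs) (y # ys) =
     snd q / dA * (capw (inverse var_A) x y * trace F xs ys) + F (x # xs) (y # ys)"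
proof -
  show "axact (pw q) (Axis, Cup) F xs ys = trace F xs ys"
    by (simp add: pw_simps cupw_def trace_def sum_bool)
  show "axact (pw q) (Axis, Cap) F (x # xs) (y # ys) = capw (inverse var_A) x y * F xs ys"
    by (simp add: pw_simps)
  have *: "(\<Sum>c\<in>UNIV. \<Sum>d\<in>UNIV. hv var_A (inverse var_A) h 1 x y c d * F (c # xs) (d # ys)) =
    h * (capw (inverse var_A) x y * trace F xs ys) + F (x # xs) (y # ys)" for h
    unfolding sum_bool hv_def trace_def
    by (cases x; cases y) (simp_all add: cupw_def capw_def algebra_simps)
  show "axact (pw q) (Axis, Xo) F (x # xs) (y # ys) =
     fst q / dA * (capw (inverse var_A) x y * trace F xs ys) + F (x # xs) (y # ys)"
    "axact (pw q) (Axis, Xu) F (x # xs) (y # ys) =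
     snd q / dA * (capw (inverse var_A) x y * trace F xs ys) + F (x # xs) (y # ys)"
    using *[of "fst q / dA"] *[of "snd q / dA"] by (simp_all add: pw_simps)
qed

lemma Word_SI: "Word (SI # w) (x # xs) (y # ys) = capw (inverse var_A) x y * Word w xs ys"
  by (auto simp: capw_def)

lemma rep_axis_crossing:
  assumes c: "(\<lambda>q. c q) \<in> polyf" "length w = Suc n"
    and W: "\<And>q x xs y ys. axact (pw q) (Axis, p) (Word w) (x # xs) (y # ys) =
     c q / dA * (capw (inverse var_A) x y * trace (Word w) xs ys) + Word w (x # xs) (y # ys)"
  shows "rep (Suc n) (\<lambda>q xs ys. 1 * ev2 (pw q) [(Axis, p)] (Word w) xs ys)"
proof -
  have cancel: "c / d * (k * (d * w)) = c * (k * w)" if "d \<noteq> 0" for c d k w :: ratfun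
    using that by simp
  obtain s w' where w: "w = s # w'" "length w' = n" using assms(2) by (cases w) auto
  show ?thesis
  proof (cases "charged s")
    case True
    show ?thesis
    proof (rule rep_cong[OF rep_Word[OF assms(2)]])
      fix q and xs ys :: "bool list" assume "length xs = Suc n" "length ys = Suc n"
      then obtain x xs' y ys' where "xs = x # xs'" "ys = y # ys'" by (cases xs; cases ys) auto
      then show "1 * ev2 (pw q) [(Axis, p)] (Word w) xs ys = Word w xs ys"
        using W[of q x xs' y ys'] trace_Word[of s w' xs' ys'] True by (simp add: w)
    qed
  next
    case False
    show ?thesis
    proof (rule rep_cong[OF rep_plus[OF rep_scale[OF rep_Word c(1)] rep_Word[OF assms(2)]]])
      show "length (SI # w') = Suc n" using w by simp
      fix q and xs ys :: "bool list" assume "length xs = Suc n" "length ys = Suc n"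
      then obtain x xs' y ys' where xy: "xs = x # xs'" "ys = y # ys'" by (cases xs; cases ys) auto
      have "c q / dA * (capw (inverse var_A) x y * (dA * Word w' xs' ys')) = c q * Word (SI # w') (x # xs') (y # ys')"
        unfolding Word_SI by (rule cancel[OF circle_nonzero(1)])
      then show "1 * ev2 (pw q) [(Axis, p)] (Word w) xs ys = c q * Word (SI # w') xs ys + Word w xs ys"
        using W[of q x xs' y ys'] trace_Word[of s w' xs' ys'] False
        by (simp only: xy w(1) ev2.simps if_False mult_1)
    qed
  qed
qed

text \<open>The exponent of the circle value with which an event, together with its mirror image,
  preserves the lattice.\<close>

fun gain :: "place \<times> piece \<Rightarrow> int" where
  "gain (L k, Cap) = 1" | "gain (L k, Cup) = - 1" | "gain (Axis, Cup) = - 1" | "gain _ = 0"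

lemma rep_event:
  assumes "not_right e" "valid_at e a a" "length w = left_after e a"
  shows "rep a (\<lambda>q xs ys. dA powi gain e * ev2 (pw q) (double [e]) (Word w) xs ys)"
proof -
  obtain pl p where e: "e = (pl, p)" by (cases e)
  have inv: "dA powi - 1 = inverse dA" by (simp only: power_int_minus power_int_1_right)
  show ?thesis
  proof (cases pl)
    case (L k)
    show ?thesis
    proof (cases p)
      case Cup
      then show ?thesis using rep_cup[of k a w] assms by (simp add: e L inv del: ev2.simps)
    next
      case Cap
      then have "a = (a - 2) + 2" using assms by (simp add: e L)
      then show ?thesis using rep_cap[of k "a - 2" w] assms Cap by (simp add: e L del: ev2.simps)
    next
      case Xo
      then show ?thesis using rep_crossing[of p k a w] assms by (simp add: e L del: ev2.simps)
    next
      case Xu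
      then show ?thesis using rep_crossing[of p k a w] assms by (simp add: e L del: ev2.simps)
    qed
  next
    case Axis
    show ?thesis
    proof (cases p)
      case Cup
      then obtain s w' where w: "w = s # w'" "length w' = a" using assms by (cases w) (auto simp: e Axis)
      show ?thesis
      proof (cases "charged s")
        case True
        show ?thesis
        proof (rule rep_cong[OF rep_0])
          fix q and xs ys :: "bool list"
          have "trace (Word (s # w')) xs ys = 0" using trace_Word True by (simp only: if_True)
          then show "dA powi gain e * ev2 (pw q) (double [e]) (Word w) xs ys = 0"
            by (simp only: e Axis Cup double_simps ev2.simps axact_Axis(1) w(1) mult_zero_right)
        qed
      next
        case False
        show ?thesis
        proof (rule rep_cong[OF rep_Word[OF w(2)]])
          fix q and xs ys :: "bool list"
          have "ev2 (pw q) (double [e]) (Word w) xs ys = dA * Word w' xs ys"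
            using trace_Word[of s w' xs ys] False
            by (simp only: e Axis Cup double_simps ev2.simps axact_Axis(1) w(1) if_False)
          moreover have "dA powi gain e = inverse dA" using inv by (simp add: e Axis Cup del: power_int_minus1_right)
          ultimately show "dA powi gain e * ev2 (pw q) (double [e]) (Word w) xs ys = Word w' xs ys"
            using left_inverse[OF circle_nonzero(1)] by (simp only: mult.assoc[symmetric] mult_1)
        qed
      qed
    next
      case Cap
      then have a: "a = Suc (length w)" using assms by (simp add: e Axis)
      show ?thesis
      proof (rule rep_cong[OF rep_Word[of "SI # w" a]])
        fix q and xs ys :: "bool list" assume "length xs = a" "length ys = a"
        then obtain x xs' y ys' where xy: "xs = x # xs'" "ys = y # ys'" using a by (cases xs; cases ys) auto
        show "dA powi gain e * ev2 (pw q) (double [e]) (Word w) xs ys = Word (SI # w) xs ys"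
          by (simp only: e Axis Cap double_simps ev2.simps axact_Axis(2) xy Word_SI gain.simps power_int_0_right mult_1)
      qed (use a in simp)
    next
      case Xo
      then obtain n where "a = Suc n" using assms by (cases a) (auto simp: e Axis)
      then show ?thesis using rep_axis_crossing[OF polyf_fst, of w n Xo] axact_Axis(3) assms Xo
        by (simp add: e Axis del: ev2.simps axact.simps)
    next
      case Xu
      then obtain n where "a = Suc n" using assms by (cases a) (auto simp: e Axis)
      then show ?thesis using rep_axis_crossing[OF polyf_snd, of w n Xu] axact_Axis(4) assms Xu
        by (simp add: e Axis del: ev2.simps axact.simps)
    qed
  qed (use assms in \<open>auto simp: e\<close>)
qed

lemma wf2_double:
  assumes "not_right e" "valid_at e a a" shows "wf2 a a (double [e]) (left_after e a) (left_after e a)"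
proof -
  obtain pl p where "e = (pl, p)" by (cases e)
  then show ?thesis using assms by (cases pl; cases p) auto
qed

text \<open>The exponent is a balance of strands and traversals that every single event respects,
  starting with zero at the top.\<close>

lemma rep_double:
  assumes "wf_half a T"
  shows "\<exists>j::int. 2 * j = int a - int (turns T) \<and> rep a (\<lambda>q xs ys. dA powi j * ev2 (pw q) (double T) eps2 xs ys)"
  using assms
proof (induction T arbitrary: a)
  case Nil
  have "rep 0 (\<lambda>q xs ys. eps2 xs ys :: ratfun)"
    by (rule rep_cong[OF rep_Word[of "[]"]]) (auto simp: eps2_def)
  then show ?case using Nil by (intro exI[of _ 0]) simp
next
  case (Cons e T)
  have e: "not_right e" "valid_at e a a" using Cons.prems by auto
  obtain j where j: "2 * j = int (left_after e a) - int (turns T)"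
    "rep (left_after e a) (\<lambda>q xs ys. dA powi j * ev2 (pw q) (double T) eps2 xs ys)"
    using Cons by auto
  have "rep a (\<lambda>q xs ys. dA powi gain e * ev2 (pw q) (double [e]) (\<lambda>xs ys. dA powi j * ev2 (pw q) (double T) eps2 xs ys) xs ys)"
    using rep_ev2[OF wf2_double[OF e] rep_event[OF e] j(2)] .
  moreover have "dA powi gain e * ev2 W (double [e]) (\<lambda>xs ys. dA powi j * ev2 W (double T) eps2 xs ys) xs ys =
      dA powi (gain e + j) * ev2 W (double (e # T)) eps2 xs ys" for W xs ys
  proof -
    have "double (e # T) = double [e] @ double T" by (simp add: double_def)
    moreover have "ev2 W (double [e]) (\<lambda>xs ys. dA powi j * F xs ys) xs ys = dA powi j * ev2 W (double [e]) F xs ys" for F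
      using fun_cong[OF fun_cong[OF ev2_linear[of W "double [e]" "dA powi j" F 0 F]], of xs ys]
      by (simp only: mult_zero_left add_0_right)
    moreover have "dA powi (gain e + j) = dA powi gain e * dA powi j"
      by (rule power_int_add) (use circle_nonzero(1) in blast)
    ultimately show ?thesis by (simp only: ev2_append mult.assoc)
  qed
  ultimately have "rep a (\<lambda>q xs ys. dA powi (gain e + j) * ev2 (pw q) (double (e # T)) eps2 xs ys)" by simp
  moreover have "2 * (gain e + j) = int a - int (turns (e # T))"
  proof -
    obtain pl p where ep: "e = (pl, p)" by (cases e)
    show ?thesis using j(1) e
      by (cases pl; cases p) (auto simp: ep algebra_simps of_nat_diff)
  qed
  ultimately show ?case by blast
qed

text \<open>No strands below and two traversals give the balance -1: exactly one circle value
  divides out, the one by which the normalisation of the bracket divides.\<close>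

lemma reduced_polyf:
  assumes "wf_half 0 T" "turns T = 2"
  shows "(\<lambda>q. inverse dA * reduced var_A q (double T)) \<in> polyf"
proof -
  obtain j :: int where j: "2 * j = - 2" and rep: "rep 0 (\<lambda>q xs ys. dA powi j * ev2 (pw q) (double T) eps2 xs ys)"
    using rep_double[OF assms(1)] assms(2) by auto
  have "dA powi j = inverse dA"
  proof -
    have "j = - 1" using j by simp
    then show ?thesis by (simp only: power_int_minus power_int_1_right)
  qed
  moreover obtain G where G: "lat 0 G" "\<forall>p xs ys. length xs = 0 \<longrightarrow> length ys = 0 \<longrightarrow> dA powi j * ev2 (pw p) (double T) eps2 xs ys = G p xs ys"
    using rep unfolding rep_def by blast
  ultimately have eq: "(\<lambda>q. inverse dA * reduced var_A q (double T)) = (\<lambda>q. G q [] [])"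
    unfolding reduced_def pw_def[symmetric] by (intro ext) auto
  from G(1) have "(\<lambda>q. G q [] []) \<in> polyf"
  proof (induction rule: lat.induct)
    case lat_0
    then show ?case using polyf_const[OF laurent_A_ring(5)] by simp
  next
    case (lat_add F c w)
    then show ?case using polyf_add[of "\<lambda>p. F p [] []" c] by simp
  qed
  then show ?thesis unfolding eq .
qed

subsection \<open>Partial knots\<close>

definition mir :: "diagram \<Rightarrow> diagram" where "mir D = map (\<lambda>(i, p). (i, mirror p)) D"
definition shift :: "diagram \<Rightarrow> diagram" where "shift D = map (\<lambda>(i, p). (Suc i, p)) D"
definition lft :: "diagram \<Rightarrow> axis_diagram" where "lft D = map (\<lambda>(k, p). (L k, p)) D"
definition rgt :: "diagram \<Rightarrow> axis_diagram" where "rgt D = map (\<lambda>(k, p). (R k, p)) D"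

lemma list_map_simps [simp]:
  "mir [] = []" "mir ((i, p) # D) = (i, mirror p) # mir D" "mir (D @ E) = mir D @ mir E"
  "shift [] = []" "shift ((i, p) # D) = (Suc i, p) # shift D" "shift (D @ E) = shift D @ shift E"
  "lft [] = []" "lft ((i, p) # D) = (L i, p) # lft D" "lft (D @ E) = lft D @ lft E"
  "rgt [] = []" "rgt ((i, p) # D) = (R i, p) # rgt D" "rgt (D @ E) = rgt D @ rgt E"
  by (auto simp: mir_def shift_def lft_def rgt_def)

lemma mirror_Cup_Cap [simp]: "mirror p = Cup \<longleftrightarrow> p = Cup" "mirror p = Cap \<longleftrightarrow> p = Cap"
  "strands_after (mirror p) n = strands_after p n"
  by (cases p; simp)+

lemma wfs_mir [simp]: "wfs n (mir D) m = wfs n D m"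
  by (induction n D m rule: wfs.induct) auto

lemma mir_shift: "mir (shift D) = shift (mir D)"
  by (induction D) auto

lemma wfs_shift: "wfs n D m \<Longrightarrow> wfs (Suc n) (shift D) (Suc m)"
proof (induction n D m rule: wfs.induct)
  case (2 n i p D m)
  have "strands_after p (Suc n) = Suc (strands_after p n)" if "p \<noteq> Cup \<longrightarrow> 2 \<le> n"
    using that by (cases p) auto
  then show ?case using 2 by (cases "p = Cup") auto
qed simp

lemma evf_shift: "evf (tag w (shift D)) \<phi> (x # xs) = evf (tag w D) (\<lambda>xs. \<phi> (x # xs)) xs"
proof (induction D arbitrary: xs)
  case (Cons e D)
  obtain i p where e: "e = (i, p)" by (cases e)
  have "evf (tag w (shift (e # D))) \<phi> (x # xs) = act (length [x] + i, p, w p) (evf (tag w (shift D)) \<phi>) ([x] @ xs)"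
    by (simp add: e)
  also have "\<dots> = act (i, p, w p) (\<lambda>xs. evf (tag w (shift D)) \<phi> (x # xs)) xs"
    unfolding act_shift by simp
  also have "(\<lambda>xs. evf (tag w (shift D)) \<phi> (x # xs)) = evf (tag w D) (\<lambda>xs. \<phi> (x # xs))"
    by (rule ext) (rule Cons.IH)
  finally show ?case by (simp add: e)
qed simp

section \<open>One-strand tangles and reflected diagrams\<close>

lemma bracket_scalar:
  fixes a b :: "'r::comm_ring_1"
  assumes "a * b = 1" "wfs 1 D 1"
  shows "\<exists>k. \<forall>\<phi> xs. length xs = 1 \<longrightarrow> evf (tag (bw a b) D) \<phi> xs = k * \<phi> xs"
  using assms(2)
proof (induction rule: crossing_induct)
  case (crossingless D)
  then obtain k where "circ D k" using circ_exists[of 1 D] by auto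
  then show ?case using circ_evf[OF _ zigzag_bw(1)[OF assms(1)] crossingless(1)] by blast
next
  case (smoothing u i p v)
  then obtain k1 k2 where k: "\<And>\<phi> xs. length xs = 1 \<Longrightarrow> evf (tag (bw a b) (u @ [(i, Cap), (i, Cup)] @ v)) \<phi> xs = k1 * \<phi> xs"
    "\<And>\<phi> xs. length xs = 1 \<Longrightarrow> evf (tag (bw a b) (u @ v)) \<phi> xs = k2 * \<phi> xs" by blast
  have "evf (tag (bw a b) (u @ (i, p) # v)) \<phi> xs = (hcoeff a b p * k1 + hcoeff b a p * k2) * \<phi> xs"
    if "length xs = 1" for \<phi> xs
    unfolding evf_smoothing[OF smoothing(1,2) that] k[OF that] by (simp add: algebra_simps)
  then show ?case by blast
qed

fun flip_coeff :: "'r::comm_ring_1 \<Rightarrow> 'r \<Rightarrow> piece \<Rightarrow> 'r" where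
  "flip_coeff a b Cup = - (a\<^sup>2)" | "flip_coeff a b Cap = - (b\<^sup>2)" | "flip_coeff a b _ = 1"

abbreviation flipped :: "(piece \<Rightarrow> 'r weight) \<Rightarrow> piece \<Rightarrow> 'r weight" where
  "flipped w \<equiv> \<lambda>p. flip (w p)"

text \<open>Reading an event from right to left inverts A and mirrors crossings, up to a scalar at
  each extremum. So the left half, counted outwards, is the bracket of its mirror image at the
  inverse parameter.\<close>

lemma flip_bw:
  assumes "a * b = (1::'r::comm_ring_1)"
  shows "flip (bw a b p) x y c d = flip_coeff a b p * bw b a (mirror p) x y c d"
  using assms by (cases p; cases x; cases y; cases c; cases d)
    (simp_all add: flip_def hv_def capw_def cupw_def power2_inv[OF assms] power2_eq_square algebra_simps)

lemma evf_flip: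
  assumes "a * b = (1::'r::comm_ring_1)"
  shows "evf (tag (flipped (bw a b)) D) \<phi> xs = (\<Prod>e\<leftarrow>D. flip_coeff a b (snd e)) * evf (tag (bw b a) (mir D)) \<phi> xs"
proof (induction D arbitrary: xs)
  case (Cons e D)
  obtain i p where e: "e = (i, p)" by (cases e)
  define k where "k = (\<Prod>e\<leftarrow>D. flip_coeff a b (snd e))"
  have "evf (tag (flipped (bw a b)) (e # D)) \<phi> xs = act (i, p, flip (bw a b p)) (evf (tag (flipped (bw a b)) D) \<phi>) xs"
    by (simp add: e)
  also have "evf (tag (flipped (bw a b)) D) \<phi> = (\<lambda>xs. k * evf (tag (bw b a) (mir D)) \<phi> xs + 0 * \<phi> xs)"
    by (rule ext) (simp add: Cons.IH k_def)
  also have "act (i, p, flip (bw a b p)) (\<lambda>xs. k * evf (tag (bw b a) (mir D)) \<phi> xs + 0 * \<phi> xs) xs =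
      k * act (i, p, flip (bw a b p)) (evf (tag (bw b a) (mir D)) \<phi>) xs"
    unfolding act_linear by (simp only: mult_zero_left add_0_right)
  also have "act (i, p, flip (bw a b p)) (evf (tag (bw b a) (mir D)) \<phi>) xs =
      flip_coeff a b p * act (i, p, bw b a (mirror p)) (evf (tag (bw b a) (mir D)) \<phi>) xs"
    by (rule act_scale_weight) (rule flip_bw[OF assms])
  also have "act (i, p, bw b a (mirror p)) (evf (tag (bw b a) (mir D)) \<phi>) xs = evf (tag (bw b a) (mir (e # D))) \<phi> xs"
    by (simp add: e act_mirror)
  finally show ?case by (simp add: e k_def algebra_simps)
qed simp

lemma bracket_scalar_flipped:
  fixes a b :: "'r::comm_ring_1"
  assumes "a * b = 1" "wfs 1 D 1"
  shows "\<exists>k. \<forall>\<phi> xs. length xs = 1 \<longrightarrow> evf (tag (flipped (bw a b)) D) \<phi> xs = k * \<phi> xs"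
proof -
  have "b * a = 1" using assms(1) by (simp add: mult.commute)
  then obtain k where "\<forall>\<phi> xs. length xs = 1 \<longrightarrow> evf (tag (bw b a) (mir D)) \<phi> xs = k * \<phi> xs"
    using bracket_scalar[of b a "mir D"] assms(2) by auto
  then have "evf (tag (flipped (bw a b)) D) \<phi> xs = ((\<Prod>e\<leftarrow>D. flip_coeff a b (snd e)) * k) * \<phi> xs"
    if "length xs = 1" for \<phi> xs
    unfolding evf_flip[OF assms(1)] using that by (simp add: mult.assoc)
  then show ?thesis by blast
qed

text \<open>
  The diagram is cut open at both traversals; \<open>c\<close> and \<open>h\<close> are the labels at the lower and upper cut.
  Joining the remaining ends outwards gives a one-strand tangle, which acts as a scalar.
\<close>

definition amplitude :: "(piece \<Rightarrow> 'r::comm_ring_1 weight) \<Rightarrow> diagram \<Rightarrow> diagram \<Rightarrow> diagram \<Rightarrow> bool \<Rightarrow> bool \<Rightarrow> 'r" where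
  "amplitude w u m v c h = evf (tag w u) (\<lambda>xs. evf (tag w m) (\<lambda>xs. of_bool (hd xs = h) * evf (tag w v) eps (tl xs)) (c # xs)) []"

lemma amplitude_scalar:
  assumes wf: "wfs 0 u a" "wfs (Suc a) m (Suc b)" "wfs b v 0"
    and sc: "\<And>D. wfs 1 D 1 \<Longrightarrow> \<exists>k. \<forall>\<phi> xs. length xs = 1 \<longrightarrow> evf (tag w D) \<phi> xs = k * \<phi> xs"
  shows "\<exists>k. \<forall>c h. amplitude w u m v c h = k * of_bool (c = h)"
proof -
  let ?T = "shift u @ m @ shift v"
  have "wfs 1 ?T 1" using wfs_shift[OF wf(1)] wfs_shift[OF wf(3)] wf(2) by (auto simp: wfs_append)
  then obtain k where k: "\<And>\<phi> xs. length xs = 1 \<Longrightarrow> evf (tag w ?T) \<phi> xs = k * \<phi> xs" using sc by blast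
  have "amplitude w u m v c h = k * of_bool (c = h)" for c h
  proof -
    \<comment> \<open>The functional that tests the label at the upper end of the one-strand tangle;
      its value from the lower label \<open>c\<close> is the amplitude.\<close>
    let ?\<phi> = "\<lambda>z. of_bool (z = [h]) :: 'a"
    have "evf (tag w v) (\<lambda>xs. of_bool (x # xs = [h])) ys = of_bool (x = h) * evf (tag w v) eps ys" for x ys
    proof -
      have "(\<lambda>xs. of_bool (x # xs = [h])) = (\<lambda>xs. of_bool (x = h) * eps xs)"
        by (auto simp: eps_def intro!: ext)
      then have "evf (tag w v) (\<lambda>xs. of_bool (x # xs = [h])) ys = evf (tag w v) (\<lambda>xs. of_bool (x = h) * eps xs) ys"
        by (rule arg_cong[of _ _ "\<lambda>f. evf (tag w v) f ys"])
      then show ?thesis unfolding evf_scale .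
    qed
    then have v: "evf (tag w (shift v)) ?\<phi> (x # ys) = of_bool (x = h) * evf (tag w v) eps ys" for x ys
      unfolding evf_shift .
    have m: "evf (tag w (m @ shift v)) ?\<phi> ys = evf (tag w m) (\<lambda>xs. of_bool (hd xs = h) * evf (tag w v) eps (tl xs)) ys"
      if "length ys = Suc a" for ys
      unfolding tag_simps evf_append
    proof (rule evf_cong)
      show "wfs (Suc a) (untag (tag w m)) (Suc b)" using wf(2) by simp
      fix zs :: "bool list" assume "length zs = Suc b"
      then obtain z zs' where "zs = z # zs'" by (cases zs) auto
      then show "evf (tag w (shift v)) ?\<phi> zs = of_bool (hd zs = h) * evf (tag w v) eps (tl zs)" by (simp add: v)
    qed (rule that)
    have "evf (tag w ?T) ?\<phi> [c] = evf (tag w u) (\<lambda>xs. evf (tag w (m @ shift v)) ?\<phi> (c # xs)) []"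
      by (simp only: tag_simps evf_append evf_shift)
    also have "\<dots> = amplitude w u m v c h"
      unfolding amplitude_def by (rule evf_cong[of 0 _ a]) (simp_all only: untag_tag wf(1) m list.size length_Cons)
    finally show ?thesis using k[of "[c]" ?\<phi>] by simp
  qed
  then show ?thesis by blast
qed

text \<open>The strand created innermost by \<open>(0, Cup)\<close> passes \<open>m\<close> on the
  side of the axis: it is the vertical strand of the partial knot. It closes a one-strand tangle
  with scalar \<open>k\<close>, leaving \<open>k\<close> times a circle.\<close>

lemma ev_closed_amplitude:
  assumes wf: "wfs 0 u a" "wfs (Suc a) m (Suc b)" and k: "\<And>c h. amplitude w u m v c h = k * of_bool (c = h)"
    and z: "zigzag w d"
  shows "evf (tag w (u @ [(0, Cup)] @ shift m @ [(0, Cap)] @ v)) eps [] = k * d"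
proof -
  let ?f = "\<lambda>c h xs. evf (tag w m) (\<lambda>xs. of_bool (hd xs = h) * evf (tag w v) eps (tl xs)) (c # xs)"
  have cap: "evf (tag w m) (\<lambda>xs. evf (tag w ([(0, Cap)] @ v)) eps (z # xs)) (c # xs) =
      w Cap z True z True * ?f c True xs + w Cap z False z False * ?f c False xs" if "length xs = a" for z c xs
  proof -
    have "evf (tag w m) (\<lambda>xs. evf (tag w ([(0, Cap)] @ v)) eps (z # xs)) (c # xs) =
      evf (tag w m) (\<lambda>xs. w Cap z True z True * (of_bool (hd xs = True) * evf (tag w v) eps (tl xs)) +
        w Cap z False z False * (of_bool (hd xs = False) * evf (tag w v) eps (tl xs))) (c # xs)"
    proof (rule evf_cong)
      show "wfs (Suc a) (untag (tag w m)) (Suc b)" using wf(2) by simp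
      fix ys :: "bool list" assume "length ys = Suc b"
      then obtain y ys' where "ys = y # ys'" by (cases ys) auto
      then show "evf (tag w ([(0, Cap)] @ v)) eps (z # ys) = w Cap z True z True * (of_bool (hd ys = True) * evf (tag w v) eps (tl ys)) +
        w Cap z False z False * (of_bool (hd ys = False) * evf (tag w v) eps (tl ys))"
        by (cases y) auto
    qed (use that in simp)
    then show ?thesis by (simp only: evf_linear)
  qed
  have "evf (tag w (u @ [(0, Cup)] @ shift m @ [(0, Cap)] @ v)) eps [] =
    evf (tag w u) (\<lambda>xs. \<Sum>z\<in>UNIV. \<Sum>c\<in>UNIV. w Cup z c z c *
      evf (tag w m) (\<lambda>xs. evf (tag w ([(0, Cap)] @ v)) eps (z # xs)) (c # xs)) []"
  proof -
    have cup: "act (0, Cup, w Cup) \<phi> = (\<lambda>xs. \<Sum>z\<in>UNIV. \<Sum>c\<in>UNIV. w Cup z c z c * \<phi> (z # c # xs))" for \<phi>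
      by (rule ext) simp
    show ?thesis by (simp only: tag_simps evf_append evf.simps cup evf_shift)
  qed
  also have "\<dots> = evf (tag w u) (\<lambda>xs. \<Sum>z\<in>UNIV. \<Sum>c\<in>UNIV. w Cup z c z c *
      (w Cap z True z True * ?f c True xs + w Cap z False z False * ?f c False xs)) []"
    by (rule evf_cong[of 0 _ a]) (use wf(1) in \<open>auto simp only: cap untag_tag list.size\<close>)
  also have "\<dots> = evf (tag w u) (\<lambda>xs.
      1 * (1 * ((w Cup True True True True * w Cap True True True True + w Cup False True False True * w Cap False True False True) * ?f True True xs +
      (w Cup True True True True * w Cap True False True False + w Cup False True False True * w Cap False False False False) * ?f True False xs) +
      (w Cup True False True False * w Cap True True True True + w Cup False False False False * w Cap False True False True) * ?f False True xs) +
      (w Cup True False True False * w Cap True False True False + w Cup False False False False * w Cap False False False False) * ?f False False xs) []"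
    by (simp only: sum_bool) (simp add: algebra_simps)
  also have "\<dots> = (w Cup True True True True * w Cap True True True True + w Cup False True False True * w Cap False True False True) * k +
      (w Cup True False True False * w Cap True False True False + w Cup False False False False * w Cap False False False False) * k"
    unfolding evf_linear amplitude_def[symmetric] k by simp
  also have "\<dots> = k * d"
    using z unfolding zigzag_def sum_bool by (auto simp: algebra_simps)
  finally show ?thesis .
qed

lemma evf_swap: "evf E (\<lambda>x. act e (F x) y) u = act e (\<lambda>y. evf E (\<lambda>x. F x y) u) y"
proof (induction E arbitrary: u)
  case (Cons e' E)
  have "evf E (\<lambda>x. act e (F x) y) = (\<lambda>u. act e (\<lambda>y. evf E (\<lambda>x. F x y) u) y)"
    by (rule ext) (rule Cons.IH)
  then show ?case using act_swap[of e' e "\<lambda>u y. evf E (\<lambda>x. F x y) u" y u] by simp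
qed simp

text \<open>Between two axis events the sides do not interact, so their actions can be collected
  separately.\<close>

lemma ev2_double_lft:
  "ev2 (\<lambda>_. w) (double (lft u)) F xs ys = evf (tag (flipped w) u) (\<lambda>xs. evf (tag w (mir u)) (F xs) ys) xs"
proof (induction u arbitrary: xs ys)
  case (Cons e u)
  obtain k p where e: "e = (k, p)" by (cases e)
  have "ev2 (\<lambda>_. w) (double (lft (e # u))) F xs ys =
    act (k, p, flip (w p)) (\<lambda>xs. act (k, mirror p, w (mirror p)) (ev2 (\<lambda>_. w) (double (lft u)) F xs) ys) xs"
    by (simp add: e)
  also have "ev2 (\<lambda>_. w) (double (lft u)) F = (\<lambda>xs ys. evf (tag (flipped w) u) (\<lambda>xs. evf (tag w (mir u)) (F xs) ys) xs)"
    by (intro ext) (rule Cons.IH)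
  also have "act (k, p, flip (w p)) (\<lambda>xs. act (k, mirror p, w (mirror p)) (\<lambda>ys. evf (tag (flipped w) u) (\<lambda>xs. evf (tag w (mir u)) (F xs) ys) xs) ys) xs
    = act (k, p, flip (w p)) (\<lambda>xs. evf (tag (flipped w) u) (\<lambda>xs. act (k, mirror p, w (mirror p)) (evf (tag w (mir u)) (F xs)) ys) xs) xs"
    using evf_swap[of "tag (flipped w) u" "(k, mirror p, w (mirror p))" "\<lambda>xs. evf (tag w (mir u)) (F xs)" ys] by simp
  finally show ?case by (simp add: e)
qed simp

lemma evf_product: "evf E (\<lambda>xs. evf E' (\<lambda>ys. \<phi> xs * \<psi> ys) ys) xs = evf E \<phi> xs * evf E' \<psi> ys"
  using evf_scale[of E "evf E' \<psi> ys" \<phi> xs] by (simp add: evf_scale mult.commute)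

lemma double_append [simp]: "double (S @ T) = double S @ double T"
  by (simp add: double_def)

text \<open>Each side transmits the label of the lower cut unchanged to the upper cut, up to its
  scalar. What is left of the sum over the labels at the two traversals is a single circle.\<close>

lemma ev2_two_traversals:
  fixes a b :: "'r::comm_ring_1"
  assumes ab: "a * b = 1" and wf: "wfs 0 u n" "wfs (Suc n) m (Suc n')" "wfs n' v 0"
    and l: "\<And>c h. amplitude (flipped (bw a b)) u m v c h = k * of_bool (c = h)"
    and r: "\<And>c h. amplitude (bw a b) (mir u) (mir m) (mir v) c h = k' * of_bool (c = h)"
  shows "ev2 (\<lambda>_. bw a b) (double (lft u @ (Axis, Cup) # lft m @ (Axis, Cap) # lft v)) eps2 [] [] = k * k' * (- (a\<^sup>2) - b\<^sup>2)"
proof -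
  let ?L = "tag (flipped (bw a b))" and ?R = "tag (bw a b)"
  let ?f = "\<lambda>h xs. of_bool (hd xs = h) * evf (?L v) eps (tl xs)"
  let ?g = "\<lambda>h ys. of_bool (hd ys = h) * evf (?R (mir v)) eps (tl ys)"
  let ?F = "\<lambda>c h xs. evf (?L m) (?f h) (c # xs)" and ?G = "\<lambda>d h ys. evf (?R (mir m)) (?g h) (d # ys)"
  have top: "ev2 (\<lambda>_. bw a b) (double (lft v)) eps2 xs ys = evf (?L v) eps xs * evf (?R (mir v)) eps ys" for xs ys
  proof -
    have e2: "(eps2 :: bool list \<Rightarrow> bool list \<Rightarrow> 'r) = (\<lambda>xs ys. eps xs * eps ys)"
      by (auto simp: eps2_def eps_def intro!: ext)
    show ?thesis unfolding ev2_double_lft by (subst e2) (rule evf_product)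
  qed
  have cap: "ev2 (\<lambda>_. bw a b) (double ((Axis, Cap) # lft v)) eps2 xs ys =
      1 * (?f True xs * ?g False ys) + (- (b\<^sup>2)) * (?f False xs * ?g True ys)" for xs ys
    by (cases "hd xs"; cases "hd ys") (simp_all add: top capw_def)
  have lin2: "evf E (\<lambda>xs. evf E' (\<lambda>ys. c * (\<phi> xs * \<psi> ys) + d * (\<phi>' xs * \<psi>' ys)) ys) xs =
    c * (evf E \<phi> xs * evf E' \<psi> ys) + d * (evf E \<phi>' xs * evf E' \<psi>' ys)"
    for E E' and c d :: 'r and \<phi> \<psi> \<phi>' \<psi>' xs ys
    unfolding evf_linear by (simp only: evf_product)
  have mid: "ev2 (\<lambda>_. bw a b) (double (lft m @ (Axis, Cap) # lft v)) eps2 xs ys =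
      1 * (evf (?L m) (?f True) xs * evf (?R (mir m)) (?g False) ys) +
      (- (b\<^sup>2)) * (evf (?L m) (?f False) xs * evf (?R (mir m)) (?g True) ys)" for xs ys
  proof -
    have "ev2 (\<lambda>_. bw a b) (double ((Axis, Cap) # lft v)) eps2 = (\<lambda>xs ys. 1 * (?f True xs * ?g False ys) + (- (b\<^sup>2)) * (?f False xs * ?g True ys))"
      by (intro ext) (rule cap)
    then show ?thesis unfolding double_append ev2_append ev2_double_lft by (simp only: lin2)
  qed
  have cup: "ev2 (\<lambda>_. bw a b) (double ((Axis, Cup) # lft m @ (Axis, Cap) # lft v)) eps2 = (\<lambda>xs ys.
      1 * (- (a\<^sup>2) * (?F True True xs * ?G False False ys) + 1 * (?F True False xs * ?G False True ys)) +
      1 * (1 * (?F False True xs * ?G True False ys) + - (b\<^sup>2) * (?F False False xs * ?G True True ys)))"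
    by (intro ext, simp only: double_simps ev2.simps axact.simps mid)
       (simp add: sum_bool cupw_def algebra_simps power2_inv[OF ab])
  have "ev2 (\<lambda>_. bw a b) (double (lft u @ (Axis, Cup) # lft m @ (Axis, Cap) # lft v)) eps2 [] [] =
    1 * (- (a\<^sup>2) * (evf (?L u) (?F True True) [] * evf (?R (mir u)) (?G False False) []) +
      1 * (evf (?L u) (?F True False) [] * evf (?R (mir u)) (?G False True) [])) +
    1 * (1 * (evf (?L u) (?F False True) [] * evf (?R (mir u)) (?G True False) []) +
      - (b\<^sup>2) * (evf (?L u) (?F False False) [] * evf (?R (mir u)) (?G True True) []))"
    unfolding double_append[of "lft u"] ev2_append ev2_double_lft cup
    by (simp only: evf_linear evf_product)
  also have "\<dots> = k * k' * (- (a\<^sup>2) - b\<^sup>2)"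
    unfolding l[unfolded amplitude_def] r[unfolded amplitude_def] by (simp add: algebra_simps)
  finally show ?thesis .
qed

section \<open>Event lists of the partial knots\<close>

abbreviation is_left :: "place \<times> piece \<Rightarrow> bool" where "is_left \<equiv> \<lambda>(a, p). \<exists>k. a = L k"
abbreviation is_right :: "place \<times> piece \<Rightarrow> bool" where "is_right \<equiv> \<lambda>(a, p). \<exists>k. a = R k"

lemma split_from_sides:
  "filter is_left (split_from b D) = filter is_left (split_from b (filter not_right D))"
  "filter is_right (split_from b D) = filter is_right (split_from b (filter not_left D))"
  by (induction b D rule: split_from.induct) (auto simp: not_right_def not_left_def)

lemma split_from_conj:
  "filter is_right (split_from b (map conj_event D)) = map conj_event (filter is_left (split_from b D))"
proof (induction D arbitrary: b)
  case (Cons e D)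
  obtain q p where e: "e = (q, p)" by (cases e)
  show ?case by (cases q; cases b; cases p) (simp_all add: e Cons.IH)
qed simp

lemma smooth_filter: "smooth_axis_vertically (filter P D) = filter P (smooth_axis_vertically D)"
  by (simp add: smooth_axis_vertically_def conj_commute)

lemma smooth_simps [simp]:
  "smooth_axis_vertically [] = []"
  "smooth_axis_vertically ((L k, p) # D) = (L k, p) # smooth_axis_vertically D"
  "smooth_axis_vertically ((R k, p) # D) = (R k, p) # smooth_axis_vertically D"
  "smooth_axis_vertically ((Axis, p) # D) =
     (if is_crossing p then smooth_axis_vertically D else (Axis, p) # smooth_axis_vertically D)"
  by (auto simp: smooth_axis_vertically_def)

lemma smooth_conj: "smooth_axis_vertically (map conj_event D) = map conj_event (smooth_axis_vertically D)"
proof (induction D)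
  case (Cons e D)
  then show ?case by (cases e; cases "fst e") auto
qed simp

lemma smooth_half:
  "wf_half a T \<Longrightarrow> wf_half a (smooth_axis_vertically T)"
  "turns (smooth_axis_vertically T) = turns T"
proof (induction T arbitrary: a)
  case (Cons e T)
  obtain q p where e: "e = (q, p)" by (cases e)
  { case 1 then show ?case using Cons.IH by (cases q; cases p) (auto simp: e) }
  { case 2 then show ?case using Cons.IH by (cases q; cases p) (auto simp: e) }
qed auto

text \<open>One side after splitting: a lower traversal that is a minimum, or an upper one that is a
  maximum, becomes an extremum with the new vertical strand; in the other cases the strands continue
  each other and the event disappears.\<close>

definition partial_list :: "diagram \<Rightarrow> piece \<Rightarrow> diagram \<Rightarrow> piece \<Rightarrow> diagram \<Rightarrow> diagram" where
  "partial_list u p m p' v = u @ (if p = Cup then [(0, Cup)] else []) @ shift m @ (if p' = Cap then [(0, Cap)] else []) @ v"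

lemma split_lft: "filter is_left (split_from b (lft u @ D)) = lft (if b then shift u else u) @ filter is_left (split_from b D)"
  by (induction u) (auto simp: lft_def shift_def)

lemma split_partial_list:
  assumes "\<not> is_crossing p" "\<not> is_crossing p'"
  shows "filter is_left (split_from False (lft u @ (Axis, p) # lft m @ (Axis, p') # lft v)) = lft (partial_list u p m p' v)"
  using assms split_lft[of False v "[]"] by (cases p; cases p') (simp_all add: split_lft partial_list_def)

lemma forget_rgt: "forget_axis (rgt D) = D"
proof -
  have "forget_from 0 (rgt D) = D" by (induction D) (auto simp: rgt_def)
  then show ?thesis by (simp add: forget_axis_def)
qed

lemma conj_lft: "map conj_event (lft D) = rgt (mir D)"
  by (induction D) auto

lemma partial_diagrams:
  assumes sym: "filter not_left D = map conj_event T" and T: "T = filter not_right D"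
    and split: "smooth_axis_vertically T = lft u @ (Axis, p) # lft m @ (Axis, p') # lft v"
    and p: "\<not> is_crossing p" "\<not> is_crossing p'"
  shows "partial_minus D = forget_axis (lft (partial_list u p m p' v))"
    and "partial_plus D = mir (partial_list u p m p' v)"
proof -
  show "partial_minus D = forget_axis (lft (partial_list u p m p' v))"
    unfolding partial_minus_def split_along_axis_def split_from_sides(1)[of False "smooth_axis_vertically D"]
    by (simp only: smooth_filter[symmetric] T[symmetric] split split_partial_list[OF p])
  show "partial_plus D = mir (partial_list u p m p' v)"
    unfolding partial_plus_def split_along_axis_def split_from_sides(2)[of False "smooth_axis_vertically D"]
    by (simp only: smooth_filter[symmetric] sym smooth_conj split_from_conj split split_partial_list[OF p]
        conj_lft forget_rgt)
qed

lemma ev2_lft: "ev2 (\<lambda>_. w) (lft D) F xs ys = evf (tag (flipped w) D) (\<lambda>xs. F xs ys) xs"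
proof (induction D arbitrary: xs)
  case (Cons e D)
  obtain k p where e: "e = (k, p)" by (cases e)
  have "(\<lambda>xs. ev2 (\<lambda>_. w) (lft D) F xs ys) = evf (tag (flipped w) D) (\<lambda>xs. F xs ys)"
    by (rule ext) (rule Cons.IH)
  then show ?case by (simp add: e)
qed simp

lemma wf2_lft: "wfs a D a' \<Longrightarrow> wf2 a b (lft D) a' b"
  by (induction a D a' rule: wfs.induct) auto

lemma ev_forget_lft:
  assumes "wfs 0 D 0" shows "ev w (forget_axis (lft D)) = evf (tag (flipped w) D) eps []"
proof -
  have "(\<lambda>xs. eps2 xs []) = (eps :: bool list \<Rightarrow> 'a)" by (auto simp: eps2_def eps_def intro!: ext)
  then show ?thesis using ev2_uniform[of "lft D" w] wf2_lft[OF assms, of 0]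
    by (simp add: wf_axis_wf2 ev2_lft)
qed

lemma prod_flip_coeff:
  assumes "wfs n D m"
  shows "\<exists>i j. n + 2 * i = m + 2 * j \<and> (\<Prod>e\<leftarrow>D. flip_coeff a b (snd e)) = (- (a\<^sup>2)) ^ i * (- (b\<^sup>2)) ^ j"
  using assms
proof (induction n D m rule: wfs.induct)
  case (1 n m)
  then show ?case by (intro exI[of _ 0]) auto
next
  case (2 n i p D m)
  then obtain i j where ij: "strands_after p n + 2 * i = m + 2 * j"
    "(\<Prod>e\<leftarrow>D. flip_coeff a b (snd e)) = (- (a\<^sup>2)) ^ i * (- (b\<^sup>2)) ^ j" by auto
  show ?case
  proof (cases p)
    case Cup
    then show ?thesis using ij by (intro exI[of _ "Suc i"] exI[of _ j]) (auto simp: algebra_simps)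
  next
    case Cap
    then show ?thesis using ij 2(2) by (intro exI[of _ i] exI[of _ "Suc j"]) (auto simp: algebra_simps)
  next
    case Xo
    then show ?thesis using ij by (intro exI[of _ i] exI[of _ j]) auto
  next
    case Xu
    then show ?thesis using ij by (intro exI[of _ i] exI[of _ j]) auto
  qed
qed

text \<open>A closed diagram has as many cups as caps, and their scalars are inverse to each
  other.\<close>

lemma prod_flip_coeff_closed:
  fixes a b :: "'r::comm_ring_1"
  assumes "a * b = 1" "wfs 0 D 0" shows "(\<Prod>e\<leftarrow>D. flip_coeff a b (snd e)) = 1"
proof -
  obtain i j where "0 + 2 * i = 0 + 2 * j" "(\<Prod>e\<leftarrow>D. flip_coeff a b (snd e)) = (- (a\<^sup>2)) ^ i * (- (b\<^sup>2)) ^ j"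
    using prod_flip_coeff[OF assms(2)] by blast
  then have "(\<Prod>e\<leftarrow>D. flip_coeff a b (snd e)) = (a\<^sup>2 * b\<^sup>2) ^ i"
    by (simp add: power_mult_distrib[symmetric])
  then show ?thesis using power2_inv(1)[OF assms(1)] by simp
qed

text \<open>The source of the relation between the Jones polynomials of the partial knots: one
  arises from the other by inverting t.\<close>

lemma bracket_mirror:
  assumes "wfs 0 D 0" "a \<noteq> (0::'r::field)"
  shows "bracket a (forget_axis (lft D)) = bracket (inverse a) (mir D)"
  unfolding ev_forget_lft[OF assms(1)]
  using evf_flip[of a "inverse a" D eps "[]"] prod_flip_coeff_closed[OF _ assms(1), of a "inverse a"] assms(2)
  by (simp add: ev_def)

lemma ow_mirror: "ow q r (mirror p) = ow r q p"
  by (cases p) (auto intro!: ext)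

lemma evf_ow_mir: "evf (tag (ow q r) (mir D)) \<phi> xs = evf (tag (ow r q) D) \<phi> xs"
proof -
  have "evf (tag (ow q r) (mir D)) \<phi> = evf (tag (ow r q) D) \<phi>"
  proof (induction D)
    case (Cons e D)
    then show ?case by (cases e) (auto simp: ow_mirror act_mirror intro!: ext)
  qed simp
  then show ?thesis by simp
qed

text \<open>The orientation sum of the mirror image has \<open>q\<close> inverted; its value at q =
  2 determines the exponent.\<close>

lemma writhe_mirror:
  assumes "wfs 0 D 0" "knot_diagram (forget_axis (lft D))" "knot_diagram (mir D)"
  shows "writhe (forget_axis (lft D)) = - writhe (mir D)"
proof -
  have "2 * (2::rat) powi writhe (forget_axis (lft D)) = ev (ow 2 (inverse 2)) (forget_axis (lft D))"
    by (rule ev_writhe[OF assms(2), symmetric]) simp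
  also have "\<dots> = evf (tag (ow 2 (inverse 2)) D) eps []"
    by (simp only: ev_forget_lft[OF assms(1)] flip_ow)
  also have "\<dots> = ev (ow (inverse 2) (inverse (inverse 2))) (mir D)"
    by (simp add: ev_def evf_ow_mir)
  also have "\<dots> = 2 * inverse 2 powi writhe (mir D)"
    by (rule ev_writhe[OF assms(3)]) simp
  also have "inverse 2 powi writhe (mir D) = (2::rat) powi (- writhe (mir D))"
    by (simp only: power_int_minus power_int_inverse)
  finally show ?thesis by (intro two_powi_inject) simp
qed

section \<open>Vertical smoothing and normal form of the traversals\<close>

lemma double_Cons: "double (e # T) = double [e] @ double T"
  by (simp add: double_def)

lemma axw_off: "axw a b x y False = bw a b" "\<not> is_crossing p \<Longrightarrow> axw a b x y ax p = bw a b p"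
  by (auto simp: axw_def intro!: ext)

text \<open>The weights are those at s = -1: the horizontal coefficients vanish, so every axis
  crossing acts as its vertical smoothing, that is, not at all.\<close>

lemma ev2_smooth:
  assumes "wf_half (length xs) T" "length ys = length xs"
  shows "ev2 (axw a b (0, 1) (0, 1)) (double T) F xs ys = ev2 (\<lambda>_. bw a b) (double (smooth_axis_vertically T)) F xs ys"
  using assms
proof (induction T arbitrary: xs ys)
  case (Cons e T)
  obtain q p where e: "e = (q, p)" by (cases e)
  let ?W = "axw a b (0, 1) (0, 1)"
  show ?case
  proof (cases "q = Axis \<and> is_crossing p")
    case True
    have "wf_half (length xs) T" using Cons.prems True by (cases p) (auto simp: e)
    moreover have "axact ?W (q, p) G xs ys = 0 * axact ?W (q, Cap) (axact ?W (q, Cup) G) xs ys + 1 * G xs ys" for G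
      by (rule axact_smoothing) (use True Cons.prems in \<open>auto simp: e axw_off axw_def is_crossing_def\<close>)
    ultimately show ?thesis using Cons.IH[of xs ys] Cons.prems(2) True by (simp add: e del: axact.simps)
  next
    case False
    have nr: "not_right e" "valid_at e (length xs) (length xs)" "wf_half (left_after e (length xs)) T"
      using Cons.prems(1) by auto
    have "ev2 ?W (double (e # T)) F xs ys = ev2 ?W (double [e]) (ev2 ?W (double T) F) xs ys"
      by (simp only: double_Cons[of e T] ev2_append)
    also have "\<dots> = ev2 ?W (double [e]) (ev2 (\<lambda>_. bw a b) (double (smooth_axis_vertically T)) F) xs ys"
      by (rule ev2_cong[of _ _ _ "left_after e (length xs)" "left_after e (length xs)"])
        (use wf2_double[OF nr(1,2)] Cons nr in auto)
    also have "\<dots> = ev2 (\<lambda>_. bw a b) (double [e]) (ev2 (\<lambda>_. bw a b) (double (smooth_axis_vertically T)) F) xs ys"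
      using False nr(1) by (cases q; cases p) (auto simp: e axw_off)
    also have "\<dots> = ev2 (\<lambda>_. bw a b) (double [e] @ double (smooth_axis_vertically T)) F xs ys"
      by simp
    also have "double [e] @ double (smooth_axis_vertically T) = double (smooth_axis_vertically (e # T))"
      using False nr(1) by (cases q) (auto simp: e)
    finally show ?thesis .
  qed
qed simp

lemma lft_split:
  assumes "wf_half a T" "smooth_axis_vertically T = T"
  shows "turns T = 0 \<and> (\<exists>u. T = lft u \<and> wfs a u 0) \<or>
    (\<exists>u p c T1. T = lft u @ (Axis, p) # T1 \<and> wfs a u c \<and> \<not> is_crossing p \<and> wf_half c ((Axis, p) # T1) \<and>
      smooth_axis_vertically T1 = T1 \<and> turns T = Suc (turns T1))"
  using assms
proof (induction T arbitrary: a)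
  case Nil
  then show ?case by (auto intro!: exI[of _ "[]"])
next
  case (Cons e T)
  obtain q p where e: "e = (q, p)" by (cases e)
  show ?case
  proof (cases q)
    case (L k)
    have wf: "wf_half (strands_after p a) T" "if p = Cup then k \<le> a else k + 2 \<le> a" and s: "smooth_axis_vertically T = T"
      using Cons.prems by (auto simp: e L)
    from Cons.IH[OF wf(1) s] show ?thesis
    proof (elim disjE exE conjE)
      fix u assume "turns T = 0" "T = lft u" "wfs (strands_after p a) u 0"
      then show ?thesis using wf(2) by (intro disjI1 conjI exI[of _ "(k, p) # u"]) (auto simp: e L)
    next
      fix u p' c T1 assume "T = lft u @ (Axis, p') # T1" "wfs (strands_after p a) u c" "\<not> is_crossing p'"
        "wf_half c ((Axis, p') # T1)" "smooth_axis_vertically T1 = T1" "turns T = Suc (turns T1)"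
      then show ?thesis using wf(2)
        by (intro disjI2 exI[of _ "(k, p) # u"] exI[of _ p'] exI[of _ c] exI[of _ T1]) (auto simp: e L)
    qed
  next
    case (R k)
    then show ?thesis using Cons.prems by (auto simp: e)
  next
    case Axis
    have "\<not> is_crossing p"
    proof
      assume "is_crossing p"
      then have "length (smooth_axis_vertically (e # T)) \<le> length T"
        by (simp add: e Axis smooth_axis_vertically_def)
      then show False using Cons.prems(2) by simp
    qed
    then show ?thesis using Cons.prems
      by (intro disjI2 exI[of _ "[]"] exI[of _ p] exI[of _ a] exI[of _ T]) (auto simp: e Axis)
  qed
qed

lemma smooth_idem: "smooth_axis_vertically (smooth_axis_vertically T) = smooth_axis_vertically T"
  by (simp add: smooth_axis_vertically_def)

fun trav_after :: "piece \<Rightarrow> nat \<Rightarrow> nat \<Rightarrow> bool" where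
  "trav_after Cup n n' \<longleftrightarrow> n' = Suc n" | "trav_after Cap n n' \<longleftrightarrow> n = Suc n'" | "trav_after _ n n' \<longleftrightarrow> False"

lemma trav_afterI: "wf_half c ((Axis, p) # T) \<Longrightarrow> \<not> is_crossing p \<Longrightarrow> \<exists>c'. trav_after p c c' \<and> wf_half c' T"
  by (cases p) (auto intro: exI[of _ "c - 1"])

lemma two_traversals:
  assumes "wf_half 0 T" "turns T = 2"
  obtains u p m p' v n1 n2 n3 n4 where
    "smooth_axis_vertically T = lft u @ (Axis, p) # lft m @ (Axis, p') # lft v"
    "wfs 0 u n1" "trav_after p n1 n2" "wfs n2 m n3" "trav_after p' n3 n4" "wfs n4 v 0"
    "\<not> is_crossing p" "\<not> is_crossing p'"
proof -
  define S where "S = smooth_axis_vertically T"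
  have S: "wf_half 0 S" "smooth_axis_vertically S = S" "turns S = 2"
    using assms smooth_half smooth_idem by (auto simp: S_def)
  obtain u p n1 T1 where 1: "S = lft u @ (Axis, p) # T1" "wfs 0 u n1" "\<not> is_crossing p" "wf_half n1 ((Axis, p) # T1)"
    "smooth_axis_vertically T1 = T1" "turns T1 = 1"
    using lft_split[OF S(1,2)] S(3) by auto
  obtain n2 where 2: "trav_after p n1 n2" "wf_half n2 T1" using trav_afterI[OF 1(4,3)] by blast
  obtain m p' n3 T2 where 3: "T1 = lft m @ (Axis, p') # T2" "wfs n2 m n3" "\<not> is_crossing p'" "wf_half n3 ((Axis, p') # T2)"
    "smooth_axis_vertically T2 = T2" "turns T2 = 0"
    using lft_split[OF 2(2) 1(5)] 1(6) by auto
  obtain n4 where 4: "trav_after p' n3 n4" "wf_half n4 T2" using trav_afterI[OF 3(4,3)] by blast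
  obtain v where "T2 = lft v" "wfs n4 v 0"
    using lft_split[OF 4(2) 3(5)] 3(6) by auto
  then show thesis using that 1 2 3 4 by (simp add: S_def)
qed

text \<open>
  A lower traversal that is a maximum is replaced by a traversing minimum followed by a maximum on
  each side, and similarly above, so that the traversals become a minimum and a maximum.
\<close>

definition norm_mid :: "piece \<Rightarrow> diagram \<Rightarrow> piece \<Rightarrow> diagram" where
  "norm_mid p m p' = (if p = Cap then [(0, Cap)] else []) @ m @ (if p' = Cup then [(0, Cup)] else [])"

lemma wfs_norm_mid:
  "trav_after p n1 n2 \<Longrightarrow> wfs n2 m n3 \<Longrightarrow> trav_after p' n3 n4 \<Longrightarrow> wfs (Suc n1) (norm_mid p m p') (Suc n4)"
  by (cases p; cases p') (auto simp: norm_mid_def wfs_append)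

lemma wf2_double_lft: "wfs a u a' \<Longrightarrow> wf2 a a (double (lft u)) a' a'"
  by (induction a u a' rule: wfs.induct) auto

text \<open>A zigzag across the axis, straightened on both sides at once; likewise for the maximum
  below.\<close>

lemma axact_Cup_straight:
  assumes "a * b = (1::'r::comm_ring_1)"
  shows "axact (\<lambda>_. bw a b) (Axis, Cup) F =
    axact (\<lambda>_. bw a b) (L 0, Cup) (axact (\<lambda>_. bw a b) (R 0, Cup) (axact (\<lambda>_. bw a b) (Axis, Cap) F))"
  by (intro ext) (simp add: sum_bool flip_def cupw_def capw_def power2_inv[OF assms] algebra_simps)

lemma axact_Cap_straight:
  assumes "a * b = (1::'r::comm_ring_1)"
  shows "axact (\<lambda>_. bw a b) (Axis, Cap) F (x # xs) (y # ys) =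
    axact (\<lambda>_. bw a b) (Axis, Cup) (axact (\<lambda>_. bw a b) (L 0, Cap) (axact (\<lambda>_. bw a b) (R 0, Cap) F)) (x # xs) (y # ys)"
  by (cases x; cases y) (simp_all add: sum_bool flip_def cupw_def capw_def power2_inv[OF assms] algebra_simps)

lemma ev2_normalise:
  assumes ab: "a * b = (1::'r::comm_ring_1)" and wf: "wfs 0 u n1" "trav_after p n1 n2" "trav_after p' n3 n4"
  shows "ev2 (\<lambda>_. bw a b) (double (lft u @ (Axis, p) # lft m @ (Axis, p') # lft v)) eps2 [] [] =
    ev2 (\<lambda>_. bw a b) (double (lft u @ (Axis, Cup) # lft (norm_mid p m p') @ (Axis, Cap) # lft v)) eps2 [] []"
proof -
  let ?E = "ev2 (\<lambda>_. bw a b)"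
  have end_eq: "?E (double ((Axis, p') # lft v)) eps2 =
      ?E (double (lft (if p' = Cup then [(0, Cup)] else []) @ (Axis, Cap) # lft v)) eps2"
    using wf(3) axact_Cup_straight[OF ab, of "?E (double (lft v)) eps2"]
    by (cases p') (simp_all del: axact.simps)
  have "?E (double (lft u @ (Axis, p) # lft m @ (Axis, p') # lft v)) eps2 [] [] =
    ?E (double (lft u)) (?E (double ((Axis, p) # lft m)) (?E (double ((Axis, p') # lft v)) eps2)) [] []"
    by simp
  also have "\<dots> = ?E (double (lft u)) (?E (double ((Axis, Cup) # lft (if p = Cap then [(0, Cap)] else []) @ lft m))
      (?E (double ((Axis, p') # lft v)) eps2)) [] []"
  proof (rule ev2_cong[of _ _ _ n1 n1])
    show "wf2 (length []) (length []) (double (lft u)) n1 n1" using wf2_double_lft[OF wf(1)] by simp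
    fix xs ys :: "bool list" assume len: "length xs = n1" "length ys = n1"
    show "?E (double ((Axis, p) # lft m)) (?E (double ((Axis, p') # lft v)) eps2) xs ys =
      ?E (double ((Axis, Cup) # lft (if p = Cap then [(0, Cap)] else []) @ lft m)) (?E (double ((Axis, p') # lft v)) eps2) xs ys"
    proof (cases p)
      case Cap
      then obtain x xs' y ys' where "xs = x # xs'" "ys = y # ys'" using len wf(2) by (cases xs; cases ys) auto
      then show ?thesis using axact_Cap_straight[OF ab] by (simp add: Cap del: axact.simps)
    qed (use wf(2) in auto)
  qed
  also have "\<dots> = ?E (double (lft u @ (Axis, Cup) # lft (norm_mid p m p') @ (Axis, Cap) # lft v)) eps2 [] []"
    unfolding end_eq by (simp add: norm_mid_def)
  finally show ?thesis .
qed

lemma evf_replace1: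
  assumes "wfs n (u @ x @ v) m" "length xs = n"
    and "\<And>k l xs \<phi>. wfs k x l \<Longrightarrow> length xs = k \<Longrightarrow> evf (tag w x) \<phi> xs = evf (tag w y) \<phi> xs"
  shows "evf (tag w (u @ x @ v)) \<phi> xs = evf (tag w (u @ y @ v)) \<phi> xs"
  using evf_replace[OF assms(1,2), of w 1 y \<phi>] assms(3) by simp

text \<open>On one side, an extremum inserted by \<open>norm_mid\<close> forms a zigzag with the new
  vertical strand, and straightening it recovers the partial diagram.\<close>

lemma evf_normalise:
  assumes z: "zigzag w d" and wf: "wfs 0 u n1" "trav_after p n1 n2" "wfs n2 m n3" "trav_after p' n3 n4" "wfs n4 v 0"
  shows "evf (tag w (u @ [(0, Cup)] @ shift (norm_mid p m p') @ [(0, Cap)] @ v)) eps [] =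
    evf (tag w (partial_list u p m p' v)) eps []"
proof -
  let ?c = "if p = Cup then [(0, Cup)] else []" and ?c' = "if p' = Cap then [(0, Cap)] else []"
  let ?e = "if p' = Cup then [(Suc 0, Cup)] else []"
  have st1: "evf (tag w [(0, Cup), (Suc 0, Cap)]) \<phi> xs = evf (tag w []) \<phi> xs"
    if "wfs k [(0, Cup), (Suc 0, Cap)] l" "length xs = k" for k l xs \<phi>
  proof -
    have "0 < length xs" using that by auto
    from evf_straighten(1)[OF z this] show ?thesis by (simp only: tag_simps(1) evf.simps(1))
  qed
  have st2: "evf (tag w [(Suc 0, Cup), (0, Cap)]) \<phi> xs = evf (tag w []) \<phi> xs"
    if "wfs k [(Suc 0, Cup), (0, Cap)] l" "length xs = k" for k l xs \<phi>
  proof -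
    have "0 < length xs" using that by auto
    from evf_straighten(2)[OF z this] show ?thesis by (simp only: tag_simps(1) evf.simps(1))
  qed
  have mid: "wfs (Suc n2) (shift m) (Suc n3)" using wfs_shift[OF wf(3)] .
  have wf1: "wfs 0 (u @ [(0, Cup), (Suc 0, Cap)] @ (shift m @ ?e @ [(0, Cap)] @ v)) 0" if "p = Cap"
  proof -
    have "wfs (Suc n3) (?e @ [(0, Cap)] @ v) 0" using wf(4,5) by (cases p') auto
    then have "wfs (Suc n2) (shift m @ ?e @ [(0, Cap)] @ v) 0" using mid wfs_append by blast
    then have "wfs n1 ([(0, Cup), (Suc 0, Cap)] @ (shift m @ ?e @ [(0, Cap)] @ v)) 0" using wf(2) that by simp
    then show ?thesis using wf(1) wfs_append by blast
  qed
  have "evf (tag w (u @ [(0, Cup)] @ shift (norm_mid p m p') @ [(0, Cap)] @ v)) eps [] =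
    evf (tag w (u @ ?c @ shift m @ ?e @ [(0, Cap)] @ v)) eps []"
  proof (cases "p = Cap")
    case True
    have "evf (tag w (u @ [(0, Cup), (Suc 0, Cap)] @ (shift m @ ?e @ [(0, Cap)] @ v))) eps [] =
      evf (tag w (u @ [] @ (shift m @ ?e @ [(0, Cap)] @ v))) eps []"
      by (rule evf_replace1[OF wf1[OF True] _ st1]) simp_all
    then show ?thesis using True by (cases "p' = Cup") (simp_all add: norm_mid_def)
  next
    case False
    then show ?thesis using wf(2) by (cases p) (auto simp: norm_mid_def)
  qed
  also have "\<dots> = evf (tag w (partial_list u p m p' v)) eps []"
  proof (cases "p' = Cup")
    case True
    have wf2: "wfs 0 ((u @ ?c @ shift m) @ [(Suc 0, Cup), (0, Cap)] @ v) 0"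
      using wf mid True by (cases p) (auto simp: wfs_append)
    have "evf (tag w ((u @ ?c @ shift m) @ [(Suc 0, Cup), (0, Cap)] @ v)) eps [] =
      evf (tag w ((u @ ?c @ shift m) @ [] @ v)) eps []"
      by (rule evf_replace1[OF wf2 _ st2]) simp_all
    then show ?thesis using True by (simp add: partial_list_def)
  next
    case False
    then show ?thesis using wf(4) by (cases p') (auto simp: partial_list_def)
  qed
  finally show ?thesis .
qed

lemma mir_norm_mid: "mir (norm_mid p m p') = norm_mid p (mir m) p'"
  by (simp add: norm_mid_def)

lemma mir_partial_list: "mir (partial_list u p m p' v) = partial_list (mir u) p (mir m) p' (mir v)"
  by (simp add: partial_list_def mir_shift)

text \<open>If the sides act by scalars k and k', the joined diagram is k k' times one circle, while
  the two partial knots are k and k' times a circle each. This explains the single additional circle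
  value on the left.\<close>

lemma reduced_product:
  fixes a :: "'r::field"
  assumes a: "a \<noteq> 0" and T: "wf_half 0 T" and split: "smooth_axis_vertically T = lft u @ (Axis, p) # lft m @ (Axis, p') # lft v"
    and wf: "wfs 0 u n1" "trav_after p n1 n2" "wfs n2 m n3" "trav_after p' n3 n4" "wfs n4 v 0"
    and P: "P = partial_list u p m p' v" "wfs 0 P 0"
  shows "reduced a (0, 0) (double T) * circle a = bracket a (forget_axis (lft P)) * bracket a (mir P)"
proof -
  define b where "b = inverse a"
  have ab: "a * b = 1" using a by (simp add: b_def)
  note mid = wfs_norm_mid[OF wf(2,3,4)]
  have wfm: "wfs 0 (mir u) n1" "wfs (Suc n1) (mir (norm_mid p m p')) (Suc n4)" "wfs n4 (mir v) 0"
    "wfs n2 (mir m) n3" using wf mid by auto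
  obtain k where k: "\<And>c h. amplitude (flipped (bw a b)) u (norm_mid p m p') v c h = k * of_bool (c = h)"
    using amplitude_scalar[OF wf(1) mid wf(5) bracket_scalar_flipped[OF ab]] by blast
  obtain k' where k': "\<And>c h. amplitude (bw a b) (mir u) (mir (norm_mid p m p')) (mir v) c h = k' * of_bool (c = h)"
    using amplitude_scalar[OF wfm(1,2,3) bracket_scalar[OF ab]] by blast
  have "reduced a (0, 0) (double T) = ev2 (\<lambda>_. bw a b) (double (smooth_axis_vertically T)) eps2 [] []"
    unfolding reduced_def b_def using ev2_smooth[of "[]" T "[]"] T by simp
  also have "\<dots> = k * k' * (- (a\<^sup>2) - b\<^sup>2)"
    unfolding split ev2_normalise[OF ab wf(1,2,4)]
    by (rule ev2_two_traversals[OF ab wf(1) mid wf(5) k k'])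
  finally have red: "reduced a (0, 0) (double T) = k * k' * circle a" by (simp add: b_def)
  have "bracket a (forget_axis (lft P)) = k * (- (a\<^sup>2) - b\<^sup>2)"
    unfolding P(1) ev_forget_lft[OF P(2)[unfolded P(1)]] b_def[symmetric] evf_normalise[OF zigzag_bw(2)[OF ab] wf, symmetric]
    by (rule ev_closed_amplitude[OF wf(1) mid k zigzag_bw(2)[OF ab]])
  moreover have "bracket a (mir P) = k' * (- (a\<^sup>2) - b\<^sup>2)"
    unfolding ev_def P(1) b_def[symmetric] mir_partial_list
      evf_normalise[OF zigzag_bw(1)[OF ab] wfm(1) wf(2) wfm(4) wf(4) wfm(3), symmetric] mir_norm_mid[symmetric]
    by (rule ev_closed_amplitude[OF wfm(1,2) k' zigzag_bw(1)[OF ab]])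
  ultimately show ?thesis unfolding red by (simp only: b_def mult_ac)
qed

subsection \<open>The polynomial W\<close>

lemma snd_forget_from: "map snd (forget_from a D) = map snd D"
  by (induction a D rule: forget_from.induct) auto

lemma snd_forget_nth: "l < length D \<Longrightarrow> snd (forget_axis D ! l) = snd (D ! l)"
  by (metis forget_axis_def length_forget_from nth_map snd_forget_from)

lemma knot_symmetric_union_turns:
  assumes K: "knot_diagram (forget_axis D)" and "symmetric_union D"
  shows "turns D = 2"
proof -
  let ?F = "forget_axis D"
  note L = knot_link[OF K]
  have len: "length ?F = length D" by (simp add: forget_axis_def)
  obtain C where C: "components ?F = {C}" using K by (auto simp: knot_diagram_def card_1_singleton_iff)
  have "traversal_point D l \<in> C" if l: "l \<in> traversals D" for l
  proof -
    obtain i p where ip: "?F ! l = (i, p)" by (cases "?F ! l")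
    have "l < length D" "\<not> is_crossing p"
      using l ip snd_forget_nth[of l D] by (auto simp: traversals_def)
    then have "p = Cup \<or> p = Cap" by (cases p) auto
    then have "\<exists>y. (traversal_point D l, y) \<in> edges ?F"
      using \<open>l < length D\<close> ip len by (fastforce simp: edges_def turning_def traversal_point_def)
    then have "traversal_point D l \<in> points ?F" using edges_points[OF L] by blast
    then show ?thesis using component_of[of _ ?F] in_component[of "traversal_point D l" ?F] C by blast
  qed
  then have "{l \<in> traversals D. traversal_point D l \<in> C} = traversals D" by blast
  then show ?thesis using assms(2) C card_traversals[of D] by (simp add: symmetric_union_def)
qed

text \<open>Here \<open>x\<close> stands for s, in which the parameters are -1 - 1/s and -1 - s. The
  polynomial does not depend on \<open>x\<close>, so it can be identified at the generic value and
  evaluated at others.\<close>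

lemma polyf_laurent2:
  assumes "f \<in> polyf"
  shows "\<exists>W. \<forall>x. x \<noteq> 0 \<longrightarrow> subst2 W x (var_A powi (- 4)) = f (- 1 - inverse x, - 1 - x)"
proof -
  define y where "y = var_A powi (- 4)"
  have y: "y * inverse y = 1" by (simp add: y_def)
  define u where "u = (\<lambda>x. \<lambda>(i, j). unit_power x i * unit_power y j)"
  have u: "mhom (u x)" if "x \<noteq> 0" for x unfolding u_def by (rule mhom_power2[of x "inverse x", OF _ y]) (use that in simp)
  have "\<exists>W. \<forall>x. x \<noteq> 0 \<longrightarrow> subst (u x) W = f (- 1 - inverse x, - 1 - x)"
    using assms
  proof (induction rule: polyf.induct)
    case (polyf_const c)
    then obtain V where V: "c = subst1 V y" by (auto simp: laurent_A_def y_def)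
    have "subst (u x) (subst (\<lambda>j. Poly_Mapping.single (0, j) 1) V) = c" if "x \<noteq> 0" for x
      unfolding subst_comp[OF u[OF that]] V subst1_eq by (simp add: subst_single u_def)
    then show ?case by blast
  next
    case polyf_fst
    have "subst (u x) (- 1 - Poly_Mapping.single (- 1, 0) 1) = - 1 - inverse x" if "x \<noteq> 0" for x
      using that u[OF that] by (simp add: subst_diff subst_uminus subst_single) (simp add: u_def unit_power_field power_int_minus)
    then show ?case by auto
  next
    case polyf_snd
    have "subst (u x) (- 1 - Poly_Mapping.single (1, 0) 1) = - 1 - x" if "x \<noteq> 0" for x
      using that u[OF that] by (simp add: subst_diff subst_uminus subst_single) (simp add: u_def unit_power_field)
    then show ?case by auto
  next
    case (polyf_add f g)
    then obtain V W where "\<forall>x. x \<noteq> 0 \<longrightarrow> subst (u x) V = f (- 1 - inverse x, - 1 - x)"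
      "\<forall>x. x \<noteq> 0 \<longrightarrow> subst (u x) W = g (- 1 - inverse x, - 1 - x)" by blast
    then show ?case by (intro exI[of _ "V + W"]) (simp add: subst_add)
  next
    case (polyf_mult f g)
    then obtain V W where "\<forall>x. x \<noteq> 0 \<longrightarrow> subst (u x) V = f (- 1 - inverse x, - 1 - x)"
      "\<forall>x. x \<noteq> 0 \<longrightarrow> subst (u x) W = g (- 1 - inverse x, - 1 - x)" by blast
    then show ?case by (intro exI[of _ "V * W"]) (simp add: subst_mult u)
  qed
  then show ?thesis by (simp add: subst2_eq u_def y_def)
qed

definition parity_sign :: "int \<Rightarrow> int" where "parity_sign k = (if even k then 1 else - 1)"

lemma parity_sign_powi: "of_int (parity_sign k) = (- 1 :: 'r::field) powi k"
  by (simp add: parity_sign_def power_int_minus_left)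

lemma parity_sign_square: "of_int (parity_sign k) * (- 1) powi k = (1 :: 'r::field)"
  by (simp add: parity_sign_def power_int_minus_left)

text \<open>The left factor comes from the reduction of the bracket and the right one from the
  crossing signs. As both have the same exponent up to sign, they combine to a signed power of
  b^-4.\<close>

lemma sign_normalisation:
  assumes "b \<noteq> (0::'r::field)"
  shows "b powi (- k) * (- (b powi (- 3))) powi k = of_int (parity_sign k) * (b powi (- 4)) powi k"
proof -
  have "(- (b powi (- 3))) powi k = (- 1) powi k * (b powi (- 3)) powi k"
    using power_int_mult_distrib[of "- 1" "b powi (- 3)" k] by simp
  moreover have "b powi (- k) * (b powi (- 3)) powi k = (b powi (- 4)) powi k"
    unfolding power_int_mult[symmetric] by (subst power_int_add[symmetric]) (use assms in \<open>auto simp: algebra_simps\<close>)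
  ultimately show ?thesis by (simp add: parity_sign_powi mult.left_commute)
qed

text \<open>The right side makes sense for every nonzero s, also where the defining formula
  degenerates. Uniqueness at the generic point s = B^-4 identifies the polynomial behind it with
  \<open>W_poly\<close>.\<close>

lemma W_poly_values:
  assumes "symmetric_union D" and K: "knot_diagram (forget_axis D)"
  defines "T \<equiv> filter not_right D"
  shows "\<And>x. x \<noteq> 0 \<Longrightarrow> subst2 (W_poly D) x (var_A powi (- 4)) = of_int (parity_sign (beta D)) * x powi beta D *
    (inverse dA * reduced var_A (- 1 - inverse x, - 1 - x) (double T))"
proof -
  have sym: "symmetric D" using assms(1) by (simp add: symmetric_union_def)
  then have wf: "wf2 0 0 D 0 0" and sh: "same_halves (switch_on_axis (reflect D)) D"
    by (auto simp: symmetric_def wf_axis_wf2)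
  have t: "turns D = 2" using knot_symmetric_union_turns[OF K assms(1)] .
  have T: "wf_half 0 T" "turns T = 2" using wf_half_left[OF wf] t by (auto simp: T_def axis_sums_left)
  have b: "beta D = axis_signs D" using symmetric_beta[OF K sym] t by simp
  let ?k = "beta D" and ?y = "var_A powi (- 4)"
  obtain W0 where W0: "\<And>x. x \<noteq> 0 \<Longrightarrow> subst2 W0 x ?y = inverse dA * reduced var_A (- 1 - inverse x, - 1 - x) (double T)"
    using polyf_laurent2[OF reduced_polyf[OF T]] by blast
  define W where "W = Poly_Mapping.single (?k, 0) (parity_sign ?k) * W0"
  have W: "subst2 W x ?y = of_int (parity_sign ?k) * x powi ?k * (inverse dA * reduced var_A (- 1 - inverse x, - 1 - x) (double T))"
    if "x \<noteq> 0" for x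
  proof -
    have "mhom (\<lambda>(i, j). unit_power x i * unit_power ?y j)"
      by (rule mhom_power2[of x "inverse x" ?y "inverse ?y"]) (use that in auto)
    then show ?thesis unfolding W0[OF that, symmetric] W_def subst2_eq
      by (simp add: subst_mult subst_single unit_power_field that)
  qed
  have red: "reduced var_A q D = reduced var_A q (double T)" for q
    unfolding reduced_def T_def by (simp only: ev2_same_halves[OF same_halves_double[OF sh]])
  have bracket: "axis_bracket D = var_B powi (- ?k) *
      (inverse dA * reduced var_A (- 1 - var_B powi 4, - 1 - var_B powi (- 4)) (double T))"
  proof -
    have "axis_bracket D = inverse dA * ev2 (axw var_A (inverse var_A) (var_B * (circle var_B / circle var_A), inverse var_B)
      (inverse var_B * (circle var_B / circle var_A), var_B)) D eps2 [] []"
      using axis_bracket_from_eq[of "[]" D] wf t by (simp add: axis_bracket_def power_int_minus)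
    then show ?thesis using ev2_reduced[OF var_B_0, where D = D] by (simp add: red b mult.left_commute)
  qed
  have "subst2 W (var_B powi (- 4)) ?y =
      axis_bracket D * (- (var_A powi (- 3))) powi alpha D * (- (var_B powi (- 3))) powi beta D"
  proof -
    have x: "var_B powi (- 4) \<noteq> 0" by simp
    have i: "inverse (var_B powi (- 4)) = var_B powi 4" by (simp add: power_int_minus)
    have "subst2 W (var_B powi (- 4)) ?y = (var_B powi (- ?k) * (- (var_B powi (- 3))) powi ?k) *
      (inverse dA * reduced var_A (- 1 - var_B powi 4, - 1 - var_B powi (- 4)) (double T))"
      unfolding W[OF x] i sign_normalisation[OF var_B_0] ..
    then show ?thesis unfolding bracket symmetric_alpha[OF K sym] by (simp only: power_int_0_right mult_1_right mult_ac)
  qed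
  then have "W_poly D = W"
    unfolding W_poly_def by (intro the_equality) (auto intro: subst2_inject)
  then show "subst2 (W_poly D) x ?y = of_int (parity_sign ?k) * x powi ?k *
    (inverse dA * reduced var_A (- 1 - inverse x, - 1 - x) (double T))" if "x \<noteq> 0" for x
    using W[OF that] by simp
qed

lemma subst1_comp:
  assumes "x * x' = (1::laurent)" "y * y' = 1"
  shows "subst1 (subst1 V x) y = subst1 V (subst1 x y)"
  using assms by (simp add: subst1_eq subst_comp mhom_power subst_unit_power)

lemma minus_one_unit: "(- 1) * (- 1) = (1::'r::comm_ring_1)" by simp

lemma subst1_minus_one: assumes "y * y' = (1::'r::comm_ring_1)" shows "subst1 (- 1) y = - 1"
  using mhom_power[OF assms] by (simp add: subst1_eq subst_uminus)

lemma knots_knot_diagram: "K \<in> knots \<Longrightarrow> D \<in> K \<Longrightarrow> knot_diagram D"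
  by (auto simp: knots_def quotient_def)

lemma jones_diagonal:
  assumes "symmetric_union D" "K \<in> knots" "forget_axis D \<in> K"
  shows "subst2 (W_poly D) var_t var_t = jones K"
proof (rule sym, rule jones_eqI[OF assms(2,3)])
  note K = knots_knot_diagram[OF assms(2,3)]
  have sm: "symmetric D" using assms(1) by (simp add: symmetric_union_def)
  then have wf: "wf_axis_from 0 0 D" and sh: "same_halves (switch_on_axis (reflect D)) D"
    by (auto simp: symmetric_def)
  have t: "turns D = 2" using knot_symmetric_union_turns[OF K assms(1)] .
  let ?k = "beta D" and ?y = "var_A powi (- 4)"
  have y: "?y \<noteq> 0" by simp
  have b: "axis_signs D = ?k" using symmetric_beta[OF K sm] t by simp
  let ?R = "reduced var_A (- 1 - inverse ?y, - 1 - ?y) (double (filter not_right D))"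
  have i: "inverse ?y = var_A powi 4" by (simp add: power_int_minus)
  have "bracket var_A (forget_axis D) = ev2 (axw var_A (inverse var_A) (var_A, inverse var_A) (inverse var_A, var_A)) D eps2 [] []"
    unfolding axw_uniform by (rule ev2_uniform[OF wf, symmetric])
  \<comment> \<open>For b = A the ratio of the circle values is 1, so the ordinary bracket is an
    instance of the reduction.\<close>
  also have "\<dots> = var_A powi (- ?k) * reduced var_A (- 1 - var_A powi 4, - 1 - ?y) D"
    unfolding b[symmetric] by (rule ev2_reduced) (use circle_nonzero(1) in \<open>simp_all\<close>)
  also have "reduced var_A (- 1 - var_A powi 4, - 1 - ?y) D = ?R"
    unfolding reduced_def i by (simp only: ev2_same_halves[OF same_halves_double[OF sh]])
  finally have "bracket var_A (forget_axis D) * (- (var_A powi (- 3))) powi ?k =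
      (var_A powi (- ?k) * (- (var_A powi (- 3))) powi ?k) * ?R" by (simp only: mult_ac)
  also have "\<dots> = dA * subst2 (W_poly D) ?y ?y"
  proof -
    have cancel: "c * r = d * (c * (inverse d * r))" if "d \<noteq> 0" for c d r :: ratfun using that by simp
    show ?thesis unfolding sign_normalisation[OF var_A_0] W_poly_values[OF assms(1) K y]
      by (rule cancel[OF circle_nonzero(1)])
  qed
  also have "subst2 (W_poly D) ?y ?y = subst1 (subst2 (W_poly D) var_t var_t) ?y"
    using subst1_subst2[OF var_t_unit var_t_unit, of ?y "inverse ?y" "W_poly D"] subst1_simps(8)[OF y] by simp
  finally show "bracket var_A (forget_axis D) * (- (var_A powi (- 3))) powi writhe (forget_axis D) =
      dA * subst1 (subst2 (W_poly D) var_t var_t) ?y"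
    using writhe_alpha_beta[of D] symmetric_alpha[OF K sm] by simp
qed

lemma minus_powi_3_inverse:
  assumes "a \<noteq> (0::'r::field)" shows "(- (inverse a powi (- 3))) powi k = (- (a powi (- 3))) powi (- k)"
proof -
  have "- (inverse a powi (- 3)) = inverse (- (a powi (- 3)))"
    by (simp add: power_int_inverse)
  then show ?thesis by (simp only: power_int_inverse power_int_minus)
qed

lemma jones_partial_knots:
  assumes "symmetric_union D" and K: "knot_diagram (forget_axis D)"
    and m: "K_minus \<in> knots" "partial_minus D \<in> K_minus" and p: "K_plus \<in> knots" "partial_plus D \<in> K_plus"
  shows "subst2 (W_poly D) (- 1) var_t = jones K_minus * jones K_plus"
    and "subst1 (jones K_minus) (- 1 :: int) = subst1 (jones K_plus) (- 1)"
proof -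
  have sm: "symmetric D" using assms(1) by (simp add: symmetric_union_def)
  then have wf: "wf2 0 0 D 0 0" and sh: "same_halves (switch_on_axis (reflect D)) D"
    by (auto simp: symmetric_def wf_axis_wf2)
  define T where "T = filter not_right D"
  have T: "wf_half 0 T" "turns T = 2"
    using wf_half_left[OF wf] knot_symmetric_union_turns[OF K assms(1)] by (auto simp: T_def axis_sums_left)
  have left: "filter not_left D = map conj_event T"
  proof -
    have "filter not_left (map conj_event D) = map conj_event (filter not_right D)" for D
    proof (induction D)
      case (Cons e D)
      then show ?case by (cases e; cases "fst e") auto
    qed simp
    then show ?thesis using sh by (simp add: same_halves_iff switch_reflect T_def)
  qed
  obtain u c m' c' v n1 n2 n3 n4 where split:
    "smooth_axis_vertically T = lft u @ (Axis, c) # lft m' @ (Axis, c') # lft v"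
    and w: "wfs 0 u n1" "trav_after c n1 n2" "wfs n2 m' n3" "trav_after c' n3 n4" "wfs n4 v 0"
    and c: "\<not> is_crossing c" "\<not> is_crossing c'"
    using two_traversals[OF T] by metis
  define P where "P = partial_list u c m' c' v"
  note parts = partial_diagrams[OF left T_def split c, folded P_def]
  have kn: "knot_diagram (partial_minus D)" "knot_diagram (mir P)"
    using knots_knot_diagram m p parts(2) by auto
  have P: "wfs 0 P 0" using knot_link[OF kn(2)] by (simp add: link_diagram_def wf_from_wfs)
  let ?y = "var_A powi (- 4)"
  have y: "?y \<noteq> 0" by simp
  define q where "q = - (var_A powi (- 3))"
  obtain Vm where Vm: "bracket var_A (partial_minus D) * q powi writhe (partial_minus D) = dA * subst1 Vm ?y"
    using knot_laurent[OF kn(1), where 'r = ratfun] unfolding q_def by (meson var_A_0)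
  obtain Vp where Vp: "\<And>a::ratfun. a \<noteq> 0 \<Longrightarrow> bracket a (mir P) * (- (a powi (- 3))) powi writhe (mir P) = circle a * subst1 Vp (a powi (- 4))"
    using knot_laurent[OF kn(2), where 'r = ratfun] by blast
  note Vp1 = Vp[OF var_A_0, folded q_def]
  have jm: "jones K_minus = Vm" using jones_eqI[OF m] Vm by (simp add: q_def)
  have jp: "jones K_plus = Vp" using jones_eqI[OF p] Vp1 parts(2) by (simp add: q_def)
  have wr: "writhe (partial_minus D) = - writhe (mir P)"
    using writhe_mirror[OF P] kn parts(1) by simp
  have q0: "q \<noteq> 0" by (simp add: q_def)
  \<comment> \<open>The writhes of mirror images cancel, so both normalising factors can be inserted
    without changing the product.\<close>
  have qq: "q powi writhe (partial_minus D) * q powi writhe (mir P) = 1"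
    unfolding wr using q0 by (simp add: power_int_minus)

  show "subst2 (W_poly D) (- 1) var_t = jones K_minus * jones K_plus"
  proof (rule subst1_inject)
    have "subst1 (subst2 (W_poly D) (- 1) var_t) ?y = subst2 (W_poly D) (- 1) ?y"
      using subst1_subst2[OF minus_one_unit var_t_unit, of ?y "inverse ?y" "W_poly D"]
        subst1_simps(8)[OF y] subst1_minus_one[of ?y "inverse ?y"] by simp
    \<comment> \<open>At s = -1 both horizontal coefficients vanish, and the sign cancels against
      the power of s.\<close>
    also have "\<dots> = inverse dA * reduced var_A (0, 0) (double T)"
      using W_poly_values[OF assms(1) K, of "- 1"] by (simp add: parity_sign_square T_def)
    also have "\<dots> = subst1 Vm ?y * subst1 Vp ?y"
    proof -
      have "reduced var_A (0, 0) (double T) * dA = bracket var_A (partial_minus D) * bracket var_A (mir P)"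
        using reduced_product[OF var_A_0 T(1) split w P_def P] parts(1) by simp
      also have "\<dots> = bracket var_A (partial_minus D) * bracket var_A (mir P) *
          (q powi writhe (partial_minus D) * q powi writhe (mir P))" by (simp only: qq mult_1_right)
      also have "\<dots> = (dA * subst1 Vm ?y) * (dA * subst1 Vp ?y)"
        unfolding Vm[symmetric] Vp1[symmetric] by (simp only: mult_ac)
      finally have *: "reduced var_A (0, 0) (double T) * dA = (dA * subst1 Vm ?y) * (dA * subst1 Vp ?y)" .
      have "inverse d * r = v * v'" if "r * d = (d * v) * (d * v')" "d \<noteq> 0" for r d v v' :: ratfun
        using that by (simp add: field_simps)
      from this[OF * circle_nonzero(1)] show ?thesis .
    qed
    finally show "subst1 (subst2 (W_poly D) (- 1) var_t) ?y = subst1 (jones K_minus * jones K_plus) ?y"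
      unfolding jm jp subst1_simps(3)[OF y] .
  qed

  \<comment> \<open>\<open>t'\<close> is 1/t. The Jones polynomials of the partial knots differ by
    this substitution, which fixes t = -1.\<close>
  define t' :: laurent where "t' = Poly_Mapping.single (- 1) 1"
  have t': "t' * var_t = 1" using var_t_unit by (simp add: t'_def mult.commute)
  have "subst1 Vm ?y = subst1 (subst1 Vp t') ?y"
  proof -
    have "dA * subst1 Vm ?y = bracket (inverse var_A) (mir P) * q powi writhe (partial_minus D)"
      using Vm bracket_mirror[OF P var_A_0] parts(1) by simp
    also have "\<dots> = circle (inverse var_A) * subst1 Vp (inverse var_A powi (- 4))"
      using Vp[of "inverse var_A"] by (simp only: minus_powi_3_inverse[OF var_A_0] wr q_def) simp
    also have "inverse var_A powi (- 4) = inverse ?y" by (simp add: power_int_inverse)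
    also have "circle (inverse var_A) = dA" by simp
    finally have "subst1 Vm ?y = subst1 Vp (inverse ?y)" using mult_left_cancel[OF circle_nonzero(1)] by blast
    moreover have "subst1 t' ?y = inverse ?y"
      using subst1_simps(7)[OF y, of "- 1" 1] by (simp add: t'_def power_int_minus)
    ultimately show ?thesis using subst1_comp[OF t', of ?y "inverse ?y" Vp] by simp
  qed
  then have "Vm = subst1 Vp t'" by (rule subst1_inject)
  moreover have "subst1 t' (- 1 :: int) = - 1"
    using unit_power_neg[OF minus_one_unit, of 1, where 'a = int] by (simp add: t'_def subst1_eq subst_single)
  ultimately show "subst1 (jones K_minus) (- 1 :: int) = subst1 (jones K_plus) (- 1)"
    unfolding jm jp using subst1_comp[OF t' minus_one_unit, of Vp, where 'a = int] by simp
qed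

theorem proposition1p11:
  fixes K K_minus K_plus :: knot and D :: axis_diagram
  assumes "symmetric_union D"
    and "K \<in> knots" and "forget_axis D \<in> K"
    and "K_minus \<in> knots" and "partial_minus D \<in> K_minus"
    and "K_plus \<in> knots" and "partial_plus D \<in> K_plus"
  shows "subst2 (W_poly D) var_t var_t = jones K
    \<and> subst2 (W_poly D) (- 1) var_t = jones K_minus * jones K_plus
    \<and> subst2 (W_poly D) (- 1) (- 1) = knot_det K
    \<and> knot_det K = knot_det K_minus * knot_det K_plus"
proof -
  note diag = jones_diagonal[OF assms(1-3)]
  note part = jones_partial_knots[OF assms(1) knots_knot_diagram[OF assms(2,3)] assms(4-7)]
  have m: "mhom (unit_power (- 1 :: int))" by (rule mhom_power[OF minus_one_unit])
  \<comment> \<open>The common value at -1 of the Jones polynomials of both partial knots. All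
    quantities in question equal its square, so the absolute values in the determinants do no
    harm.\<close>
  define s where "s = subst1 (jones K_plus) (- 1 :: int)"
  have "subst2 (W_poly D) (- 1) (- 1 :: int) = subst1 (subst2 (W_poly D) (- 1) var_t) (- 1)"
    using subst1_subst2[OF minus_one_unit var_t_unit minus_one_unit, of "W_poly D", where 'a = int]
      subst1_var_t[OF m] subst1_minus_one[OF minus_one_unit, where 'r = int] by simp
  also have "\<dots> = s * s" using m part(2) unfolding part(1) s_def by (simp add: subst1_eq subst_mult)
  finally have W: "subst2 (W_poly D) (- 1) (- 1 :: int) = s * s" .
  have "subst1 (jones K) (- 1 :: int) = subst2 (W_poly D) (- 1) (- 1)"
    using subst1_subst2[OF var_t_unit var_t_unit minus_one_unit, of "W_poly D", where 'a = int]
      subst1_var_t[OF m] diag by simp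
  then have "knot_det K = s * s" using W by (simp add: knot_det_def)
  moreover have "knot_det K_minus * knot_det K_plus = s * s"
    using part(2) by (simp add: knot_det_def s_def)
  ultimately show ?thesis using diag part(1) W by simp
qed

end
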